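(* Let $M$ be an abelian group. The contravariant functor $G \mapsto H^3_{2\text{-ab}}(G,M)$ on abelian groups takes filtered colimits to limits: for every filtered system $(G_i)$ of abelian groups (with index category of arbitrary cardinality), the canonical map is an isomorphism $$H^3_{2\text{-ab}}\left(\varinjlim G_i, M\right) \cong \varprojlim H^3_{2\text{-ab}}(G_i, M).$$
   Context: All groups are abelian and written additively. $H^3_{2\text{-ab}}(G,M):=H^{4}(K(G,2),M)$, where $K(G,2)$ is an Eilenberg-Mac Lane space. Explicitly it is described as follows. A (standard) 3-cocycle on $G$ with values in $M$ (trivial action) is a function $h:G^3\to M$ with $h(g_1,g_2,g_3) + h(g_1,g_2+g_3,g_4) + h(g_2,g_3,g_4) = h(g_1+g_2,g_3,g_4) + h(g_1,g_2,g_3+g_4)$. For $k:G^2\to M$ put $(\delta k)(g_1,g_2,g_3)=k(g_2,g_3)-k(g_1+g_2,g_3)+k(g_1,g_2+g_3)-k(g_1,g_2)$. A 2-abelian 3-cocycle is a pair $(h,c)$ with $h$ a standard 3-cocycle and $c:G^2\to M$ a function such that for all $x,y,z\in G$: $h(y,z,x)+c(x,y+z)+h(x,y,z)=c(x,z)+h(y,x,z)+c(x,y)$ and $-h(z,x,y)+c(x+y,z)-h(x,y,z)=c(x,z)-h(x,z,y)+c(y,z)$. These form a group $Z^3_{2\text{-ab}}(G,M)$; the subgroup $B^3_{2\text{-ab}}(G,M)$ consists of the pairs $(\delta k, c_k)$, $k:G^2\to M$ any function, $c_k(x,y)=k(y,x)-k(x,y)$; and $H^3_{2\text{-ab}}(G,M)=Z^3_{2\text{-ab}}(G,M)/B^3_{2\text{-ab}}(G,M)$.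 A homomorphism $G\to G'$ acts contravariantly by pulling back $(h,c)$. *)

theory Defs
  imports "HOL-Algebra.Product_Groups"
begin

text \<open>Abelian groups are \<open>comm_group\<close> records of HOL-Algebra, hence written multiplicatively.\<close>

section \<open>2-abelian 3-cocycles\<close>

definition cocycle3 :: "('a, 'x) monoid_scheme \<Rightarrow> ('m, 'y) monoid_scheme \<Rightarrow> ('a \<times> 'a \<times> 'a \<Rightarrow> 'm) \<Rightarrow> bool"
  where "cocycle3 G M h \<longleftrightarrow>
    (\<forall>g\<^sub>1\<in>carrier G. \<forall>g\<^sub>2\<in>carrier G. \<forall>g\<^sub>3\<in>carrier G. \<forall>g\<^sub>4\<in>carrier G.
       h (g\<^sub>1, g\<^sub>2, g\<^sub>3) \<otimes>\<^bsub>M\<^esub> h (g\<^sub>1, g\<^sub>2 \<otimes>\<^bsub>G\<^esub> g\<^sub>3, g\<^sub>4) \<otimes>\<^bsub>M\<^esub> h (g\<^sub>2, g\<^sub>3, g\<^sub>4)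
       = h (g\<^sub>1 \<otimes>\<^bsub>G\<^esub> g\<^sub>2, g\<^sub>3, g\<^sub>4) \<otimes>\<^bsub>M\<^esub> h (g\<^sub>1, g\<^sub>2, g\<^sub>3 \<otimes>\<^bsub>G\<^esub> g\<^sub>4))"

definition hexagons ::
    "('a, 'x) monoid_scheme \<Rightarrow> ('m, 'y) monoid_scheme \<Rightarrow> ('a \<times> 'a \<times> 'a \<Rightarrow> 'm) \<Rightarrow> ('a \<times> 'a \<Rightarrow> 'm) \<Rightarrow> bool"
  where "hexagons G M h c \<longleftrightarrow>
    (\<forall>x\<in>carrier G. \<forall>y\<in>carrier G. \<forall>z\<in>carrier G.
       h (y, z, x) \<otimes>\<^bsub>M\<^esub> c (x, y \<otimes>\<^bsub>G\<^esub> z) \<otimes>\<^bsub>M\<^esub> h (x, y, z)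
         = c (x, z) \<otimes>\<^bsub>M\<^esub> h (y, x, z) \<otimes>\<^bsub>M\<^esub> c (x, y) \<and>
       inv\<^bsub>M\<^esub> h (z, x, y) \<otimes>\<^bsub>M\<^esub> c (x \<otimes>\<^bsub>G\<^esub> y, z) \<otimes>\<^bsub>M\<^esub> inv\<^bsub>M\<^esub> h (x, y, z)
         = c (x, z) \<otimes>\<^bsub>M\<^esub> inv\<^bsub>M\<^esub> h (x, z, y) \<otimes>\<^bsub>M\<^esub> c (y, z))"

text \<open>
  Cochains are extensional functions on the carrier of \<open>G\<close> (values outside the carrier are
  \<open>undefined\<close>), so that equality of cochains is equality on \<open>G\<close>.
\<close>

abbreviation carrier2 :: "('a, 'x) monoid_scheme \<Rightarrow> ('a \<times> 'a) set"
  where "carrier2 G \<equiv> carrier G \<times> carrier G"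

abbreviation carrier3 :: "('a, 'x) monoid_scheme \<Rightarrow> ('a \<times> 'a \<times> 'a) set"
  where "carrier3 G \<equiv> carrier G \<times> carrier G \<times> carrier G"

definition C3_2ab :: "('a, 'x) monoid_scheme \<Rightarrow> ('m, 'y) monoid_scheme
    \<Rightarrow> (('a \<times> 'a \<times> 'a \<Rightarrow> 'm) \<times> ('a \<times> 'a \<Rightarrow> 'm)) monoid"
  where "C3_2ab G M = product_group (carrier3 G) (\<lambda>_. M) \<times>\<times> product_group (carrier2 G) (\<lambda>_. M)"

definition Z3_2ab :: "('a, 'x) monoid_scheme \<Rightarrow> ('m, 'y) monoid_scheme
    \<Rightarrow> (('a \<times> 'a \<times> 'a \<Rightarrow> 'm) \<times> ('a \<times> 'a \<Rightarrow> 'm)) monoid"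
  where "Z3_2ab G M = (C3_2ab G M)
    \<lparr>carrier := {(h, c) \<in> carrier (C3_2ab G M). cocycle3 G M h \<and> hexagons G M h c}\<rparr>"

definition coboundary_2ab :: "('a, 'x) monoid_scheme \<Rightarrow> ('m, 'y) monoid_scheme
    \<Rightarrow> ('a \<times> 'a \<Rightarrow> 'm) \<Rightarrow> ('a \<times> 'a \<times> 'a \<Rightarrow> 'm) \<times> ('a \<times> 'a \<Rightarrow> 'm)"
  where "coboundary_2ab G M k =
    (\<lambda>(g\<^sub>1, g\<^sub>2, g\<^sub>3) \<in> carrier3 G. k (g\<^sub>2, g\<^sub>3) \<otimes>\<^bsub>M\<^esub> inv\<^bsub>M\<^esub> k (g\<^sub>1 \<otimes>\<^bsub>G\<^esub> g\<^sub>2, g\<^sub>3)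
                               \<otimes>\<^bsub>M\<^esub> k (g\<^sub>1, g\<^sub>2 \<otimes>\<^bsub>G\<^esub> g\<^sub>3) \<otimes>\<^bsub>M\<^esub> inv\<^bsub>M\<^esub> k (g\<^sub>1, g\<^sub>2),
     \<lambda>(x, y) \<in> carrier2 G. k (y, x) \<otimes>\<^bsub>M\<^esub> inv\<^bsub>M\<^esub> k (x, y))"

definition B3_2ab :: "('a, 'x) monoid_scheme \<Rightarrow> ('m, 'y) monoid_scheme
    \<Rightarrow> (('a \<times> 'a \<times> 'a \<Rightarrow> 'm) \<times> ('a \<times> 'a \<Rightarrow> 'm)) set"
  where "B3_2ab G M = coboundary_2ab G M ` (carrier2 G \<rightarrow>\<^sub>E carrier M)"

definition H3_2ab :: "('a, 'x) monoid_scheme \<Rightarrow> ('m, 'y) monoid_scheme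
    \<Rightarrow> (('a \<times> 'a \<times> 'a \<Rightarrow> 'm) \<times> ('a \<times> 'a \<Rightarrow> 'm)) set monoid"
  where "H3_2ab G M = Z3_2ab G M Mod B3_2ab G M"

definition pullback_2ab :: "('a, 'x) monoid_scheme \<Rightarrow> ('a \<Rightarrow> 'b)
    \<Rightarrow> ('b \<times> 'b \<times> 'b \<Rightarrow> 'm) \<times> ('b \<times> 'b \<Rightarrow> 'm) \<Rightarrow> ('a \<times> 'a \<times> 'a \<Rightarrow> 'm) \<times> ('a \<times> 'a \<Rightarrow> 'm)"
  where "pullback_2ab G \<phi> = (\<lambda>(h, c).
    (\<lambda>(x, y, z) \<in> carrier3 G. h (\<phi> x, \<phi> y, \<phi> z), \<lambda>(x, y) \<in> carrier2 G. c (\<phi> x, \<phi> y)))"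

text \<open>
  For \<open>\<phi> : G \<rightarrow> G'\<close>, a class (coset) \<open>u\<close> in \<open>H\<^sup>3(G', M)\<close> goes to the coset containing the pullbacks
  of all its representatives, see \<open>H3_map_coset\<close> below.
\<close>

definition H3_map :: "('a, 'x) monoid_scheme \<Rightarrow> ('m, 'y) monoid_scheme \<Rightarrow> ('a \<Rightarrow> 'b)
    \<Rightarrow> (('b \<times> 'b \<times> 'b \<Rightarrow> 'm) \<times> ('b \<times> 'b \<Rightarrow> 'm)) set
    \<Rightarrow> (('a \<times> 'a \<times> 'a \<Rightarrow> 'm) \<times> ('a \<times> 'a \<Rightarrow> 'm)) set"
  where "H3_map G M \<phi> u = (\<Union>z\<in>u. B3_2ab G M #>\<^bsub>Z3_2ab G M\<^esub> pullback_2ab G \<phi> z)"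

lemma (in comm_group) frac_mult:
  assumes "a \<in> carrier G" "b \<in> carrier G" "c \<in> carrier G" "d \<in> carrier G"
  shows "(a \<otimes> inv b) \<otimes> (c \<otimes> inv d) = (a \<otimes> c) \<otimes> inv (b \<otimes> d)"
  using assms by (simp add: inv_mult m_ac)

lemma (in comm_group) frac_eq:
  assumes "a \<in> carrier G" "b \<in> carrier G" "c \<in> carrier G" "d \<in> carrier G"
  shows "a \<otimes> inv b = c \<otimes> inv d \<longleftrightarrow> a \<otimes> d = c \<otimes> b"
proof -
  have "a \<otimes> inv b = c \<otimes> inv d \<longleftrightarrow> c = a \<otimes> inv b \<otimes> d"
    using assms by (intro inv_solve_right) auto
  also have "a \<otimes> inv b \<otimes> d = (a \<otimes> d) \<otimes> inv b"
    using assms by (simp add: m_ac)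
  also have "c = (a \<otimes> d) \<otimes> inv b \<longleftrightarrow> a \<otimes> d = c \<otimes> b"
    using assms by (intro inv_solve_right) auto
  finally show ?thesis .
qed

lemma comm_group_C3:
  assumes "comm_group M" shows "comm_group (C3_2ab G M)"
proof -
  interpret M: comm_group M by fact
  have *: "comm_group (product_group I (\<lambda>_. M))" for I :: "'z set"
  proof (rule group.group_comm_groupI)
    show "Group.group (product_group I (\<lambda>_. M))" by simp
  qed (auto simp: PiE_iff M.m_comm intro!: restrict_ext)
  interpret A: comm_group "product_group (carrier3 G) (\<lambda>_. M)" by (rule *)
  interpret B: comm_group "product_group (carrier2 G) (\<lambda>_. M)" by (rule *)
  show ?thesis unfolding C3_2ab_def
    by (rule group.group_comm_groupI[OF DirProd_group[OF A.is_group B.is_group]])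
       (auto simp del: mult_product_group carrier_product_group simp: A.m_comm B.m_comm)
qed

lemma subgroup_Z3:
  assumes "comm_group G" "comm_group M"
  shows "subgroup (carrier (Z3_2ab G M)) (C3_2ab G M)"
proof -
  interpret G: comm_group G by fact
  interpret M: comm_group M by fact
  interpret C: comm_group "C3_2ab G M" by (rule comm_group_C3) fact
  have cl: "h p \<in> carrier M" if "h \<in> I \<rightarrow>\<^sub>E carrier M" "p \<in> I" for h :: "'z \<Rightarrow> 'c" and I p
    using that by (rule PiE_mem)
  show ?thesis
  proof (rule C.subgroupI)
    show "carrier (Z3_2ab G M) \<subseteq> carrier (C3_2ab G M)"
      by (auto simp: Z3_2ab_def)
    have "\<one>\<^bsub>C3_2ab G M\<^esub> \<in> carrier (Z3_2ab G M)"
      by (auto simp: Z3_2ab_def C3_2ab_def cocycle3_def hexagons_def)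
    then show "carrier (Z3_2ab G M) \<noteq> {}" by blast
  next
    fix a assume "a \<in> carrier (Z3_2ab G M)"
    then obtain h c where a: "a = (h, c)" and hc: "h \<in> carrier3 G \<rightarrow>\<^sub>E carrier M" "c \<in> carrier2 G \<rightarrow>\<^sub>E carrier M"
      and coc: "cocycle3 G M h" and hex: "hexagons G M h c"
      by (auto simp: Z3_2ab_def C3_2ab_def)
    have inv: "inv\<^bsub>C3_2ab G M\<^esub> a = (\<lambda>p\<in>carrier3 G. inv\<^bsub>M\<^esub> h p, \<lambda>p\<in>carrier2 G. inv\<^bsub>M\<^esub> c p)"
      unfolding a C3_2ab_def using hc by (subst inv_DirProd) auto
    note [simp] = cl[OF hc(1)] cl[OF hc(2)]
    have "cocycle3 G M (\<lambda>p\<in>carrier3 G. inv\<^bsub>M\<^esub> h p)"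
      using coc by (simp add: cocycle3_def M.inv_mult[symmetric])
    moreover have "hexagons G M (\<lambda>p\<in>carrier3 G. inv\<^bsub>M\<^esub> h p) (\<lambda>p\<in>carrier2 G. inv\<^bsub>M\<^esub> c p)"
      unfolding hexagons_def
    proof (intro ballI conjI, goal_cases)
      case (1 x y z)
      then have "h (y, z, x) \<otimes>\<^bsub>M\<^esub> c (x, y \<otimes>\<^bsub>G\<^esub> z) \<otimes>\<^bsub>M\<^esub> h (x, y, z) = c (x, z) \<otimes>\<^bsub>M\<^esub> h (y, x, z) \<otimes>\<^bsub>M\<^esub> c (x, y)"
        using hex by (simp add: hexagons_def)
      from arg_cong[OF this, of "m_inv M"] show ?case
        using 1 by (simp add: M.inv_mult)
    next
      case (2 x y z)
      then have "inv\<^bsub>M\<^esub> h (z, x, y) \<otimes>\<^bsub>M\<^esub> c (x \<otimes>\<^bsub>G\<^esub> y, z) \<otimes>\<^bsub>M\<^esub> inv\<^bsub>M\<^esub> h (x, y, z)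
          = c (x, z) \<otimes>\<^bsub>M\<^esub> inv\<^bsub>M\<^esub> h (x, z, y) \<otimes>\<^bsub>M\<^esub> c (y, z)"
        using hex by (simp add: hexagons_def)
      from arg_cong[OF this, of "m_inv M"] show ?case
        using 2 by (simp add: M.inv_mult)
    qed
    ultimately show "inv\<^bsub>C3_2ab G M\<^esub> a \<in> carrier (Z3_2ab G M)"
      unfolding inv by (auto simp: Z3_2ab_def C3_2ab_def)
  next
    fix a b assume "a \<in> carrier (Z3_2ab G M)" "b \<in> carrier (Z3_2ab G M)"
    then obtain h c h' c' where ab: "a = (h, c)" "b = (h', c')"
      and hc: "h \<in> carrier3 G \<rightarrow>\<^sub>E carrier M" "c \<in> carrier2 G \<rightarrow>\<^sub>E carrier M"
        "h' \<in> carrier3 G \<rightarrow>\<^sub>E carrier M" "c' \<in> carrier2 G \<rightarrow>\<^sub>E carrier M"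
      and coc: "cocycle3 G M h" "cocycle3 G M h'" and hex: "hexagons G M h c" "hexagons G M h' c'"
      by (auto simp: Z3_2ab_def C3_2ab_def)
    note [simp] = hc[THEN cl]
    have m3: "(x \<otimes>\<^bsub>M\<^esub> x') \<otimes>\<^bsub>M\<^esub> (y \<otimes>\<^bsub>M\<^esub> y') \<otimes>\<^bsub>M\<^esub> (z \<otimes>\<^bsub>M\<^esub> z') =
      (x \<otimes>\<^bsub>M\<^esub> y \<otimes>\<^bsub>M\<^esub> z) \<otimes>\<^bsub>M\<^esub> (x' \<otimes>\<^bsub>M\<^esub> y' \<otimes>\<^bsub>M\<^esub> z')" if "x \<in> carrier M" "y \<in> carrier M" "z \<in> carrier M"
      "x' \<in> carrier M" "y' \<in> carrier M" "z' \<in> carrier M" for x y z x' y' z'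
      using that by (simp add: M.m_ac)
    have m2: "(x \<otimes>\<^bsub>M\<^esub> x') \<otimes>\<^bsub>M\<^esub> (y \<otimes>\<^bsub>M\<^esub> y') = (x \<otimes>\<^bsub>M\<^esub> y) \<otimes>\<^bsub>M\<^esub> (x' \<otimes>\<^bsub>M\<^esub> y')"
      if "x \<in> carrier M" "y \<in> carrier M" "x' \<in> carrier M" "y' \<in> carrier M" for x y x' y'
      using that by (simp add: M.m_ac)
    have "cocycle3 G M (\<lambda>p\<in>carrier3 G. h p \<otimes>\<^bsub>M\<^esub> h' p)"
      using coc by (simp add: cocycle3_def m3) (simp add: m2)
    moreover have "hexagons G M (\<lambda>p\<in>carrier3 G. h p \<otimes>\<^bsub>M\<^esub> h' p) (\<lambda>p\<in>carrier2 G. c p \<otimes>\<^bsub>M\<^esub> c' p)"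
      using hex by (simp add: hexagons_def m3 M.inv_mult)
    ultimately show "a \<otimes>\<^bsub>C3_2ab G M\<^esub> b \<in> carrier (Z3_2ab G M)"
      unfolding ab by (auto simp: Z3_2ab_def C3_2ab_def)
  qed
qed

lemma comm_group_Z3:
  assumes "comm_group G" "comm_group M"
  shows "comm_group (Z3_2ab G M)"
proof -
  interpret C: comm_group "C3_2ab G M" by (rule comm_group_C3) fact
  have eq: "Z3_2ab G M = (C3_2ab G M)\<lparr>carrier := carrier (Z3_2ab G M)\<rparr>"
    by (simp add: Z3_2ab_def)
  have "Group.group (Z3_2ab G M)"
    using C.subgroup_imp_group[OF subgroup_Z3[OF assms]] eq by simp
  moreover have "carrier (Z3_2ab G M) \<subseteq> carrier (C3_2ab G M)"
    using subgroup.subset[OF subgroup_Z3[OF assms]] .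
  moreover have "x \<otimes>\<^bsub>Z3_2ab G M\<^esub> y = x \<otimes>\<^bsub>C3_2ab G M\<^esub> y" for x y
    by (simp add: Z3_2ab_def)
  ultimately show ?thesis
    by (intro group.group_comm_groupI) (auto simp: C.m_comm subset_iff)
qed

lemma mult_Z3: "(h, c) \<otimes>\<^bsub>Z3_2ab G M\<^esub> (h', c') =
    (\<lambda>p\<in>carrier3 G. h p \<otimes>\<^bsub>M\<^esub> h' p, \<lambda>p\<in>carrier2 G. c p \<otimes>\<^bsub>M\<^esub> c' p)"
  by (simp add: Z3_2ab_def C3_2ab_def)

lemma coboundary_in_Z3:
  assumes "comm_group G" "comm_group M" and k: "k \<in> carrier2 G \<rightarrow>\<^sub>E carrier M"
  shows "coboundary_2ab G M k \<in> carrier (Z3_2ab G M)"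
proof -
  interpret G: comm_group G by fact
  interpret M: comm_group M by fact
  have [simp]: "k p \<in> carrier M" if "p \<in> carrier2 G" for p
    using k that by (rule PiE_mem)
  obtain h c where hc: "coboundary_2ab G M k = (h, c)" by force
  have h: "h (x, y, z) = (k (y, z) \<otimes>\<^bsub>M\<^esub> k (x, y \<otimes>\<^bsub>G\<^esub> z)) \<otimes>\<^bsub>M\<^esub> inv\<^bsub>M\<^esub> (k (x \<otimes>\<^bsub>G\<^esub> y, z) \<otimes>\<^bsub>M\<^esub> k (x, y))"
    if "x \<in> carrier G" "y \<in> carrier G" "z \<in> carrier G" for x y z
    using hc that by (auto simp: coboundary_2ab_def M.inv_mult M.m_ac)
  have inv_h: "inv\<^bsub>M\<^esub> h (x, y, z) = (k (x \<otimes>\<^bsub>G\<^esub> y, z) \<otimes>\<^bsub>M\<^esub> k (x, y)) \<otimes>\<^bsub>M\<^esub> inv\<^bsub>M\<^esub> (k (y, z) \<otimes>\<^bsub>M\<^esub> k (x, y \<otimes>\<^bsub>G\<^esub> z))"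
    if "x \<in> carrier G" "y \<in> carrier G" "z \<in> carrier G" for x y z
    using that by (simp add: h M.inv_mult M.m_ac)
  have c: "c (x, y) = k (y, x) \<otimes>\<^bsub>M\<^esub> inv\<^bsub>M\<^esub> k (x, y)" if "x \<in> carrier G" "y \<in> carrier G" for x y
    using hc that by (auto simp: coboundary_2ab_def)
  have "h \<in> carrier3 G \<rightarrow>\<^sub>E carrier M" "c \<in> carrier2 G \<rightarrow>\<^sub>E carrier M"
    using hc by (auto simp: coboundary_2ab_def PiE_def extensional_def)
  moreover have "cocycle3 G M h"
    unfolding cocycle3_def
    by (intro ballI) (simp add: h M.frac_mult M.frac_eq G.m_assoc, simp add: M.m_ac)
  moreover have "hexagons G M h c"
    unfolding hexagons_def
  proof (intro ballI conjI, goal_cases)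
    case (1 x y z)
    then show ?case
      by (simp add: h c M.frac_mult M.frac_eq) (simp add: M.m_ac G.m_comm)
  next
    case (2 x y z)
    then show ?case
      by (simp add: inv_h c M.frac_mult M.frac_eq del: M.inv_mult_group) (simp add: M.m_ac G.m_comm)
  qed
  ultimately show ?thesis
    by (simp add: hc Z3_2ab_def C3_2ab_def)
qed

lemma subgroup_B3:
  assumes "comm_group G" "comm_group M"
  shows "subgroup (B3_2ab G M) (Z3_2ab G M)"
proof -
  interpret G: comm_group G by fact
  interpret M: comm_group M by fact
  interpret Z: comm_group "Z3_2ab G M" by (rule comm_group_Z3) fact+
  define P where "P = product_group (carrier2 G) (\<lambda>_. M)"
  interpret P: group P by (simp add: P_def)
  have "coboundary_2ab G M \<in> hom P (Z3_2ab G M)"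
  proof (rule homI)
    fix k assume "k \<in> carrier P"
    then show "coboundary_2ab G M k \<in> carrier (Z3_2ab G M)"
      by (intro coboundary_in_Z3 assms) (simp add: P_def)
  next
    fix k l assume "k \<in> carrier P" "l \<in> carrier P"
    then have [simp]: "k p \<in> carrier M" "l p \<in> carrier M" if "p \<in> carrier2 G" for p
      using that by (auto simp: P_def)
    show "coboundary_2ab G M (k \<otimes>\<^bsub>P\<^esub> l) =
        coboundary_2ab G M k \<otimes>\<^bsub>Z3_2ab G M\<^esub> coboundary_2ab G M l"
      by (auto simp: coboundary_2ab_def mult_Z3 P_def M.inv_mult M.m_ac intro!: restrict_ext)
  qed
  then interpret group_hom P "Z3_2ab G M" "coboundary_2ab G M"
    by unfold_locales
  show ?thesis
    using img_is_subgroup by (simp add: B3_2ab_def P_def)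
qed

theorem comm_group_H3:
  assumes "comm_group G" "comm_group M"
  shows "comm_group (H3_2ab G M)"
  unfolding H3_2ab_def
  by (intro comm_group.abelian_FactGroup comm_group_Z3 subgroup_B3 assms)

lemma pullback_in_Z3:
  assumes "comm_group G" "comm_group G'" "comm_group M" "\<phi> \<in> hom G G'"
    and "z \<in> carrier (Z3_2ab G' M)"
  shows "pullback_2ab G \<phi> z \<in> carrier (Z3_2ab G M)"
proof -
  interpret G: comm_group G by fact
  interpret G': comm_group G' by fact
  interpret group_hom G G' \<phi> by unfold_locales fact
  obtain h c where z: "z = (h, c)" by force
  show ?thesis
    using assms(5)
    by (auto simp: z Z3_2ab_def C3_2ab_def pullback_2ab_def cocycle3_def hexagons_def)
qed

lemma pullback_hom:
  assumes "comm_group G" "comm_group G'" "comm_group M" "\<phi> \<in> hom G G'"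
  shows "pullback_2ab G \<phi> \<in> hom (Z3_2ab G' M) (Z3_2ab G M)"
proof (rule homI)
  interpret G: comm_group G by fact
  interpret G': comm_group G' by fact
  interpret group_hom G G' \<phi> by unfold_locales fact
  show "pullback_2ab G \<phi> z \<in> carrier (Z3_2ab G M)" if "z \<in> carrier (Z3_2ab G' M)" for z
    using pullback_in_Z3 assms that .
  fix z w assume "z \<in> carrier (Z3_2ab G' M)" "w \<in> carrier (Z3_2ab G' M)"
  obtain h c h' c' where "z = (h, c)" "w = (h', c')" by (metis surj_pair)
  then show "pullback_2ab G \<phi> (z \<otimes>\<^bsub>Z3_2ab G' M\<^esub> w) = pullback_2ab G \<phi> z \<otimes>\<^bsub>Z3_2ab G M\<^esub> pullback_2ab G \<phi> w"
    by (auto simp: pullback_2ab_def mult_Z3 intro!: restrict_ext)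
qed

lemma pullback_coboundary:
  assumes "comm_group G" "comm_group G'" "comm_group M" "\<phi> \<in> hom G G'"
    and "z \<in> B3_2ab G' M"
  shows "pullback_2ab G \<phi> z \<in> B3_2ab G M"
proof -
  interpret G: comm_group G by fact
  interpret G': comm_group G' by fact
  interpret group_hom G G' \<phi> by unfold_locales fact
  obtain k where k: "k \<in> carrier2 G' \<rightarrow>\<^sub>E carrier M" and z: "z = coboundary_2ab G' M k"
    using assms(5) by (auto simp: B3_2ab_def)
  have "pullback_2ab G \<phi> z = coboundary_2ab G M (\<lambda>(x, y)\<in>carrier2 G. k (\<phi> x, \<phi> y))"
    by (auto simp: z pullback_2ab_def coboundary_2ab_def intro!: restrict_ext)
  moreover have "(\<lambda>(x, y)\<in>carrier2 G. k (\<phi> x, \<phi> y)) \<in> carrier2 G \<rightarrow>\<^sub>E carrier M"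
    using k by (auto simp: PiE_iff)
  ultimately show ?thesis
    by (auto simp: B3_2ab_def)
qed

lemma H3_map_coset:
  assumes "comm_group G" "comm_group G'" "comm_group M" "\<phi> \<in> hom G G'"
    and z: "z \<in> carrier (Z3_2ab G' M)"
  shows "H3_map G M \<phi> (B3_2ab G' M #>\<^bsub>Z3_2ab G' M\<^esub> z) = B3_2ab G M #>\<^bsub>Z3_2ab G M\<^esub> pullback_2ab G \<phi> z"
proof -
  interpret Z: comm_group "Z3_2ab G M" by (rule comm_group_Z3) fact+
  interpret Z': comm_group "Z3_2ab G' M" by (rule comm_group_Z3) fact+
  interpret B: subgroup "B3_2ab G M" "Z3_2ab G M" by (rule subgroup_B3) fact+
  interpret B': subgroup "B3_2ab G' M" "Z3_2ab G' M" by (rule subgroup_B3) fact+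
  interpret p: group_hom "Z3_2ab G' M" "Z3_2ab G M" "pullback_2ab G \<phi>"
    by unfold_locales (rule pullback_hom[OF assms(1-4)])
  have "B3_2ab G M #>\<^bsub>Z3_2ab G M\<^esub> pullback_2ab G \<phi> w = B3_2ab G M #>\<^bsub>Z3_2ab G M\<^esub> pullback_2ab G \<phi> z"
    if w: "w \<in> B3_2ab G' M #>\<^bsub>Z3_2ab G' M\<^esub> z" for w
  proof -
    obtain b where b: "b \<in> B3_2ab G' M" "w = b \<otimes>\<^bsub>Z3_2ab G' M\<^esub> z"
      using w by (auto simp: r_coset_def)
    have "pullback_2ab G \<phi> b \<in> B3_2ab G M"
      by (rule pullback_coboundary[OF assms(1-4) b(1)])
    then show ?thesis
      using b z by (simp add: Z.coset_mult_assoc[symmetric] B.subset B.rcos_const[OF Z.is_group])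
  qed
  moreover have "z \<in> B3_2ab G' M #>\<^bsub>Z3_2ab G' M\<^esub> z"
    by (rule Z'.rcos_self) (use z B'.subgroup_axioms in auto)
  ultimately show ?thesis
    unfolding H3_map_def by blast
qed

theorem H3_map_hom:
  assumes "comm_group G" "comm_group G'" "comm_group M" "\<phi> \<in> hom G G'"
  shows "H3_map G M \<phi> \<in> hom (H3_2ab G' M) (H3_2ab G M)"
proof -
  interpret Z: comm_group "Z3_2ab G M" by (rule comm_group_Z3) fact+
  interpret Z': comm_group "Z3_2ab G' M" by (rule comm_group_Z3) fact+
  interpret B: normal "B3_2ab G M" "Z3_2ab G M"
    by (intro Z.subgroup_imp_normal subgroup_B3 assms)
  interpret B': normal "B3_2ab G' M" "Z3_2ab G' M"
    by (intro Z'.subgroup_imp_normal subgroup_B3 assms)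
  interpret p: group_hom "Z3_2ab G' M" "Z3_2ab G M" "pullback_2ab G \<phi>"
    by unfold_locales (rule pullback_hom[OF assms(1-4)])
  show ?thesis
    by (rule homI)
       (auto simp: H3_2ab_def carrier_FactGroup H3_map_coset[OF assms] B.rcos_sum B'.rcos_sum)
qed

theorem H3_map_id:
  assumes "comm_group G" "comm_group M" "u \<in> carrier (H3_2ab G M)"
    and "\<And>x. x \<in> carrier G \<Longrightarrow> \<phi> x = x"
  shows "H3_map G M \<phi> u = u"
proof -
  interpret G: comm_group G by fact
  have hom: "\<phi> \<in> hom G G" using assms(4) by (auto simp: hom_def)
  obtain z where z: "z \<in> carrier (Z3_2ab G M)" "u = B3_2ab G M #>\<^bsub>Z3_2ab G M\<^esub> z"
    using assms(3) by (auto simp: H3_2ab_def carrier_FactGroup)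
  have "pullback_2ab G \<phi> z = z"
    using z(1) assms(4)
    by (auto simp: pullback_2ab_def Z3_2ab_def C3_2ab_def PiE_iff restrict_def extensional_def fun_eq_iff)
  then show ?thesis
    using H3_map_coset[OF assms(1,1,2) hom z(1)] z(2) by simp
qed

theorem H3_map_comp:
  assumes "comm_group G" "comm_group G'" "comm_group G''" "comm_group M"
    and "\<phi> \<in> hom G G'" "\<psi> \<in> hom G' G''" "u \<in> carrier (H3_2ab G'' M)"
  shows "H3_map G M (\<psi> \<circ> \<phi>) u = H3_map G M \<phi> (H3_map G' M \<psi> u)"
proof -
  have hom: "\<psi> \<circ> \<phi> \<in> hom G G''"
    using assms by (intro hom_compose)
  obtain z where z: "z \<in> carrier (Z3_2ab G'' M)" "u = B3_2ab G'' M #>\<^bsub>Z3_2ab G'' M\<^esub> z"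
    using assms(7) by (auto simp: H3_2ab_def carrier_FactGroup)
  have "pullback_2ab G (\<psi> \<circ> \<phi>) z = pullback_2ab G \<phi> (pullback_2ab G' \<psi> z)"
    using assms(5) by (auto simp: pullback_2ab_def hom_def Pi_iff split: prod.splits intro!: restrict_ext)
  then show ?thesis
    using H3_map_coset[OF assms(1,3,4) hom z(1)] H3_map_coset[OF assms(2,3,4,6) z(1)]
      H3_map_coset[OF assms(1,2,4,5) pullback_in_Z3[OF assms(2,3,4,6) z(1)]] z(2) by simp
qed


section \<open>Filtered systems of abelian groups\<close>

record ('o, 'f) category =
  Obj :: "'o set"
  Arr :: "'f set"
  Dom :: "'f \<Rightarrow> 'o"
  Cod :: "'f \<Rightarrow> 'o"
  Idt :: "'o \<Rightarrow> 'f"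
  Cmp :: "'f \<Rightarrow> 'f \<Rightarrow> 'f"  \<comment> \<open>\<open>Cmp C g f\<close> is \<open>g\<close> after \<open>f\<close>\<close>

definition Hom :: "('o, 'f, 'x) category_scheme \<Rightarrow> 'o \<Rightarrow> 'o \<Rightarrow> 'f set"
  where "Hom C i j = {f \<in> Arr C. Dom C f = i \<and> Cod C f = j}"

locale category =
  fixes C :: "('o, 'f, 'x) category_scheme"
  assumes Dom_in: "f \<in> Arr C \<Longrightarrow> Dom C f \<in> Obj C"
    and Cod_in: "f \<in> Arr C \<Longrightarrow> Cod C f \<in> Obj C"
    and Idt_in: "i \<in> Obj C \<Longrightarrow> Idt C i \<in> Hom C i i"
    and Cmp_in: "f \<in> Hom C i j \<Longrightarrow> g \<in> Hom C j k \<Longrightarrow> Cmp C g f \<in> Hom C i k"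
    and Cmp_Idt: "f \<in> Hom C i j \<Longrightarrow> Cmp C f (Idt C i) = f"
    and Idt_Cmp: "f \<in> Hom C i j \<Longrightarrow> Cmp C (Idt C j) f = f"
    and Cmp_assoc: "f \<in> Hom C i j \<Longrightarrow> g \<in> Hom C j k \<Longrightarrow> h \<in> Hom C k l
        \<Longrightarrow> Cmp C h (Cmp C g f) = Cmp C (Cmp C h g) f"

locale filtered_category = category +
  assumes nonempty: "Obj C \<noteq> {}"
    and cocone_objects: "i \<in> Obj C \<Longrightarrow> j \<in> Obj C \<Longrightarrow> \<exists>k. Hom C i k \<noteq> {} \<and> Hom C j k \<noteq> {}"
    and cocone_arrows: "f \<in> Hom C i j \<Longrightarrow> g \<in> Hom C i j \<Longrightarrow> \<exists>k. \<exists>h\<in>Hom C j k. Cmp C h f = Cmp C h g"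

text \<open>
  A functor from \<open>C\<close> to abelian groups, with object part \<open>G\<close> and arrow part \<open>F\<close>. That all \<open>G i\<close> have
  elements of the same type is no restriction, since that type is arbitrary.
\<close>

locale ab_group_functor = category C
  for C :: "('o, 'f, 'x) category_scheme" +
  fixes G :: "'o \<Rightarrow> ('a, 'y) monoid_scheme" and F :: "'f \<Rightarrow> 'a \<Rightarrow> 'a"
  assumes comm_group: "i \<in> Obj C \<Longrightarrow> comm_group (G i)"
    and hom: "f \<in> Hom C i j \<Longrightarrow> F f \<in> hom (G i) (G j)"
    and map_Idt: "i \<in> Obj C \<Longrightarrow> x \<in> carrier (G i) \<Longrightarrow> F (Idt C i) x = x"
    and map_Cmp: "f \<in> Hom C i j \<Longrightarrow> g \<in> Hom C j k \<Longrightarrow> x \<in> carrier (G i)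
        \<Longrightarrow> F (Cmp C g f) x = F g (F f x)"

text \<open>
  The filtered colimit is the group of germs: the disjoint union of the \<open>G i\<close> modulo
  identification at a later stage. The theorems \<open>colim_in_hom\<close>, \<open>colim_in_compat\<close> and
  \<open>colim_universal\<close> below show that this is the colimit in the category of abelian groups.
\<close>

definition colim_rel :: "('o, 'f, 'x) category_scheme \<Rightarrow> ('o \<Rightarrow> ('a, 'y) monoid_scheme)
    \<Rightarrow> ('f \<Rightarrow> 'a \<Rightarrow> 'a) \<Rightarrow> (('o \<times> 'a) \<times> ('o \<times> 'a)) set"
  where "colim_rel C G F = {((i, x), (j, y)). i \<in> Obj C \<and> j \<in> Obj C \<and>
    x \<in> carrier (G i) \<and> y \<in> carrier (G j) \<and> (\<exists>k. \<exists>f\<in>Hom C i k. \<exists>g\<in>Hom C j k. F f x = F g y)}"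

definition colim_in :: "('o, 'f, 'x) category_scheme \<Rightarrow> ('o \<Rightarrow> ('a, 'y) monoid_scheme)
    \<Rightarrow> ('f \<Rightarrow> 'a \<Rightarrow> 'a) \<Rightarrow> 'o \<Rightarrow> 'a \<Rightarrow> ('o \<times> 'a) set"
  where "colim_in C G F i x = colim_rel C G F `` {(i, x)}"

text \<open>
  In the product and the unit below all members of the unions coincide, see \<open>colim_mult\<close> and
  \<open>colim_one\<close>.
\<close>

definition colim_group :: "('o, 'f, 'x) category_scheme \<Rightarrow> ('o \<Rightarrow> ('a, 'y) monoid_scheme)
    \<Rightarrow> ('f \<Rightarrow> 'a \<Rightarrow> 'a) \<Rightarrow> ('o \<times> 'a) set monoid"
  where "colim_group C G F =
    \<lparr>carrier = (SIGMA i:Obj C. carrier (G i)) // colim_rel C G F,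
     monoid.mult = (\<lambda>A B. \<Union>{colim_in C G F k (F f x \<otimes>\<^bsub>G k\<^esub> F g y) | i x j y k f g.
        (i, x) \<in> A \<and> (j, y) \<in> B \<and> f \<in> Hom C i k \<and> g \<in> Hom C j k}),
     one = (\<Union>i\<in>Obj C. colim_in C G F i \<one>\<^bsub>G i\<^esub>)\<rparr>"

text \<open>
  The limit of a contravariant diagram of groups on \<open>C\<close> (\<open>T f : H (Cod f) \<rightarrow> H (Dom f)\<close>): the
  subgroup of compatible families in the product.
\<close>

definition lim_group :: "('o, 'f, 'x) category_scheme \<Rightarrow> ('o \<Rightarrow> ('b, 'y) monoid_scheme)
    \<Rightarrow> ('f \<Rightarrow> 'b \<Rightarrow> 'b) \<Rightarrow> ('o \<Rightarrow> 'b) monoid"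
  where "lim_group C H T = (product_group (Obj C) H)
    \<lparr>carrier := {s \<in> carrier (product_group (Obj C) H). \<forall>f\<in>Arr C. T f (s (Cod C f)) = s (Dom C f)}\<rparr>"

definition lim_H3 :: "('o, 'f, 'x) category_scheme \<Rightarrow> ('o \<Rightarrow> ('a, 'y) monoid_scheme)
    \<Rightarrow> ('f \<Rightarrow> 'a \<Rightarrow> 'a) \<Rightarrow> ('m, 'z) monoid_scheme
    \<Rightarrow> ('o \<Rightarrow> (('a \<times> 'a \<times> 'a \<Rightarrow> 'm) \<times> ('a \<times> 'a \<Rightarrow> 'm)) set) monoid"
  where "lim_H3 C G F M =
    lim_group C (\<lambda>i. H3_2ab (G i) M) (\<lambda>f. H3_map (G (Dom C f)) M (F f))"

definition H3_colim_to_lim :: "('o, 'f, 'x) category_scheme \<Rightarrow> ('o \<Rightarrow> ('a, 'y) monoid_scheme)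
    \<Rightarrow> ('f \<Rightarrow> 'a \<Rightarrow> 'a) \<Rightarrow> ('m, 'z) monoid_scheme
    \<Rightarrow> ((('o \<times> 'a) set \<times> ('o \<times> 'a) set \<times> ('o \<times> 'a) set \<Rightarrow> 'm) \<times>
        (('o \<times> 'a) set \<times> ('o \<times> 'a) set \<Rightarrow> 'm)) set
    \<Rightarrow> 'o \<Rightarrow> (('a \<times> 'a \<times> 'a \<Rightarrow> 'm) \<times> ('a \<times> 'a \<Rightarrow> 'm)) set"
  where
  "H3_colim_to_lim C G F M u = (\<lambda>i\<in>Obj C. H3_map (G i) M (colim_in C G F i) u)"

locale filtered_ab_system = filtered_category C + ab_group_functor C G F
  for C :: "('o, 'f, 'x) category_scheme" and G :: "'o \<Rightarrow> ('a, 'y) monoid_scheme"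
    and F :: "'f \<Rightarrow> 'a \<Rightarrow> 'a"
begin

abbreviation "R \<equiv> colim_rel C G F"
abbreviation "\<iota> \<equiv> colim_in C G F"
abbreviation "L \<equiv> colim_group C G F"

lemma Hom_obj: "f \<in> Hom C i j \<Longrightarrow> i \<in> Obj C \<and> j \<in> Obj C"
  by (auto simp: Hom_def Dom_in Cod_in)

lemma F_closed: "f \<in> Hom C i j \<Longrightarrow> x \<in> carrier (G i) \<Longrightarrow> F f x \<in> carrier (G j)"
  using hom by (auto simp: hom_def)

lemma F_mult: "f \<in> Hom C i j \<Longrightarrow> x \<in> carrier (G i) \<Longrightarrow> y \<in> carrier (G i)
    \<Longrightarrow> F f (x \<otimes>\<^bsub>G i\<^esub> y) = F f x \<otimes>\<^bsub>G j\<^esub> F f y"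
  using hom by (auto simp: hom_def)

lemma G_closed: "i \<in> Obj C \<Longrightarrow> x \<in> carrier (G i) \<Longrightarrow> y \<in> carrier (G i) \<Longrightarrow> x \<otimes>\<^bsub>G i\<^esub> y \<in> carrier (G i)"
  using comm_group by (meson comm_groupE(1))

text \<open>Any two spans out of \<open>i\<close> and \<open>j\<close> become equal after composition to some later stage.\<close>

lemma common_stage:
  assumes "f \<in> Hom C i k" "g \<in> Hom C j k" "f' \<in> Hom C i k'" "g' \<in> Hom C j k'"
  obtains m a b where "a \<in> Hom C k m" "b \<in> Hom C k' m"
    "Cmp C a f = Cmp C b f'" "Cmp C a g = Cmp C b g'"
proof -
  obtain l a0 b0 where l: "a0 \<in> Hom C k l" "b0 \<in> Hom C k' l"
    using cocone_objects[of k k'] assms Hom_obj by blast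
  obtain n u where u: "u \<in> Hom C l n" "Cmp C u (Cmp C a0 f) = Cmp C u (Cmp C b0 f')"
    using cocone_arrows[of "Cmp C a0 f" i l "Cmp C b0 f'"] Cmp_in assms l by blast
  obtain m v where v: "v \<in> Hom C n m"
    "Cmp C v (Cmp C u (Cmp C a0 g)) = Cmp C v (Cmp C u (Cmp C b0 g'))"
    using cocone_arrows[of "Cmp C u (Cmp C a0 g)" j n "Cmp C u (Cmp C b0 g')"] Cmp_in assms l u by metis
  define w where "w = Cmp C v u"
  have w: "w \<in> Hom C l m" using u v Cmp_in by (simp add: w_def)
  have *: "Cmp C v (Cmp C u (Cmp C p q)) = Cmp C (Cmp C w p) q"
    if pq: "q \<in> Hom C i' k''" "p \<in> Hom C k'' l" for p q i' k''
    using Cmp_assoc[OF Cmp_in[OF pq] u(1) v(1)] Cmp_assoc[OF pq w] by (simp add: w_def)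
  show thesis
    using that[of "Cmp C w a0" m "Cmp C w b0"] * u(2) v(2) Cmp_in[OF l(1) w] Cmp_in[OF l(2) w] assms l
    by metis
qed

lemma equiv_R: "equiv (SIGMA i:Obj C. carrier (G i)) R"
proof (rule equivI)
  show "R \<subseteq> (SIGMA i:Obj C. carrier (G i)) \<times> (SIGMA i:Obj C. carrier (G i))"
    by (auto simp: colim_rel_def)
  show "refl_on (SIGMA i:Obj C. carrier (G i)) R"
    by (rule refl_onI) (auto simp: colim_rel_def intro: Idt_in)
  show "sym R"
    by (rule symI) (auto simp: colim_rel_def, metis)
  show "trans R"
  proof (rule transI, clarify)
    fix i x j y l z assume "((i, x), (j, y)) \<in> R" "((j, y), (l, z)) \<in> R"
    then obtain k k' f g f' g' where
      o: "i \<in> Obj C" "j \<in> Obj C" "l \<in> Obj C" "x \<in> carrier (G i)" "y \<in> carrier (G j)" "z \<in> carrier (G l)"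
      and f: "f \<in> Hom C i k" "g \<in> Hom C j k" "F f x = F g y"
      and f': "f' \<in> Hom C j k'" "g' \<in> Hom C l k'" "F f' y = F g' z"
      by (auto simp: colim_rel_def)
    obtain m a b where m: "a \<in> Hom C k m" "b \<in> Hom C k' m" "Cmp C a g = Cmp C b f'"
      using common_stage[OF f(2) f(2) f'(1) f'(1)] by metis
    have "F (Cmp C a f) x = F (Cmp C b g') z"
      using map_Cmp[OF f(1) m(1) o(4)] map_Cmp[OF f(2) m(1) o(5)]
        map_Cmp[OF f'(1) m(2) o(5)] map_Cmp[OF f'(2) m(2) o(6)] f f' m by simp
    then show "((i, x), (l, z)) \<in> R"
      using o Cmp_in[OF f(1) m(1)] Cmp_in[OF f'(2) m(2)] by (auto simp: colim_rel_def)
  qed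
qed

lemma colim_in_eq_iff:
  assumes "i \<in> Obj C" "x \<in> carrier (G i)" "j \<in> Obj C" "y \<in> carrier (G j)"
  shows "\<iota> i x = \<iota> j y \<longleftrightarrow> (\<exists>k. \<exists>f\<in>Hom C i k. \<exists>g\<in>Hom C j k. F f x = F g y)"
proof -
  have "\<iota> i x = \<iota> j y \<longleftrightarrow> ((i, x), (j, y)) \<in> R"
    unfolding colim_in_def using assms by (intro eq_equiv_class_iff[OF equiv_R]) auto
  then show ?thesis using assms by (simp add: colim_rel_def)
qed

theorem colim_in_compat:
  assumes "f \<in> Hom C i j" "x \<in> carrier (G i)"
  shows "\<iota> j (F f x) = \<iota> i x"
proof -
  have o: "i \<in> Obj C" "j \<in> Obj C" using Hom_obj assms by blast+
  have "F (Idt C j) (F f x) = F f x"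
    using assms o by (simp add: map_Idt F_closed)
  then show ?thesis
    using assms o Idt_in[OF o(2)] by (subst colim_in_eq_iff) (auto simp: F_closed)
qed

lemma carrier_colim: "carrier L = (\<Union>i\<in>Obj C. \<iota> i ` carrier (G i))"
  by (auto simp: colim_group_def quotient_def colim_in_def)

lemma mem_colim_in: "(j, y) \<in> \<iota> i x \<longleftrightarrow> ((i, x), (j, y)) \<in> R"
  by (simp add: colim_in_def)

lemma colim_mult:
  assumes f: "f \<in> Hom C i k" and g: "g \<in> Hom C j k"
    and x: "x \<in> carrier (G i)" and y: "y \<in> carrier (G j)"
  shows "\<iota> i x \<otimes>\<^bsub>L\<^esub> \<iota> j y = \<iota> k (F f x \<otimes>\<^bsub>G k\<^esub> F g y)"
proof -
  let ?S = "{\<iota> k' (F f' x' \<otimes>\<^bsub>G k'\<^esub> F g' y') | i' x' j' y' k' f' g'.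
    (i', x') \<in> \<iota> i x \<and> (j', y') \<in> \<iota> j y \<and> f' \<in> Hom C i' k' \<and> g' \<in> Hom C j' k'}"
  have o: "i \<in> Obj C" "j \<in> Obj C" "k \<in> Obj C" using Hom_obj f g by blast+
  have mult_in: "\<iota> k' (F f' x' \<otimes>\<^bsub>G k'\<^esub> F g' y') = \<iota> m (F (Cmp C a f') x' \<otimes>\<^bsub>G m\<^esub> F (Cmp C a g') y')"
    if "f' \<in> Hom C i' k'" "g' \<in> Hom C j' k'" "x' \<in> carrier (G i')" "y' \<in> carrier (G j')" "a \<in> Hom C k' m"
    for f' g' k' x' y' a m i' j'
  proof -
    have "F (Cmp C a f') x' \<otimes>\<^bsub>G m\<^esub> F (Cmp C a g') y' = F a (F f' x' \<otimes>\<^bsub>G k'\<^esub> F g' y')"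
      using that by (simp add: map_Cmp F_mult F_closed)
    then show ?thesis
      using that Hom_obj[OF that(5)] by (simp add: colim_in_compat G_closed F_closed)
  qed
  have "\<iota> k' (F f' x' \<otimes>\<^bsub>G k'\<^esub> F g' y') = \<iota> k (F f x \<otimes>\<^bsub>G k\<^esub> F g y)"
    if ix: "(i', x') \<in> \<iota> i x" and jy: "(j', y') \<in> \<iota> j y" and f': "f' \<in> Hom C i' k'" and g': "g' \<in> Hom C j' k'"
    for i' x' j' y' k' f' g'
  proof -
    obtain p u u' where u: "u \<in> Hom C i p" "u' \<in> Hom C i' p" "F u x = F u' x'" and x': "x' \<in> carrier (G i')"
      using ix by (auto simp: mem_colim_in colim_rel_def)
    obtain q v v' where v: "v \<in> Hom C j q" "v' \<in> Hom C j' q" "F v y = F v' y'" and y': "y' \<in> carrier (G j')"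
      using jy by (auto simp: mem_colim_in colim_rel_def)
    obtain n s t where st: "s \<in> Hom C p n" "t \<in> Hom C q n"
      using cocone_objects[of p q] Hom_obj u v by blast
    define u1 u1' v1 v1' where d: "u1 = Cmp C s u" "u1' = Cmp C s u'" "v1 = Cmp C t v" "v1' = Cmp C t v'"
    have u1: "u1 \<in> Hom C i n" "u1' \<in> Hom C i' n" "v1 \<in> Hom C j n" "v1' \<in> Hom C j' n"
      using u v st Cmp_in by (auto simp: d)
    have e: "F u1 x = F u1' x'" "F v1 y = F v1' y'"
      using u v st x y x' y' by (simp_all add: d map_Cmp)
    have "\<iota> k (F f x \<otimes>\<^bsub>G k\<^esub> F g y) = \<iota> n (F u1 x \<otimes>\<^bsub>G n\<^esub> F v1 y)"
      using common_stage[OF f g u1(1,3)] mult_in[OF f g x y] mult_in[OF u1(1,3) x y] by metis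
    moreover have "\<iota> k' (F f' x' \<otimes>\<^bsub>G k'\<^esub> F g' y') = \<iota> n (F u1' x' \<otimes>\<^bsub>G n\<^esub> F v1' y')"
      using common_stage[OF f' g' u1(2,4)] mult_in[OF f' g' x' y'] mult_in[OF u1(2,4) x' y'] by metis
    ultimately show ?thesis using e by simp
  qed
  moreover have "(i, x) \<in> \<iota> i x" "(j, y) \<in> \<iota> j y"
    using o x y by (auto simp: mem_colim_in intro: equiv_class_self[OF equiv_R, unfolded Image_singleton_iff])
  ultimately have "?S = {\<iota> k (F f x \<otimes>\<^bsub>G k\<^esub> F g y)}"
    using f g by blast
  then show ?thesis
    by (simp add: colim_group_def)
qed

lemma colim_mult_same:
  assumes "i \<in> Obj C" "x \<in> carrier (G i)" "y \<in> carrier (G i)"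
  shows "\<iota> i x \<otimes>\<^bsub>L\<^esub> \<iota> i y = \<iota> i (x \<otimes>\<^bsub>G i\<^esub> y)"
  using colim_mult[OF Idt_in[OF assms(1)] Idt_in[OF assms(1)] assms(2,3)] assms by (simp add: map_Idt)

lemma colim_one:
  assumes "i \<in> Obj C" shows "\<one>\<^bsub>L\<^esub> = \<iota> i \<one>\<^bsub>G i\<^esub>"
proof -
  have "\<iota> j \<one>\<^bsub>G j\<^esub> = \<iota> i \<one>\<^bsub>G i\<^esub>" if j: "j \<in> Obj C" for j
  proof -
    obtain k f g where fg: "f \<in> Hom C j k" "g \<in> Hom C i k"
      using cocone_objects[OF j assms] by blast
    have k: "k \<in> Obj C" using Hom_obj fg by blast
    interpret i: comm_group "G i" by (rule comm_group) fact
    interpret j: comm_group "G j" by (rule comm_group) fact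
    interpret k: comm_group "G k" by (rule comm_group) fact
    have "F f \<one>\<^bsub>G j\<^esub> = F g \<one>\<^bsub>G i\<^esub>"
      using hom_one[OF hom[OF fg(1)] j.is_group k.is_group] hom_one[OF hom[OF fg(2)] i.is_group k.is_group] by simp
    then show ?thesis
      using j assms fg by (subst colim_in_eq_iff) auto
  qed
  then have "(\<Union>j\<in>Obj C. \<iota> j \<one>\<^bsub>G j\<^esub>) = (\<Union>j\<in>Obj C. \<iota> i \<one>\<^bsub>G i\<^esub>)"
    by (rule SUP_cong[OF refl])
  also have "\<dots> = \<iota> i \<one>\<^bsub>G i\<^esub>"
    using assms by auto
  finally show ?thesis by (simp add: colim_group_def)
qed

lemma colim_stage2:
  assumes "A \<in> carrier L" "B \<in> carrier L"
  obtains k x y where "k \<in> Obj C" "x \<in> carrier (G k)" "y \<in> carrier (G k)" "A = \<iota> k x" "B = \<iota> k y"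
proof -
  obtain i x j y where xy: "i \<in> Obj C" "x \<in> carrier (G i)" "j \<in> Obj C" "y \<in> carrier (G j)"
    and AB: "A = \<iota> i x" "B = \<iota> j y"
    using assms by (auto simp: carrier_colim)
  obtain k f g where "f \<in> Hom C i k" "g \<in> Hom C j k"
    using cocone_objects[OF xy(1,3)] by blast
  then show thesis
    using that[of k "F f x" "F g y"] xy AB Hom_obj by (simp add: F_closed colim_in_compat)
qed

lemma colim_stage3:
  assumes "A \<in> carrier L" "B \<in> carrier L" "D \<in> carrier L"
  obtains k x y z where "k \<in> Obj C" "x \<in> carrier (G k)" "y \<in> carrier (G k)" "z \<in> carrier (G k)"
    "A = \<iota> k x" "B = \<iota> k y" "D = \<iota> k z"
proof -
  obtain i x y where xy: "i \<in> Obj C" "x \<in> carrier (G i)" "y \<in> carrier (G i)" "A = \<iota> i x" "B = \<iota> i y"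
    using colim_stage2 assms(1,2) .
  obtain j z where z: "j \<in> Obj C" "z \<in> carrier (G j)" "D = \<iota> j z"
    using assms(3) by (auto simp: carrier_colim)
  obtain k f g where "f \<in> Hom C i k" "g \<in> Hom C j k"
    using cocone_objects[OF xy(1) z(1)] by blast
  then show thesis
    using that[of k "F f x" "F f y" "F g z"] xy z Hom_obj by (simp add: F_closed colim_in_compat)
qed

lemma colim_in_closed: "i \<in> Obj C \<Longrightarrow> x \<in> carrier (G i) \<Longrightarrow> \<iota> i x \<in> carrier L"
  by (auto simp: carrier_colim)

theorem comm_group_colim: "comm_group L"
proof (rule comm_groupI)
  show "A \<otimes>\<^bsub>L\<^esub> B \<in> carrier L" if "A \<in> carrier L" "B \<in> carrier L" for A B
    by (rule colim_stage2[OF that]) (simp add: colim_mult_same colim_in_closed G_closed)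
  show "\<one>\<^bsub>L\<^esub> \<in> carrier L"
    using nonempty colim_one colim_in_closed comm_group by (metis comm_groupE(2) ex_in_conv)
  show "A \<otimes>\<^bsub>L\<^esub> B \<otimes>\<^bsub>L\<^esub> D = A \<otimes>\<^bsub>L\<^esub> (B \<otimes>\<^bsub>L\<^esub> D)"
    if "A \<in> carrier L" "B \<in> carrier L" "D \<in> carrier L" for A B D
    by (rule colim_stage3[OF that]) (simp add: colim_mult_same G_closed comm_groupE(3)[OF comm_group])
  show "A \<otimes>\<^bsub>L\<^esub> B = B \<otimes>\<^bsub>L\<^esub> A" if "A \<in> carrier L" "B \<in> carrier L" for A B
    by (rule colim_stage2[OF that]) (simp add: colim_mult_same comm_groupE(4)[OF comm_group])
  fix A assume "A \<in> carrier L"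
  then obtain i x where x: "i \<in> Obj C" "x \<in> carrier (G i)" "A = \<iota> i x"
    by (auto simp: carrier_colim)
  interpret i: comm_group "G i" by (rule comm_group) fact
  show "\<one>\<^bsub>L\<^esub> \<otimes>\<^bsub>L\<^esub> A = A"
    using x by (simp add: colim_one[OF x(1)] colim_mult_same)
  show "\<exists>B\<in>carrier L. B \<otimes>\<^bsub>L\<^esub> A = \<one>\<^bsub>L\<^esub>"
    using x by (intro bexI[of _ "\<iota> i (inv\<^bsub>G i\<^esub> x)"])
      (simp_all add: colim_one[OF x(1)] colim_mult_same colim_in_closed)
qed

theorem colim_in_hom: "i \<in> Obj C \<Longrightarrow> \<iota> i \<in> hom (G i) L"
  by (rule homI) (simp_all add: colim_in_closed colim_mult_same)

theorem colim_universal: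
  fixes A :: "('b, 'z) monoid_scheme"
  assumes A: "comm_group A" and t: "\<And>i. i \<in> Obj C \<Longrightarrow> t i \<in> hom (G i) A"
    and compat: "\<And>i j f x. f \<in> Hom C i j \<Longrightarrow> x \<in> carrier (G i) \<Longrightarrow> t j (F f x) = t i x"
  shows "\<exists>!s. s \<in> extensional (carrier L) \<and> s \<in> hom L A \<and>
    (\<forall>i\<in>Obj C. \<forall>x\<in>carrier (G i). s (\<iota> i x) = t i x)"
proof -
  define s where "s = (\<lambda>A\<in>carrier L. case SOME p. p \<in> A of (i, x) \<Rightarrow> t i x)"
  have s: "s (\<iota> i x) = t i x" if "i \<in> Obj C" "x \<in> carrier (G i)" for i x
  proof -
    obtain j y where p: "(SOME p. p \<in> \<iota> i x) = (j, y)" by force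
    have "(i, x) \<in> \<iota> i x"
      using that by (auto simp: mem_colim_in intro: equiv_class_self[OF equiv_R, unfolded Image_singleton_iff])
    then have "(j, y) \<in> \<iota> i x" using p someI by metis
    then obtain k f g where "f \<in> Hom C i k" "g \<in> Hom C j k" "F f x = F g y" "y \<in> carrier (G j)"
      by (auto simp: mem_colim_in colim_rel_def)
    then have "t j y = t i x" using compat that by metis
    then show ?thesis using that by (simp add: s_def p colim_in_closed)
  qed
  show ?thesis
  proof (rule ex1I[of _ s], intro conjI ballI)
    show "s \<in> extensional (carrier L)" by (simp add: s_def)
    show "s \<in> hom L A"
    proof (rule homI)
      show "s X \<in> carrier A" if "X \<in> carrier L" for X
        using that hom_in_carrier[OF t] by (auto simp: carrier_colim s)
      show "s (X \<otimes>\<^bsub>L\<^esub> Y) = s X \<otimes>\<^bsub>A\<^esub> s Y" if "X \<in> carrier L" "Y \<in> carrier L" for X Y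
        by (rule colim_stage2[OF that]) (simp add: colim_mult_same s G_closed hom_mult[OF t])
    qed
  next
    fix i x assume "i \<in> Obj C" "x \<in> carrier (G i)"
    then show "s (\<iota> i x) = t i x" by (rule s)
  next
    fix s' assume s': "s' \<in> extensional (carrier L) \<and> s' \<in> hom L A \<and>
      (\<forall>i\<in>Obj C. \<forall>x\<in>carrier (G i). s' (\<iota> i x) = t i x)"
    show "s' = s"
    proof (rule extensionalityI)
      show "s' X = s X" if "X \<in> carrier L" for X
        using that s' s by (auto simp: carrier_colim)
    qed (use s' in \<open>auto simp: s_def\<close>)
  qed
qed

theorem lim_H3_subgroup:
  assumes M: "comm_group M"
  shows "subgroup (carrier (lim_H3 C G F M)) (product_group (Obj C) (\<lambda>i. H3_2ab (G i) M))"
proof -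
  let ?P = "product_group (Obj C) (\<lambda>i. H3_2ab (G i) M)"
  have H: "Group.group (H3_2ab (G i) M)" if "i \<in> Obj C" for i
    using comm_group_H3[OF comm_group[OF that] M] by (simp add: comm_group_def)
  interpret P: Group.group ?P using H by simp
  have T: "group_hom (H3_2ab (G (Cod C f)) M) (H3_2ab (G (Dom C f)) M) (H3_map (G (Dom C f)) M (F f))"
    if "f \<in> Arr C" for f
    using that H H3_map_hom[OF comm_group comm_group M hom[of f]]
    by (auto simp: group_hom_def group_hom_axioms_def Dom_in Cod_in Hom_def)
  show ?thesis
  proof (rule P.subgroupI)
    have "\<one>\<^bsub>?P\<^esub> \<in> carrier (lim_H3 C G F M)"
      using group_hom.hom_one[OF T] P.one_closed
      by (simp add: lim_H3_def lim_group_def Dom_in Cod_in del: restrict_apply)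
        (simp add: Dom_in Cod_in)
    then show "carrier (lim_H3 C G F M) \<noteq> {}" by blast
    show "carrier (lim_H3 C G F M) \<subseteq> carrier ?P" by (auto simp: lim_H3_def lim_group_def)
  next
    fix a assume a: "a \<in> carrier (lim_H3 C G F M)"
    have "a \<in> carrier ?P" using a by (simp add: lim_H3_def lim_group_def)
    then show "inv\<^bsub>?P\<^esub> a \<in> carrier (lim_H3 C G F M)"
      using a P.inv_closed[of a] group_hom.hom_inv[OF T] H
      by (auto simp: lim_H3_def lim_group_def Dom_in Cod_in PiE_iff)
  next
    fix a b assume a: "a \<in> carrier (lim_H3 C G F M)" and b: "b \<in> carrier (lim_H3 C G F M)"
    then show "a \<otimes>\<^bsub>?P\<^esub> b \<in> carrier (lim_H3 C G F M)"
      using P.m_closed[of a b] group_hom.hom_mult[OF T]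
      by (auto simp: lim_H3_def lim_group_def Dom_in Cod_in PiE_iff)
  qed
qed

theorem H3_colim_to_lim_hom:
  fixes M :: "('m, 'z) monoid_scheme"
  assumes M: "comm_group M"
  shows "H3_colim_to_lim C G F M \<in> hom (H3_2ab L M) (lim_H3 C G F M)"
proof (rule homI)
  have h: "H3_map (G i) M (\<iota> i) \<in> hom (H3_2ab L M) (H3_2ab (G i) M)" if "i \<in> Obj C" for i
    using that by (intro H3_map_hom comm_group comm_group_colim M colim_in_hom)
  have compat: "H3_map (G (Dom C f)) M (F f) (H3_map (G (Cod C f)) M (\<iota> (Cod C f)) u)
      = H3_map (G (Dom C f)) M (\<iota> (Dom C f)) u"
    if f: "f \<in> Arr C" and u: "u \<in> carrier (H3_2ab L M)" for f u
  proof -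
    let ?i = "Dom C f" and ?j = "Cod C f"
    have ij: "f \<in> Hom C ?i ?j" "?i \<in> Obj C" "?j \<in> Obj C"
      using f by (auto simp: Hom_def Dom_in Cod_in)
    have "H3_map (G ?i) M (\<iota> ?j \<circ> F f) u = H3_map (G ?i) M (F f) (H3_map (G ?j) M (\<iota> ?j) u)"
      by (rule H3_map_comp[OF comm_group[OF ij(2)] comm_group[OF ij(3)] comm_group_colim M hom[OF ij(1)]
          colim_in_hom[OF ij(3)] u])
    moreover have "H3_map (G ?i) M (\<iota> ?j \<circ> F f) u = H3_map (G ?i) M (\<iota> ?i) u"
    proof -
      have "pullback_2ab (G ?i) (\<iota> ?j \<circ> F f) z = pullback_2ab (G ?i) (\<iota> ?i) z"
        for z :: "(('o \<times> 'a) set \<times> ('o \<times> 'a) set \<times> ('o \<times> 'a) set \<Rightarrow> 'm)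
            \<times> (('o \<times> 'a) set \<times> ('o \<times> 'a) set \<Rightarrow> 'm)"
        using ij by (auto simp: pullback_2ab_def colim_in_compat split: prod.splits intro!: restrict_ext)
      then show ?thesis by (simp add: H3_map_def)
    qed
    ultimately show ?thesis by simp
  qed
  fix u assume u: "u \<in> carrier (H3_2ab L M)"
  show "H3_colim_to_lim C G F M u \<in> carrier (lim_H3 C G F M)"
    using u compat hom_in_carrier[OF h]
    by (auto simp: H3_colim_to_lim_def lim_H3_def lim_group_def Dom_in Cod_in)
  fix v assume v: "v \<in> carrier (H3_2ab L M)"
  show "H3_colim_to_lim C G F M (u \<otimes>\<^bsub>H3_2ab L M\<^esub> v)
      = H3_colim_to_lim C G F M u \<otimes>\<^bsub>lim_H3 C G F M\<^esub> H3_colim_to_lim C G F M v"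
    using u v hom_mult[OF h]
    by (auto simp: H3_colim_to_lim_def lim_H3_def lim_group_def intro!: restrict_ext)
qed

end

end

theory Submission
  imports Defs "HOL-Library.Poly_Mapping"
begin

text \<open>
  By Eilenberg and Mac Lane, \<open>(h, c) \<mapsto> q\<close> with \<open>q x = c (x, x)\<close> identifies \<open>H\<^sup>3(G, M)\<close> with the quadratic
  maps \<open>G \<rightarrow> M\<close>, and a quadratic map on a colimit is the same as a compatible family of them.

  Let \<open>P\<close> be the free abelian group on \<open>G\<close> and \<open>R\<close> the kernel of \<open>P \<rightarrow> G\<close>. Instead of a basis of \<open>R\<close> we use
  the elements of \<open>R\<close> supported in a set \<open>J\<close>: enlarging \<open>J\<close> by one generator splits off at most one
  infinite cyclic summand, so Zorn's lemma reduces constructions on \<open>R\<close> (or \<open>P\<close>) to that step.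

  Surjectivity: choose a biadditive \<open>B\<close> on \<open>P\<close> with \<open>B p p = q p\<close>. It is alternating on \<open>R\<close>, hence equal to
  \<open>D x y - D y x\<close> there for a biadditive \<open>D\<close>. For a section \<open>s\<close> of \<open>P \<rightarrow> G\<close> with \<open>f x y = s x + s y - s (x + y)\<close>, the pair
  \<open>h x y z = B (s x) (f y z) + D (f (x + y) z) (f x y) - D (f x (y + z)) (f y z)\<close>, \<open>c x y = B (s x) (s y)\<close> is a cocycle
  with trace \<open>q\<close>. The terms with \<open>D\<close> form a cup-1-product correcting the defect \<open>B (f x y) (f z w)\<close>.

  Injectivity: a cocycle with trace zero becomes the coboundary of some \<open>k\<close> on \<open>P\<close>. On \<open>R\<close> this \<open>k\<close> is a symmetric
  2-cocycle, hence splits, and after subtracting a suitable extension of the splitting \<open>k\<close> descends to \<open>G\<close>.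
\<close>


section \<open>Integer sums and multiples\<close>

text \<open>The discrete antiderivative of \<open>f\<close> on all integers: it is 0 at 0 and grows
  by \<open>f m\<close> from m to m + 1. For negative m this forces minus the sum of
  \<open>f\<close> over m, ..., -1.\<close>

definition zsum :: "(int \<Rightarrow> 'a::ab_group_add) \<Rightarrow> int \<Rightarrow> 'a"
  where "zsum f m = (\<Sum>i<nat m. f (int i)) - (\<Sum>i<nat (-m). f (- int i - 1))"

lemma zsum_0 [simp]: "zsum f 0 = 0"
  by (simp add: zsum_def)

lemma zsum_Suc: "zsum f (m + 1) = zsum f m + f m"
proof (cases "m \<ge> 0")
  case True
  then have "nat (m + 1) = Suc (nat m)" "nat (- m) = 0" "nat (- (m + 1)) = 0" by auto
  then show ?thesis using True by (simp add: zsum_def)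
next
  case False
  then have "nat (m + 1) = 0" "nat m = 0" "nat (- m) = Suc (nat (- (m + 1)))" by auto
  then show ?thesis using False by (simp add: zsum_def)
qed

definition zscale :: "int \<Rightarrow> 'a::ab_group_add \<Rightarrow> 'a"
  where "zscale m x = zsum (\<lambda>_. x) m"

lemma zscale_0 [simp]: "zscale 0 x = 0"
  by (simp add: zscale_def)

lemma zscale_Suc: "zscale (m + 1) x = zscale m x + x"
  by (simp add: zscale_def zsum_Suc)

lemma zscale_pred: "zscale (m - 1) x = zscale m x - x"
  using zscale_Suc[of "m - 1" x] by simp

lemma zscale_1 [simp]: "zscale 1 x = x"
  using zscale_Suc[of 0 x] by simp

lemma zscale_add: "zscale (m + n) x = zscale m x + zscale n x"
proof (induction n rule: int_induct[where k = 0])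
  case base then show ?case by simp
next
  case (step1 i)
  then show ?case using zscale_Suc[of "m + i" x] zscale_Suc[of i x] by (simp add: add.assoc)
next
  case (step2 i)
  then show ?case using zscale_pred[of "m + i" x] zscale_pred[of i x] by (simp add: add_diff_eq)
qed

lemma zscale_diff: "zscale (m - n) x = zscale m x - zscale n x"
  using zscale_add[of "m - n" n x] by simp

text \<open>Additivity is asked for only along the multiples of \<open>x\<close>, so that maps
  additive merely on a subgroup are covered.\<close>

lemma additive_zscale:
  fixes f :: "'a::ab_group_add \<Rightarrow> 'b::ab_group_add"
  assumes "\<And>m. f (zscale (m + 1) x) = f (zscale m x) + f x" "f 0 = 0"
  shows "f (zscale m x) = zscale m (f x)"
proof (induction m rule: int_induct[where k = 0])
  case base then show ?case using assms by simp
next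
  case (step1 i) then show ?case using assms(1)[of i] zscale_Suc[of i "f x"] by simp
next
  case (step2 i) then show ?case using assms(1)[of "i - 1"] zscale_pred[of i "f x"] by (simp add: algebra_simps)
qed

lemma zscale_zero [simp]: "zscale m 0 = 0"
  using additive_zscale[of "\<lambda>_. 0" 0 m] by simp

lemma zscale_distrib: "zscale m (x + y) = zscale m x + zscale m y"
proof (induction m rule: int_induct[where k = 0])
  case base then show ?case by simp
next
  case (step1 i) show ?case unfolding zscale_Suc step1 by (simp add: ac_simps)
next
  case (step2 i) show ?case unfolding zscale_pred step2 by (simp add: algebra_simps)
qed

lemma lookup_zscale: "Poly_Mapping.lookup (zscale m x) i = m * Poly_Mapping.lookup x i"
proof (induction m rule: int_induct[where k = 0])
  case base then show ?case by simp
next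
  case (step1 i) show ?case unfolding zscale_Suc lookup_add step1 by (simp add: algebra_simps)
next
  case (step2 i) then show ?case by (simp add: zscale_pred lookup_minus algebra_simps)
qed

section \<open>Extension along a filtration of a subgroup of a free abelian group\<close>

definition additive_subgroup_set :: "'a::ab_group_add set \<Rightarrow> bool"
  where "additive_subgroup_set A \<longleftrightarrow> 0 \<in> A \<and> (\<forall>x\<in>A. \<forall>y\<in>A. x - y \<in> A)"

lemma additive_subgroup_setD:
  assumes "additive_subgroup_set A"
  shows "0 \<in> A" "x \<in> A \<Longrightarrow> y \<in> A \<Longrightarrow> x - y \<in> A" "x \<in> A \<Longrightarrow> - x \<in> A"
    "x \<in> A \<Longrightarrow> y \<in> A \<Longrightarrow> x + y \<in> A" "x \<in> A \<Longrightarrow> zscale m x \<in> A"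
proof -
  show d: "x - y \<in> A" if "x \<in> A" "y \<in> A" for x y
    using assms that by (auto simp: additive_subgroup_set_def)
  show "0 \<in> A" using assms by (auto simp: additive_subgroup_set_def)
  then show u: "- x \<in> A" if "x \<in> A" for x using d[of 0 x] that by simp
  show p: "x + y \<in> A" if "x \<in> A" "y \<in> A" for x y using d[of x "- y"] u that by simp
  show "x \<in> A \<Longrightarrow> zscale m x \<in> A"
    by (induction m rule: int_induct[where k = 0])
       (use \<open>0 \<in> A\<close> d p in \<open>auto simp: zscale_Suc zscale_pred\<close>)
qed

section \<open>Adjoining one generator to a subgroup\<close>

definition adjoin :: "'a::ab_group_add set \<Rightarrow> 'a \<Rightarrow> 'a set"
  where "adjoin A r = {a + zscale m r | a m. a \<in> A}"

text \<open>That is, \<open>r\<close> has infinite order modulo \<open>A\<close>; for a subgroup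
  \<open>A\<close>, \<open>adjoin A r\<close> is then the direct sum of \<open>A\<close> and an
  infinite cyclic group.\<close>

definition independent_over :: "'a::ab_group_add set \<Rightarrow> 'a \<Rightarrow> bool"
  where "independent_over A r \<longleftrightarrow> (\<forall>m. zscale m r \<in> A \<longrightarrow> m = 0)"

lemma adjoinI: "a \<in> A \<Longrightarrow> a + zscale m r \<in> adjoin A r"
  by (auto simp: adjoin_def)

lemma adjoin_subgroup:
  assumes "additive_subgroup_set A" shows "additive_subgroup_set (adjoin A r)"
  unfolding additive_subgroup_set_def
proof (intro conjI ballI)
  show "0 \<in> adjoin A r" using adjoinI[of 0 A 0 r] additive_subgroup_setD(1)[OF assms] by simp
  fix x y assume "x \<in> adjoin A r" "y \<in> adjoin A r"
  then obtain a m b n where "x = a + zscale m r" "y = b + zscale n r" "a \<in> A" "b \<in> A"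
    by (auto simp: adjoin_def)
  then show "x - y \<in> adjoin A r"
    using adjoinI[of "a - b" A "m - n" r] additive_subgroup_setD(2)[OF assms]
    by (simp add: zscale_diff algebra_simps)
qed

text \<open>Subtracting two expressions of one element gives a multiple of \<open>r\<close> in
  \<open>A\<close>, which independence makes trivial. Off \<open>adjoin A r\<close> the coordinates
  are arbitrary.\<close>

lemma adjoin_coordinates:
  assumes A: "additive_subgroup_set A" and r: "independent_over A r"
  obtains \<alpha> \<mu> where "\<And>a m. a \<in> A \<Longrightarrow> \<alpha> (a + zscale m r) = a" "\<And>a m. a \<in> A \<Longrightarrow> \<mu> (a + zscale m r) = m"
proof -
  have uniq: "a = b \<and> m = n" if "a \<in> A" "b \<in> A" "a + zscale m r = b + zscale n r" for a b m n
  proof -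
    have "zscale (m - n) r = b - a" using that(3) by (simp add: zscale_diff algebra_simps)
    then have "zscale (m - n) r \<in> A" using additive_subgroup_setD(2)[OF A] that by simp
    then have "m = n" using r by (auto simp: independent_over_def)
    then show ?thesis using that(3) by simp
  qed
  define P where "P x p \<longleftrightarrow> fst p \<in> A \<and> x = fst p + zscale (snd p) r" for x p
  have "(SOME p. P (a + zscale m r) p) = (a, m)" if "a \<in> A" for a m
  proof (rule some_equality)
    show "P (a + zscale m r) (a, m)" using that by (simp add: P_def)
    show "p = (a, m)" if "P (a + zscale m r) p" for p
      using uniq[of a "fst p" m "snd p"] that \<open>a \<in> A\<close> by (auto simp: P_def prod_eq_iff)
  qed
  then show thesis
    using that[of "\<lambda>x. fst (SOME p. P x p)" "\<lambda>x. snd (SOME p. P x p)"] by simp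
qed

section \<open>The filtration of a subgroup by supports\<close>

definition supported_in :: "('i \<Rightarrow>\<^sub>0 int) set \<Rightarrow> 'i set \<Rightarrow> ('i \<Rightarrow>\<^sub>0 int) set"
  where "supported_in R J = {x \<in> R. Poly_Mapping.keys x \<subseteq> J}"

lemma supported_in_iff:
  "x \<in> supported_in R J \<longleftrightarrow> x \<in> R \<and> (\<forall>i. i \<notin> J \<longrightarrow> Poly_Mapping.lookup x i = 0)"
  by (auto simp: supported_in_def in_keys_iff)

lemma supported_in_subgroup:
  assumes "additive_subgroup_set R" shows "additive_subgroup_set (supported_in R J)"
  unfolding additive_subgroup_set_def
  by (simp add: supported_in_iff additive_subgroup_setD[OF assms] lookup_minus)

text \<open>The \<open>i\<close>-th coefficients of the elements supported in \<open>insert i J\<close> form an ideal of the integers;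
  \<open>r\<close> attains its positive generator.\<close>

lemma supported_in_insert:
  assumes R: "additive_subgroup_set R" and i: "i \<notin> J"
  shows "supported_in R (insert i J) = supported_in R J \<or>
    (\<exists>r. independent_over (supported_in R J) r \<and> supported_in R (insert i J) = adjoin (supported_in R J) r)"
proof (cases "\<forall>x\<in>supported_in R (insert i J). Poly_Mapping.lookup x i = 0")
  case True
  then have "supported_in R (insert i J) = supported_in R J"
    unfolding set_eq_iff by (metis supported_in_iff insert_iff)
  then show ?thesis ..
next
  case False
  let ?A = "supported_in R J" and ?A' = "supported_in R (insert i J)"
  note D = additive_subgroup_setD[OF supported_in_subgroup[OF R, of "insert i J"]]
  define Q where "Q n \<longleftrightarrow> n > 0 \<and> (\<exists>x\<in>?A'. Poly_Mapping.lookup x i = int n)" for n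
  obtain x0 where x0: "x0 \<in> ?A'" "Poly_Mapping.lookup x0 i \<noteq> 0" using False by blast
  have "\<exists>n. Q n"
  proof (cases "Poly_Mapping.lookup x0 i > 0")
    case True then show ?thesis using x0 by (intro exI[of _ "nat (Poly_Mapping.lookup x0 i)"]) (auto simp: Q_def)
  next
    case False
    then show ?thesis using x0 D(3)[OF x0(1)]
      by (intro exI[of _ "nat (- Poly_Mapping.lookup x0 i)"]) (auto simp: Q_def intro!: bexI[of _ "- x0"])
  qed
  then have Q: "Q (LEAST n. Q n)" by (rule LeastI_ex)
  define n where "n = (LEAST n. Q n)"
  obtain r where r: "r \<in> ?A'" "Poly_Mapping.lookup r i = int n" and n: "n > 0"
    using Q by (auto simp: Q_def n_def)
  have min: "\<not> Q k" if "k < n" for k using that not_less_Least n_def by blast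
  have zero: "x \<in> ?A" if "x \<in> ?A'" "Poly_Mapping.lookup x i = 0" for x
    using that by (auto simp: supported_in_iff)
  have "x \<in> adjoin ?A r" if x: "x \<in> ?A'" for x
  proof -
    \<comment> \<open>Division with remainder: the \<open>i\<close>-th coefficient of
      \<open>y\<close> is nonnegative and below the least positive one, hence zero.\<close>
    define y where "y = x - zscale (Poly_Mapping.lookup x i div int n) r"
    have y: "y \<in> ?A'" unfolding y_def by (intro D(2) D(5) x r)
    have ly: "Poly_Mapping.lookup y i = Poly_Mapping.lookup x i mod int n"
      by (simp add: y_def lookup_minus lookup_zscale r minus_div_mult_eq_mod)
    have "Poly_Mapping.lookup y i = 0"
    proof (rule ccontr)
      assume "Poly_Mapping.lookup y i \<noteq> 0"
      moreover have "Poly_Mapping.lookup y i \<ge> 0" "Poly_Mapping.lookup y i < int n" using n by (simp_all add: ly)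
      ultimately have "Q (nat (Poly_Mapping.lookup y i))" "nat (Poly_Mapping.lookup y i) < n" using y by (auto simp: Q_def)
      then show False using min by blast
    qed
    then have "y \<in> ?A" using y zero by blast
    then show ?thesis using adjoinI[of y ?A "Poly_Mapping.lookup x i div int n" r] by (simp add: y_def)
  qed
  moreover have "x \<in> ?A'" if x: "x \<in> adjoin ?A r" for x
  proof -
    have "?A \<subseteq> ?A'" by (auto simp: supported_in_def)
    moreover obtain a m where "x = a + zscale m r" "a \<in> ?A" using x by (auto simp: adjoin_def)
    ultimately show ?thesis using D(4)[of a "zscale m r"] D(5)[of r m] r(1) by blast
  qed
  moreover have "independent_over ?A r"
    unfolding independent_over_def
  proof (intro allI impI)
    fix m assume "zscale m r \<in> ?A"
    then have "Poly_Mapping.lookup (zscale m r) i = 0" using i by (auto simp: supported_in_def in_keys_iff)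
    then show "m = 0" using n r by (simp add: lookup_zscale)
  qed
  ultimately show ?thesis by blast
qed

text \<open>Zorn's lemma on the partial solutions over \<open>supported_in R J\<close>; outside this set they are \<open>undefined\<close>,
  which makes the order antisymmetric.\<close>

theorem free_extension_principle:
  fixes R :: "('i \<Rightarrow>\<^sub>0 int) set" and f0 :: "('i \<Rightarrow>\<^sub>0 int) \<Rightarrow> ('i \<Rightarrow>\<^sub>0 int) \<Rightarrow> 'm"
    and \<phi> :: "(('i \<Rightarrow>\<^sub>0 int) \<Rightarrow> ('i \<Rightarrow>\<^sub>0 int) \<Rightarrow> 'm) \<Rightarrow> ('i \<Rightarrow>\<^sub>0 int) \<Rightarrow> ('i \<Rightarrow>\<^sub>0 int) \<Rightarrow> ('i \<Rightarrow>\<^sub>0 int) \<Rightarrow> bool"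
  assumes R: "additive_subgroup_set R"
    and cong: "\<And>A f g a b c. additive_subgroup_set A \<Longrightarrow> (\<And>x y. x \<in> A \<Longrightarrow> y \<in> A \<Longrightarrow> f x y = g x y)
      \<Longrightarrow> a \<in> A \<Longrightarrow> b \<in> A \<Longrightarrow> c \<in> A \<Longrightarrow> \<phi> f a b c \<Longrightarrow> \<phi> g a b c"
    and base: "\<phi> f0 0 0 0"
    and step: "\<And>A r f. additive_subgroup_set A \<Longrightarrow> independent_over A r \<Longrightarrow> adjoin A r \<subseteq> R
      \<Longrightarrow> (\<And>a b c. a \<in> A \<Longrightarrow> b \<in> A \<Longrightarrow> c \<in> A \<Longrightarrow> \<phi> f a b c)
      \<Longrightarrow> \<exists>g. (\<forall>x\<in>A. \<forall>y\<in>A. g x y = f x y) \<and> (\<forall>a\<in>adjoin A r. \<forall>b\<in>adjoin A r. \<forall>c\<in>adjoin A r. \<phi> g a b c)"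
  shows "\<exists>f. \<forall>a\<in>R. \<forall>b\<in>R. \<forall>c\<in>R. \<phi> f a b c"
proof -
  let ?S = "supported_in R"
  define res where "res A f = (\<lambda>x y. if x \<in> A \<and> y \<in> A then f x y else undefined)"
    for A and f :: "('i \<Rightarrow>\<^sub>0 int) \<Rightarrow> ('i \<Rightarrow>\<^sub>0 int) \<Rightarrow> 'm"
  define \<A> where "\<A> = {(J, f). res (?S J) f = f \<and> (\<forall>a\<in>?S J. \<forall>b\<in>?S J. \<forall>c\<in>?S J. \<phi> f a b c)}"
  define le :: "'i set \<times> (('i \<Rightarrow>\<^sub>0 int) \<Rightarrow> ('i \<Rightarrow>\<^sub>0 int) \<Rightarrow> 'm) \<Rightarrow> _ \<Rightarrow> bool"
    where "le = (\<lambda>(J, f) (J', f'). J \<subseteq> J' \<and> (\<forall>x\<in>?S J. \<forall>y\<in>?S J. f' x y = f x y))"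
  note sub = supported_in_subgroup[OF R]
  have mono: "?S J \<subseteq> ?S J'" if "J \<subseteq> J'" for J J'
    using that by (auto simp: supported_in_def)
  have leD: "fst p \<subseteq> fst q" "x \<in> ?S (fst p) \<Longrightarrow> y \<in> ?S (fst p) \<Longrightarrow> snd q x y = snd p x y"
    if "le p q" for p q x y
    using that by (cases p; cases q; simp add: le_def)+
  have intro: "(J, res (?S J) f) \<in> \<A>" if "\<And>a b c. a \<in> ?S J \<Longrightarrow> b \<in> ?S J \<Longrightarrow> c \<in> ?S J \<Longrightarrow> \<phi> f a b c" for J f
    using cong[OF sub, of J f "res (?S J) f"] that by (auto simp: \<A>_def res_def fun_eq_iff)
  have "\<exists>m\<in>\<A>. \<forall>a\<in>\<A>. le m a \<longrightarrow> a = m"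
  proof (rule predicate_Zorn)
    show "partial_order_on \<A> (relation_of le \<A>)"
    proof (rule partial_order_on_relation_ofI)
      show "le a a" for a by (auto simp: le_def)
      show "le a c" if "le a b" "le b c" for a b c
      proof -
        obtain J f J' f' J'' f'' where e: "a = (J, f)" "b = (J', f')" "c = (J'', f'')" by (metis surj_pair)
        have "?S J \<subseteq> ?S J'" using that mono[of J J'] by (simp add: e le_def)
        then show ?thesis using that by (simp add: e le_def) (metis order_trans subsetD)
      qed
      show "a = b" if "a \<in> \<A>" "b \<in> \<A>" "le a b" "le b a" for a b
      proof -
        obtain J f J' f' where ab: "a = (J, f)" "b = (J', f')" by (metis surj_pair)
        then have J: "J = J'" and f: "\<And>x y. x \<in> ?S J \<Longrightarrow> y \<in> ?S J \<Longrightarrow> f' x y = f x y"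
          using that by (auto simp: le_def)
        have "f = res (?S J) f" "f' = res (?S J) f'" using that ab J by (auto simp: \<A>_def)
        moreover have "res (?S J) f = res (?S J) f'" using f unfolding res_def by (intro ext) simp
        ultimately show ?thesis using ab J by simp
      qed
    qed
  next
    fix \<C> assume C: "\<C> \<in> Chains (relation_of le \<A>)"
    then have CA: "p \<in> \<A>" if "p \<in> \<C>" for p using that by (auto simp: Chains_def relation_of_def)
    have lin: "le p q \<or> le q p" if "p \<in> \<C>" "q \<in> \<C>" for p q
      using C that by (auto simp: Chains_def relation_of_def)
    show "\<exists>u\<in>\<A>. \<forall>a\<in>\<C>. le a u"
    proof (cases "\<C> = {}")
      \<comment> \<open>The empty chain is bounded by the solution over the empty set of generators,
        where only 0 is supported and \<open>base\<close> applies.\<close>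
      case True
      have "?S {} \<subseteq> {0}" by (auto simp: supported_in_def)
      then have "({}, res (?S {}) f0) \<in> \<A>" using base by (intro intro) blast
      then show ?thesis using True by blast
    next
      case False
      define J where "J = (\<Union>p\<in>\<C>. fst p)"
      have lin_subset: "fst p \<subseteq> fst q \<or> fst q \<subseteq> fst p" if "p \<in> \<C>" "q \<in> \<C>" for p q
        using lin[OF that] leD(1) by blast
      \<comment> \<open>Elements have finite support and the chain is linearly ordered, so finitely
        many elements over \<open>J\<close> already live over one member of the chain. As the
        property concerns only three elements at a time, it passes to the union.\<close>
      have cover: "\<exists>p\<in>\<C>. X \<subseteq> ?S (fst p)" if "finite X" "X \<subseteq> ?S J" for X
        using that
      proof (induction X rule: finite_induct)
        case empty then show ?case using False by blast
      next
        case (insert x X)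
        have "\<exists>p\<in>\<C>. Y \<subseteq> fst p" if "finite Y" "Y \<subseteq> J" for Y
          using that
        proof (induction Y rule: finite_induct)
          case empty then show ?case using False by blast
        next
          case (insert y Y)
          then obtain p q where "p \<in> \<C>" "Y \<subseteq> fst p" "q \<in> \<C>" "y \<in> fst q" by (auto simp: J_def)
          with lin_subset[of p q] have "insert y Y \<subseteq> fst q \<or> insert y Y \<subseteq> fst p" by blast
          with \<open>p \<in> \<C>\<close> \<open>q \<in> \<C>\<close> show ?case by blast
        qed
        from this[of "Poly_Mapping.keys x"] obtain q where "q \<in> \<C>" "x \<in> ?S (fst q)"
          using insert.prems by (auto simp: supported_in_def)
        moreover obtain p where "p \<in> \<C>" "X \<subseteq> ?S (fst p)" using insert by auto
        ultimately have "insert x X \<subseteq> ?S (fst q) \<or> insert x X \<subseteq> ?S (fst p)"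
          using lin_subset[of p q] mono[of "fst p" "fst q"] mono[of "fst q" "fst p"] by blast
        with \<open>p \<in> \<C>\<close> \<open>q \<in> \<C>\<close> show ?case by blast
      qed
      \<comment> \<open>Any two members of the chain agree where both are defined, so the choice
        does not affect the value.\<close>
      define f where "f x y = snd (SOME p. p \<in> \<C> \<and> x \<in> ?S (fst p) \<and> y \<in> ?S (fst p)) x y" for x y
      have f: "f x y = snd p x y" if "p \<in> \<C>" "x \<in> ?S (fst p)" "y \<in> ?S (fst p)" for p x y
      proof -
        define q where "q = (SOME p. p \<in> \<C> \<and> x \<in> ?S (fst p) \<and> y \<in> ?S (fst p))"
        have "q \<in> \<C> \<and> x \<in> ?S (fst q) \<and> y \<in> ?S (fst q)"
          unfolding q_def by (rule someI[of _ p]) (use that in blast)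
        then have "snd q x y = snd p x y"
          using lin[of p q] leD(2)[of p q x y] leD(2)[of q p x y] that by auto
        then show ?thesis by (simp add: f_def q_def)
      qed
      have "\<phi> f a b c" if abc: "a \<in> ?S J" "b \<in> ?S J" "c \<in> ?S J" for a b c
      proof -
        obtain p where p: "p \<in> \<C>" "{a, b, c} \<subseteq> ?S (fst p)" using cover[of "{a, b, c}"] abc by auto
        have "\<phi> (snd p) a b c" using CA[OF p(1)] p(2) by (auto simp: \<A>_def)
        then show ?thesis using cong[OF sub, of "fst p" "snd p" f a b c] f[OF p(1)] p(2) by auto
      qed
      then have "(J, res (?S J) f) \<in> \<A>" by (rule intro)
      moreover have "le p (J, res (?S J) f)" if "p \<in> \<C>" for p
      proof -
        have "fst p \<subseteq> J" using that by (auto simp: J_def)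
        then show ?thesis using f[OF that] mono[of "fst p" J] by (auto simp: le_def res_def case_prod_beta)
      qed
      ultimately show ?thesis by blast
    qed
  qed
  then obtain J f where Jf: "(J, f) \<in> \<A>" and max: "\<And>q. q \<in> \<A> \<Longrightarrow> le (J, f) q \<Longrightarrow> q = (J, f)" by fast
  \<comment> \<open>If a generator were missing, \<open>supported_in_insert\<close> together with
    \<open>step\<close> would give a strictly larger solution.\<close>
  have "J = UNIV"
  proof (rule ccontr)
    assume "J \<noteq> UNIV"
    then obtain i where i: "i \<notin> J" by blast
    have "\<exists>g. (\<forall>x\<in>?S J. \<forall>y\<in>?S J. g x y = f x y) \<and>
      (\<forall>a\<in>?S (insert i J). \<forall>b\<in>?S (insert i J). \<forall>c\<in>?S (insert i J). \<phi> g a b c)"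
    proof (cases "?S (insert i J) = ?S J")
      case True then show ?thesis using Jf by (auto simp: \<A>_def)
    next
      case False
      then obtain r where r: "independent_over (?S J) r" "?S (insert i J) = adjoin (?S J) r"
        using supported_in_insert[OF R i] by blast
      have "?S (insert i J) \<subseteq> R" by (auto simp: supported_in_def)
      then show ?thesis using step[OF sub r(1), of f] Jf r(2) by (auto simp: \<A>_def)
    qed
    then obtain g where g: "\<And>x y. x \<in> ?S J \<Longrightarrow> y \<in> ?S J \<Longrightarrow> g x y = f x y"
      "\<And>a b c. a \<in> ?S (insert i J) \<Longrightarrow> b \<in> ?S (insert i J) \<Longrightarrow> c \<in> ?S (insert i J) \<Longrightarrow> \<phi> g a b c" by blast
    have "(insert i J, res (?S (insert i J)) g) \<in> \<A>" by (rule intro) (rule g)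
    moreover have "le (J, f) (insert i J, res (?S (insert i J)) g)"
      using g(1) mono[of J "insert i J"] by (auto simp: le_def res_def)
    ultimately show False using max i by blast
  qed
  then have "?S J = R" by (auto simp: supported_in_iff)
  then show ?thesis using Jf by (auto simp: \<A>_def)
qed

section \<open>Quadratic maps and biadditive maps\<close>

definition polarization :: "('a::ab_group_add \<Rightarrow> 'm::ab_group_add) \<Rightarrow> 'a \<Rightarrow> 'a \<Rightarrow> 'm"
  where "polarization q x y = q (x + y) - q x - q y"

text \<open>The polarization is symmetric, so additivity in its first argument makes it biadditive.
  Given that, the second condition amounts to \<open>q (- x) = q x\<close>; among additive maps it
  admits only those killed by 2.\<close>

definition quadratic :: "('a::ab_group_add \<Rightarrow> 'm::ab_group_add) \<Rightarrow> bool"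
  where "quadratic q \<longleftrightarrow> (\<forall>x y z. polarization q (x + y) z = polarization q x z + polarization q y z)
    \<and> (\<forall>x. polarization q x x = q x + q x)"

definition additive_on :: "'a::ab_group_add set \<Rightarrow> ('a \<Rightarrow> 'm::ab_group_add) \<Rightarrow> bool"
  where "additive_on A f \<longleftrightarrow> (\<forall>x\<in>A. \<forall>y\<in>A. f (x + y) = f x + f y)"

definition biadditive_on :: "'a::ab_group_add set \<Rightarrow> ('a \<Rightarrow> 'a \<Rightarrow> 'm::ab_group_add) \<Rightarrow> bool"
  where "biadditive_on A D \<longleftrightarrow> (\<forall>x\<in>A. additive_on A (D x) \<and> additive_on A (\<lambda>y. D y x))"

lemma zscale_neg: "zscale m (- x) = - zscale m x"
  using zscale_distrib[of m x "- x"] by (simp add: eq_neg_iff_add_eq_0 add.commute)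

lemma polarization_commute: "polarization q x y = polarization q y x"
  by (simp add: polarization_def add.commute)

lemma additive_onD:
  assumes f: "additive_on A f" and A: "additive_subgroup_set A"
  shows "x \<in> A \<Longrightarrow> y \<in> A \<Longrightarrow> f (x + y) = f x + f y" "f 0 = 0"
    "x \<in> A \<Longrightarrow> y \<in> A \<Longrightarrow> f (x - y) = f x - f y" "x \<in> A \<Longrightarrow> f (zscale m x) = zscale m (f x)"
proof -
  note D = additive_subgroup_setD[OF A]
  show add: "f (x + y) = f x + f y" if "x \<in> A" "y \<in> A" for x y
    using f that by (simp add: additive_on_def)
  show zero: "f 0 = 0" using add[OF D(1) D(1)] by simp
  show "f (x - y) = f x - f y" if "x \<in> A" "y \<in> A" for x y
    using add[of "x - y" y] that D by simp
  show "f (zscale m x) = zscale m (f x)" if "x \<in> A"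
    by (rule additive_zscale) (simp_all add: zscale_Suc add zero D that)
qed

lemma additive_subgroup_set_UNIV [simp]: "additive_subgroup_set UNIV"
  by (simp add: additive_subgroup_set_def)

lemma quadratic_polarization: "quadratic q \<Longrightarrow> additive_on UNIV (polarization q x)"
  by (simp add: quadratic_def additive_on_def polarization_commute[of q x])

lemma quadratic_zero: "quadratic q \<Longrightarrow> q 0 = 0"
  using additive_onD(2)[OF quadratic_polarization[of q 0]] by (simp add: polarization_def)

lemma quadratic_add: "q (x + y) = q x + q y + polarization q x y"
  by (simp add: polarization_def)

lemma quadratic_zscale:
  assumes q: "quadratic q" shows "q (zscale m x) = zscale m (zscale m (q x))"
proof -
  \<comment> \<open>The defect between q(mx) and m^2 q(x) does not depend on m, and it vanishes at m
    = 0.\<close>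
  have step: "q (zscale (m + 1) x) - zscale (m + 1) (zscale (m + 1) (q x))
      = q (zscale m x) - zscale m (zscale m (q x))" for m
  proof -
    have "q (zscale (m + 1) x) = q (zscale m x) + q x + polarization q x (zscale m x)"
      by (simp add: zscale_Suc quadratic_add polarization_commute)
    also have "polarization q x (zscale m x) = zscale m (q x + q x)"
      using q additive_onD(4)[OF quadratic_polarization[OF q]] by (simp add: quadratic_def)
    finally show ?thesis by (simp add: zscale_Suc zscale_distrib)
  qed
  show ?thesis
  proof (induction m rule: int_induct[where k = 0])
    case base then show ?case using quadratic_zero[OF q] by simp
  next
    case (step1 i) then show ?case using step[of i] by simp
  next
    case (step2 i) then show ?case using step[of "i - 1"] by simp
  qed
qed

section \<open>Biadditive maps built one generator at a time\<close>

lemma biadditive_onD: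
  assumes "biadditive_on A D" "x \<in> A"
  shows "additive_on A (D x)" "additive_on A (\<lambda>y. D y x)"
  using assms by (auto simp: biadditive_on_def)

text \<open>A biadditive extension is determined by its values at \<open>(r, b)\<close>,
  \<open>(a, r)\<close> and \<open>(r, r)\<close> with a, b in \<open>A\<close>. The first are
  prescribed by \<open>\<beta>\<close>, the second are set to zero, and the last is an arbitrary
  \<open>\<kappa>\<close>.\<close>

lemma biadditive_extend:
  fixes D :: "'a::ab_group_add \<Rightarrow> 'a \<Rightarrow> 'm::ab_group_add"
  assumes A: "additive_subgroup_set A" and r: "independent_over A r"
    and D: "biadditive_on A D" and \<beta>: "additive_on A \<beta>"
  obtains D' where "biadditive_on (adjoin A r) D'"
    "\<And>a b m n. a \<in> A \<Longrightarrow> b \<in> A \<Longrightarrow>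
      D' (a + zscale m r) (b + zscale n r) = D a b + zscale m (\<beta> b) + zscale m (zscale n \<kappa>)"
proof -
  obtain \<alpha> \<mu> where \<alpha>: "\<And>a m. a \<in> A \<Longrightarrow> \<alpha> (a + zscale m r) = a" "\<And>a m. a \<in> A \<Longrightarrow> \<mu> (a + zscale m r) = m"
    using adjoin_coordinates[OF A r] by metis
  define D' where "D' x y = D (\<alpha> x) (\<alpha> y) + zscale (\<mu> x) (\<beta> (\<alpha> y)) + zscale (\<mu> x) (zscale (\<mu> y) \<kappa>)" for x y
  have eq: "D' (a + zscale m r) (b + zscale n r) = D a b + zscale m (\<beta> b) + zscale m (zscale n \<kappa>)"
    if "a \<in> A" "b \<in> A" for a b m n
    using that by (simp add: D'_def \<alpha>)
  have sum: "a + zscale m r + (b + zscale n r) = (a + b) + zscale (m + n) r" for a b m n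
    by (simp add: zscale_add algebra_simps)
  have "biadditive_on (adjoin A r) D'"
    unfolding biadditive_on_def additive_on_def
  proof (intro ballI conjI)
    fix x y z assume "x \<in> adjoin A r" "y \<in> adjoin A r" "z \<in> adjoin A r"
    then obtain a m b n c l where e: "x = a + zscale m r" "y = b + zscale n r" "z = c + zscale l r"
      "a \<in> A" "b \<in> A" "c \<in> A"
      by (auto simp: adjoin_def)
    show "D' x (y + z) = D' x y + D' x z" "D' (y + z) x = D' y x + D' z x"
      unfolding e(1-3) sum using e(4-6)
      by (simp_all only: eq additive_subgroup_setD(4)[OF A])
         (simp_all add: zscale_add zscale_distrib additive_onD(1)[OF biadditive_onD(1)[OF D] A]
           additive_onD(1)[OF biadditive_onD(2)[OF D] A] additive_onD(1)[OF \<beta> A] ac_simps)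
  qed
  then show thesis using that eq by blast
qed

text \<open>\<open>B\<close> is modelled on a triangular matrix with \<open>q\<close> on the
  diagonal and the polarization on one side. The values g(r, b) = \<open>polarization q r b\<close>,
  g(a, r) = 0 and g(r, r) = \<open>q r\<close> at a new generator match the expansion q(a + mr) =
  q(a) + m \<open>polarization q r a\<close> + m^2 q(r).\<close>

theorem quadratic_from_biadditive:
  fixes q :: "('i \<Rightarrow>\<^sub>0 int) \<Rightarrow> 'm::ab_group_add"
  assumes q: "quadratic q"
  obtains B where "biadditive_on UNIV B" "\<And>x. B x x = q x"
proof -
  define \<phi> where "\<phi> f a b c \<longleftrightarrow> f c (a + b) = f c a + f c b \<and> f (a + b) c = f a c + f b c \<and> f a a = q a"
    for f :: "('i \<Rightarrow>\<^sub>0 int) \<Rightarrow> ('i \<Rightarrow>\<^sub>0 int) \<Rightarrow> 'm" and a b c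
  have "\<exists>f. \<forall>a\<in>UNIV. \<forall>b\<in>UNIV. \<forall>c\<in>UNIV. \<phi> f a b c"
  proof (rule free_extension_principle[where ?f0.0 = "\<lambda>_ _. 0"])
    show "\<phi> (\<lambda>_ _. 0) 0 0 0" using quadratic_zero[OF q] by (simp add: \<phi>_def)
    show "\<phi> g a b c" if "additive_subgroup_set A" "\<And>x y. x \<in> A \<Longrightarrow> y \<in> A \<Longrightarrow> f x y = g x y"
      "a \<in> A" "b \<in> A" "c \<in> A" "\<phi> f a b c" for A f g a b c
      using that additive_subgroup_setD[OF that(1)] by (simp add: \<phi>_def)
  next
    fix A r f assume A: "additive_subgroup_set A" and r: "independent_over A r"
      and f: "\<And>a b c. a \<in> A \<Longrightarrow> b \<in> A \<Longrightarrow> c \<in> A \<Longrightarrow> \<phi> f a b c"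
    have "biadditive_on A f" using f by (simp add: \<phi>_def biadditive_on_def additive_on_def)
    moreover have "additive_on A (polarization q r)"
      using quadratic_polarization[OF q] by (simp add: additive_on_def)
    ultimately obtain g where g: "biadditive_on (adjoin A r) g" "\<And>a b m n. a \<in> A \<Longrightarrow> b \<in> A \<Longrightarrow>
      g (a + zscale m r) (b + zscale n r) = f a b + zscale m (polarization q r b) + zscale m (zscale n (q r))"
      using biadditive_extend[OF A r] by blast
    have "g x x = q x" if "x \<in> adjoin A r" for x
    proof -
      obtain a m where x: "x = a + zscale m r" "a \<in> A" using \<open>x \<in> adjoin A r\<close> by (auto simp: adjoin_def)
      have "polarization q a (zscale m r) = zscale m (polarization q r a)"
        using additive_onD(4)[OF quadratic_polarization[OF q]] by (simp add: polarization_commute)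
      then have "q x = q a + zscale m (zscale m (q r)) + zscale m (polarization q r a)"
        by (simp add: x(1) quadratic_add quadratic_zscale[OF q])
      moreover have "f a a = q a" using f x(2) by (auto simp: \<phi>_def)
      ultimately show ?thesis using x by (simp add: g)
    qed
    moreover have "g x y = f x y" if "x \<in> A" "y \<in> A" for x y
      using g(2)[OF that, of 0 0] by simp
    ultimately show "\<exists>g. (\<forall>x\<in>A. \<forall>y\<in>A. g x y = f x y) \<and>
        (\<forall>a\<in>adjoin A r. \<forall>b\<in>adjoin A r. \<forall>c\<in>adjoin A r. \<phi> g a b c)"
      using g(1) by (intro exI[of _ g]) (simp add: \<phi>_def biadditive_on_def additive_on_def)
  qed simp
  then show thesis
    using that by (auto simp: \<phi>_def biadditive_on_def additive_on_def)
qed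

text \<open>\<open>D\<close> is one triangular half of \<open>B\<close>: at a new generator g(r, b)
  = \<open>B r b\<close>, while g(a, r) and g(r, r) are zero. Antisymmetry of \<open>B\<close>
  supplies the other half, and \<open>B r r = 0\<close> takes care of the diagonal.\<close>

theorem alternating_from_biadditive:
  fixes B :: "('i \<Rightarrow>\<^sub>0 int) \<Rightarrow> ('i \<Rightarrow>\<^sub>0 int) \<Rightarrow> 'm::ab_group_add"
  assumes R: "additive_subgroup_set R" and B: "biadditive_on R B" and alt: "\<And>x. x \<in> R \<Longrightarrow> B x x = 0"
  obtains D where "biadditive_on R D" "\<And>x y. x \<in> R \<Longrightarrow> y \<in> R \<Longrightarrow> D x y - D y x = B x y"
proof -
  define \<phi> where "\<phi> f a b c \<longleftrightarrow> f c (a + b) = f c a + f c b \<and> f (a + b) c = f a c + f b c \<and> f a b - f b a = B a b"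
    for f :: "('i \<Rightarrow>\<^sub>0 int) \<Rightarrow> ('i \<Rightarrow>\<^sub>0 int) \<Rightarrow> 'm" and a b c
  note BD = additive_onD[OF biadditive_onD(1)[OF B] R] additive_onD[OF biadditive_onD(2)[OF B] R]
  note RD = additive_subgroup_setD[OF R]
  have anti: "B x y = - B y x" if "x \<in> R" "y \<in> R" for x y
    using alt[of "x + y"] that
    by (simp add: BD RD alt[OF that(1)] alt[OF that(2)] eq_neg_iff_add_eq_0 add.commute)
  have "\<exists>f. \<forall>a\<in>R. \<forall>b\<in>R. \<forall>c\<in>R. \<phi> f a b c"
  proof (rule free_extension_principle[where ?f0.0 = "\<lambda>_ _. 0"])
    show "\<phi> (\<lambda>_ _. 0) 0 0 0" using alt[OF RD(1)] by (simp add: \<phi>_def)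
    show "\<phi> g a b c" if "additive_subgroup_set A" "\<And>x y. x \<in> A \<Longrightarrow> y \<in> A \<Longrightarrow> f x y = g x y"
      "a \<in> A" "b \<in> A" "c \<in> A" "\<phi> f a b c" for A f g a b c
      using that additive_subgroup_setD[OF that(1)] by (simp add: \<phi>_def)
  next
    fix A r f assume A: "additive_subgroup_set A" and r: "independent_over A r" and AR: "adjoin A r \<subseteq> R"
      and f: "\<And>a b c. a \<in> A \<Longrightarrow> b \<in> A \<Longrightarrow> c \<in> A \<Longrightarrow> \<phi> f a b c"
    have rR: "r \<in> R" using adjoinI[of 0 A 1 r] additive_subgroup_setD(1)[OF A] AR by auto
    have AR': "a \<in> R" if "a \<in> A" for a using adjoinI[of a A 0 r] that AR by auto
    have "biadditive_on A f" using f by (simp add: \<phi>_def biadditive_on_def additive_on_def)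
    moreover have "additive_on A (B r)"
      using BD(1) rR AR' by (simp add: additive_on_def)
    ultimately obtain g where g: "biadditive_on (adjoin A r) g" "\<And>a b m n. a \<in> A \<Longrightarrow> b \<in> A \<Longrightarrow>
      g (a + zscale m r) (b + zscale n r) = f a b + zscale m (B r b) + zscale m (zscale n 0)"
      using biadditive_extend[OF A r] by blast
    have "g x y - g y x = B x y" if "x \<in> adjoin A r" "y \<in> adjoin A r" for x y
    proof -
      obtain a m where x: "x = a + zscale m r" "a \<in> A" using \<open>x \<in> adjoin A r\<close> by (auto simp: adjoin_def)
      obtain b n where y: "y = b + zscale n r" "b \<in> A" using \<open>y \<in> adjoin A r\<close> by (auto simp: adjoin_def)
      have "B x y = B a b + zscale n (B a r) + zscale m (B r b)"
        unfolding x(1) y(1) using AR' x(2) y(2) rR by (simp add: BD RD alt)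
      also have "zscale n (B a r) = - zscale n (B r a)"
        by (simp add: anti[OF AR'[OF x(2)] rR] zscale_neg)
      also have "B a b = f a b - f b a" using f x y by (auto simp: \<phi>_def)
      finally show ?thesis using x y by (simp add: g)
    qed
    moreover have "g x y = f x y" if "x \<in> A" "y \<in> A" for x y
      using g(2)[OF that, of 0 0] by simp
    ultimately show "\<exists>g. (\<forall>x\<in>A. \<forall>y\<in>A. g x y = f x y) \<and>
        (\<forall>a\<in>adjoin A r. \<forall>b\<in>adjoin A r. \<forall>c\<in>adjoin A r. \<phi> g a b c)"
      using g(1) by (intro exI[of _ g]) (simp add: \<phi>_def biadditive_on_def additive_on_def)
  qed (rule R)
  then show thesis
    using that by (auto simp: \<phi>_def biadditive_on_def additive_on_def)
qed

section \<open>Abelian cocycles\<close>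

text \<open>The conditions \<open>cocycle3\<close> and \<open>hexagons\<close> in additive form, for
  groups that are whole types. Likewise \<open>cob3\<close> and \<open>cob2\<close> are the two
  components of \<open>coboundary_2ab\<close>.\<close>

definition abelian_cocycle :: "('a::ab_group_add \<Rightarrow> 'a \<Rightarrow> 'a \<Rightarrow> 'm::ab_group_add) \<Rightarrow> ('a \<Rightarrow> 'a \<Rightarrow> 'm) \<Rightarrow> bool"
  where "abelian_cocycle h c \<longleftrightarrow>
    (\<forall>x y z w. h x y z + h x (y + z) w + h y z w = h (x + y) z w + h x y (z + w)) \<and>
    (\<forall>x y z. h y z x + c x (y + z) + h x y z = c x z + h y x z + c x y) \<and>
    (\<forall>x y z. - h z x y + c (x + y) z - h x y z = c x z - h x z y + c y z)"

definition cob3 :: "('a::ab_group_add \<Rightarrow> 'a \<Rightarrow> 'm::ab_group_add) \<Rightarrow> 'a \<Rightarrow> 'a \<Rightarrow> 'a \<Rightarrow> 'm"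
  where "cob3 k x y z = k y z - k (x + y) z + k x (y + z) - k x y"

definition cob2 :: "('a::ab_group_add \<Rightarrow> 'a \<Rightarrow> 'm::ab_group_add) \<Rightarrow> 'a \<Rightarrow> 'a \<Rightarrow> 'm"
  where "cob2 k x y = k y x - k x y"

lemma abelian_cocycleD:
  assumes "abelian_cocycle h c"
  shows "h x y z + h x (y + z) w + h y z w = h (x + y) z w + h x y (z + w)"
    "h y z x + c x (y + z) + h x y z = c x z + h y x z + c x y"
    "- h z x y + c (x + y) z - h x y z = c x z - h x z y + c y z"
  using assms by (auto simp: abelian_cocycle_def)

lemma abelian_cocycle_minus_coboundary:
  assumes "abelian_cocycle h c"
  shows "abelian_cocycle (\<lambda>x y z. h x y z - cob3 k x y z) (\<lambda>x y. c x y - cob2 k x y)"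
proof -
  have 1: "cob3 k x y z + cob3 k x (y + z) w + cob3 k y z w = cob3 k (x + y) z w + cob3 k x y (z + w)" for x y z w
    by (simp add: cob3_def algebra_simps)
  have 2: "cob3 k y z x + cob2 k x (y + z) + cob3 k x y z = cob2 k x z + cob3 k y x z + cob2 k x y" for x y z
    by (simp add: cob3_def cob2_def algebra_simps)
  have 3: "- cob3 k z x y + cob2 k (x + y) z - cob3 k x y z = cob2 k x z - cob3 k x z y + cob2 k y z" for x y z
    by (simp add: cob3_def cob2_def algebra_simps)
  show ?thesis
    unfolding abelian_cocycle_def
  proof (intro conjI allI)
    fix x y z w
    show "h x y z - cob3 k x y z + (h x (y + z) w - cob3 k x (y + z) w) + (h y z w - cob3 k y z w) =
        h (x + y) z w - cob3 k (x + y) z w + (h x y (z + w) - cob3 k x y (z + w))"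
      using arg_cong2[OF abelian_cocycleD(1)[OF assms, of x y z w] 1[of x y z w], of minus]
      by (simp add: algebra_simps)
    show "h y z x - cob3 k y z x + (c x (y + z) - cob2 k x (y + z)) + (h x y z - cob3 k x y z) =
        c x z - cob2 k x z + (h y x z - cob3 k y x z) + (c x y - cob2 k x y)"
      using arg_cong2[OF abelian_cocycleD(2)[OF assms, of y z x] 2[of y z x], of minus]
      by (simp add: algebra_simps)
    show "- (h z x y - cob3 k z x y) + (c (x + y) z - cob2 k (x + y) z) - (h x y z - cob3 k x y z) =
        c x z - cob2 k x z - (h x z y - cob3 k x z y) + (c y z - cob2 k y z)"
      using arg_cong2[OF abelian_cocycleD(3)[OF assms, of z x y] 3[of z x y], of minus]
      by (simp add: algebra_simps)
  qed
qed

text \<open>Applied repeatedly, this proves an equation as the sum of given equations.\<close>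

lemma add_equation:
  fixes a b L R :: "'a::ab_group_add"
  shows "a = b \<Longrightarrow> L + a = R + b \<Longrightarrow> L = R"
  by simp

text \<open>The hexagons expand c(x+y, x+y) first in the second argument and then in the first; the
  surviving values of \<open>h\<close> cancel by the cocycle identity at (x, y, x, y).\<close>

lemma trace_polarization:
  assumes "abelian_cocycle h c"
  shows "polarization (\<lambda>x. c x x) x y = c x y + c y x"
proof -
  note D = abelian_cocycleD[OF assms]
  show ?thesis
    unfolding polarization_def
    by (rule add_equation[OF D(2)[of x y "x+y", symmetric]], rule add_equation[OF D(3)[of y x y, symmetric]],
        rule add_equation[OF D(3)[of x x y, symmetric]], rule add_equation[OF D(1)[of x y x y, symmetric]])
       (simp add: algebra_simps)
qed

text \<open>The hexagon expansions of c(x+y, z) and c(z, x+y) contain opposite values of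
  \<open>h\<close>. Hence the symmetrization of \<open>c\<close>, which is the polarization of the
  trace, is biadditive.\<close>

theorem quadratic_trace:
  assumes "abelian_cocycle h c" shows "quadratic (\<lambda>x. c x x)"
proof -
  note D = abelian_cocycleD[OF assms]
  have "c (x + y) z + c z (x + y) = c x z + c z x + (c y z + c z y)" for x y z
    by (rule add_equation[OF D(2)[of x y z, symmetric]], rule add_equation[OF D(3)[of z x y, symmetric]])
       (simp add: algebra_simps)
  then show ?thesis
    unfolding quadratic_def trace_polarization[OF assms] by simp
qed

section \<open>Every quadratic map is a trace\<close>

theorem biadditive_gives_cocycle:
  fixes \<pi> :: "'p::ab_group_add \<Rightarrow> 'g::ab_group_add" and q :: "'g \<Rightarrow> 'm::ab_group_add"
  defines "R \<equiv> {p. \<pi> p = 0}"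
  assumes \<pi>: "additive_on UNIV \<pi>" "surj \<pi>" and q0: "q 0 = 0"
    and B: "biadditive_on UNIV B" and Bq: "\<And>p. B p p = q (\<pi> p)"
    and D: "biadditive_on R D" and DB: "\<And>x y. x \<in> R \<Longrightarrow> y \<in> R \<Longrightarrow> D x y - D y x = B x y"
  shows "\<exists>h c. abelian_cocycle h c \<and> (\<forall>x. c x x = q x)"
proof -
  define s where "s = inv_into UNIV \<pi>"
  have \<pi>s: "\<pi> (s x) = x" for x using \<pi>(2) by (simp add: s_def f_inv_into_f)
  note p = additive_onD[OF \<pi>(1) additive_subgroup_set_UNIV, simplified]
  have R: "additive_subgroup_set R" by (simp add: additive_subgroup_set_def R_def p)
  define f where "f x y = s x + s y - s (x + y)" for x y
  have fR [simp]: "f x y \<in> R" for x y by (simp add: f_def R_def p \<pi>s)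
  note RD [simp] = additive_subgroup_setD[OF R]
  note BD = additive_onD[OF biadditive_onD(1)[OF B] additive_subgroup_set_UNIV, simplified]
    additive_onD[OF biadditive_onD(2)[OF B] additive_subgroup_set_UNIV, simplified]
  note DD = additive_onD[OF biadditive_onD(1)[OF D] R] additive_onD[OF biadditive_onD(2)[OF D] R]
  have f_sym: "f x y = f y x" for x y by (simp add: f_def add.commute)
  have f_coc: "f x (y + z) = f x y + f (x + y) z - f y z" for x y z by (simp add: f_def algebra_simps)
  \<comment> \<open>The points u + v and v have the same image under \<open>\<pi>\<close>, so
    \<open>B\<close> has the same diagonal value at both. One argument in the kernel therefore
    suffices.\<close>
  have anti: "B u v = - B v u" if "u \<in> R" for u v
  proof -
    have "B (u + v) (u + v) = q (\<pi> v)" "B u u = 0" using that by (simp_all add: Bq p R_def q0)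
    then show ?thesis by (simp add: BD Bq[of v] eq_neg_iff_add_eq_0 add.commute)
  qed
  define c where "c x y = B (s x) (s y)" for x y
  define h where "h x y z = B (s x) (f y z) + D (f (x + y) z) (f x y) - D (f x (y + z)) (f y z)" for x y z
  have sadd: "s (x + y) = s x + s y - f x y" for x y by (simp add: f_def)
  have "abelian_cocycle h c"
    unfolding abelian_cocycle_def
  proof (intro conjI allI)
    fix x y z w
    \<comment> \<open>By the 2-cocycle identity of \<open>f\<close> every value of \<open>f\<close>
      in the equation is a combination of these six. What remains is biadditive expansion, and the
      defect \<open>B a d\<close> is absorbed by \<open>D a d - D d a\<close>.\<close>
    define a b d u t n where abb: "a = f x y" "b = f y z" "d = f z w" "u = f (x + y) z" "t = f (x + y + z) w" "n = f (y + z) w"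
    have rel: "f x (y + z) = a + u - b" "f y (z + w) = b + n - d" "f x (y + z + w) = a + u - b + t - n"
      "f (x + y) (z + w) = u + t - d" "f x (y + (z + w)) = a + u - b + t - n"
      unfolding abb
      using f_coc[of x y z] f_coc[of y z w] f_coc[of x "y + z" w] f_coc[of "x + y" z w] by (simp_all add: add.assoc)
    have [simp]: "a \<in> R" "b \<in> R" "d \<in> R" "u \<in> R" "t \<in> R" "n \<in> R" by (simp_all add: abb)
    have e: "B a d = D a d - D d a" by (simp add: DB)
    have h: "h x y z = B (s x) b + D u a - D (a + u - b) b"
      "h x (y + z) w = B (s x) n + D t (a + u - b) - D (a + u - b + t - n) n"
      "h y z w = B (s y) d + D n b - D (b + n - d) d"
      "h (x + y) z w = B (s x + s y - a) d + D t u - D (u + t - d) d"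
      "h x y (z + w) = B (s x) (b + n - d) + D (u + t - d) a - D (a + u - b + t - n) (b + n - d)"
      unfolding h_def sadd[of x y] by (simp_all only: rel abb[symmetric] add.assoc[of x y z, symmetric])
    show "h x y z + h x (y + z) w + h y z w = h (x + y) z w + h x y (z + w)"
      unfolding h by (simp add: DD BD e algebra_simps)
  next
    fix x y z
    \<comment> \<open>In both hexagons the terms with \<open>D\<close> cancel by the symmetry of
      \<open>f\<close>. In the first, B(s x, f y z) compensates the failure of \<open>s\<close> to
      be additive; in the second the correction has its arguments exchanged, whence
      \<open>anti\<close>.\<close>
    show "h y z x + c x (y + z) + h x y z = c x z + h y x z + c x y"
      unfolding h_def c_def sadd[of y z] using f_sym[of z x] f_sym[of "y + z" x] f_sym[of x y]
      by (simp add: BD algebra_simps)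
    show "- h z x y + c (x + y) z - h x y z = c x z - h x z y + c y z"
      unfolding h_def c_def sadd[of x y] using f_sym[of z x] f_sym[of z "x + y"] f_sym[of z y] anti[of "f x y" "s z"]
      by (simp add: BD algebra_simps)
  qed
  moreover have "c x x = q x" for x by (simp add: c_def Bq \<pi>s)
  ultimately show ?thesis by blast
qed

lemma free_abelian_surjection:
  obtains \<pi> :: "('g::ab_group_add \<Rightarrow>\<^sub>0 int) \<Rightarrow> 'g" where "additive_on UNIV \<pi>" "surj \<pi>"
proof -
  define \<pi> :: "('g \<Rightarrow>\<^sub>0 int) \<Rightarrow> 'g" where "\<pi> p = (\<Sum>x\<in>Poly_Mapping.keys p. zscale (Poly_Mapping.lookup p x) x)" for p
  \<comment> \<open>Larger index sets are allowed so that \<open>p\<close>, \<open>p'\<close> and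
    their sum can be summed over the same one.\<close>
  have eq: "\<pi> p = (\<Sum>x\<in>K. zscale (Poly_Mapping.lookup p x) x)" if "finite K" "Poly_Mapping.keys p \<subseteq> K" for p K
    unfolding \<pi>_def by (rule sum.mono_neutral_left) (use that in \<open>auto simp: in_keys_iff\<close>)
  have "\<pi> (p + p') = \<pi> p + \<pi> p'" for p p'
  proof -
    let ?K = "Poly_Mapping.keys p \<union> Poly_Mapping.keys p'"
    have "\<pi> (p + p') = (\<Sum>x\<in>?K. zscale (Poly_Mapping.lookup (p + p') x) x)"
      by (rule eq) (use keys_add[of p p'] in auto)
    also have "\<dots> = \<pi> p + \<pi> p'"
      using eq[of ?K p] eq[of ?K p'] by (simp add: lookup_add zscale_add sum.distrib)
    finally show ?thesis .
  qed
  moreover have "\<pi> (Poly_Mapping.single x 1) = x" for x by (simp add: \<pi>_def)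
  ultimately have "additive_on UNIV \<pi>" "surj \<pi>"
    by (simp_all add: additive_on_def surjI[of \<pi> "\<lambda>x. Poly_Mapping.single x 1"])
  then show thesis by (rule that)
qed

theorem quadratic_is_trace:
  fixes q :: "'g::ab_group_add \<Rightarrow> 'm::ab_group_add"
  assumes q: "quadratic q"
  shows "\<exists>h c. abelian_cocycle h c \<and> (\<forall>x. c x x = q x)"
proof -
  obtain \<pi> :: "('g \<Rightarrow>\<^sub>0 int) \<Rightarrow> 'g" where \<pi>: "additive_on UNIV \<pi>" "surj \<pi>"
    using free_abelian_surjection .
  note p = additive_onD[OF \<pi>(1) additive_subgroup_set_UNIV, simplified]
  let ?R = "{p. \<pi> p = 0}"
  have R: "additive_subgroup_set ?R" by (simp add: additive_subgroup_set_def p)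
  have "quadratic (\<lambda>p. q (\<pi> p))" using q unfolding quadratic_def polarization_def p(1)[symmetric] by (simp only: p(1) simp_thms)
  then obtain B where B: "biadditive_on UNIV B" "\<And>x. B x x = q (\<pi> x)"
    using quadratic_from_biadditive by blast
  have q0: "q 0 = 0" by (rule quadratic_zero) (rule q)
  have BR: "biadditive_on ?R B" using B(1) by (simp add: biadditive_on_def additive_on_def)
  have alt: "B x x = 0" if "x \<in> ?R" for x using that B(2) q0 by simp
  obtain D where D: "biadditive_on ?R D" "\<And>x y. x \<in> ?R \<Longrightarrow> y \<in> ?R \<Longrightarrow> D x y - D y x = B x y"
    using alternating_from_biadditive[OF R BR alt] by blast
  show ?thesis by (rule biadditive_gives_cocycle[OF \<pi> q0 B D])
qed

section \<open>Abelian cocycles with trace zero are coboundaries\<close>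

definition normalized :: "('a::zero \<Rightarrow> 'a \<Rightarrow> 'a \<Rightarrow> 'm::zero) \<Rightarrow> bool"
  where "normalized h \<longleftrightarrow> (\<forall>x y. h 0 x y = 0 \<and> h x 0 y = 0 \<and> h x y 0 = 0)"

lemma normalize_cocycle:
  assumes "abelian_cocycle h c"
  obtains k where "normalized (\<lambda>x y z. h x y z - cob3 k x y z)"
proof -
  note D = abelian_cocycleD(1)[OF assms]
  \<comment> \<open>The cocycle identity with two zero arguments expresses each value of
    \<open>h\<close> at a triple containing 0 through \<open>h 0 0 y\<close> and
    \<open>h x 0 0\<close>. A cochain on the two axes can absorb these; at the origin both
    prescriptions give 0.\<close>
  define k where "k x y = (if x = 0 then h 0 0 y else if y = 0 then - h x 0 0 else 0)" for x y
  have 0: "h 0 0 0 = 0" using D[of 0 0 0 0] by simp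
  have 1: "h x 0 y = h x 0 0 + h 0 0 y" for x y using D[of x 0 0 y] by (simp add: algebra_simps)
  have 2: "h 0 x y = h 0 0 (x + y) - h 0 0 x" for x y using D[of 0 0 x y] by (simp add: algebra_simps)
  have 3: "h x y 0 = h (x + y) 0 0 - h y 0 0" for x y using D[of x y 0 0] by (simp add: algebra_simps)
  have k: "k 0 y = h 0 0 y" "k x 0 = - h x 0 0" for x y by (simp_all add: k_def 0)
  have "normalized (\<lambda>x y z. h x y z - cob3 k x y z)"
    unfolding normalized_def
  proof (intro allI conjI)
    fix x y
    show "h 0 x y - cob3 k 0 x y = 0" using 2[of x y] by (simp add: cob3_def k)
    show "h x 0 y - cob3 k x 0 y = 0" using 1[of x y] by (simp add: cob3_def k)
    show "h x y 0 - cob3 k x y 0 = 0" using 3[of x y] by (simp add: cob3_def k)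
  qed
  then show thesis by (rule that[of k])
qed

lemma normalized_braiding:
  assumes "abelian_cocycle h c" "normalized h"
  shows "c x 0 = 0" "c 0 x = 0"
  using abelian_cocycleD(2)[OF assms(1), of 0 0 x] abelian_cocycleD(3)[OF assms(1), of x 0 0] assms(2)
  by (auto simp: normalized_def)

text \<open>The uniqueness half of the one-generator step. The hypotheses \<open>h1\<close>,
  \<open>h2\<close> and \<open>c1\<close> list the values that a coboundary can remove; once they
  vanish, the cocycle identity and the hexagons annihilate all others.\<close>

lemma cocycle_adjoin_rigid:
  assumes coc: "abelian_cocycle h c" and norm: "normalized h" and tr: "\<And>x. c x x = 0"
    and A: "additive_subgroup_set A"
    and hA: "\<And>a b d. a \<in> A \<Longrightarrow> b \<in> A \<Longrightarrow> d \<in> A \<Longrightarrow> h a b d = 0"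
    and cA: "\<And>a b. a \<in> A \<Longrightarrow> b \<in> A \<Longrightarrow> c a b = 0"
    and h1: "\<And>x y. x \<in> adjoin A r \<Longrightarrow> y \<in> adjoin A r \<Longrightarrow> h x y r = 0"
    and h2: "\<And>m a b. a \<in> A \<Longrightarrow> b \<in> A \<Longrightarrow> h (zscale m r) a b = 0"
    and c1: "\<And>m a. a \<in> A \<Longrightarrow> c (zscale m r) a = 0"
  shows "x \<in> adjoin A r \<Longrightarrow> y \<in> adjoin A r \<Longrightarrow> z \<in> adjoin A r \<Longrightarrow> h x y z = 0"
    and "x \<in> adjoin A r \<Longrightarrow> y \<in> adjoin A r \<Longrightarrow> c x y = 0"
proof -
  let ?A = "adjoin A r"
  note D = abelian_cocycleD[OF coc]
  note E = additive_subgroup_setD[OF adjoin_subgroup[OF A, of r]]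
  note AD = additive_subgroup_setD[OF A]
  have AA: "a \<in> ?A" if "a \<in> A" for a using adjoinI[OF that, of 0 r] by simp
  have rA: "zscale m r \<in> ?A" for m using adjoinI[OF AD(1), of m r] by simp
  have rA1: "r \<in> ?A" using rA[of 1] by simp
  \<comment> \<open>Trace zero makes the polarization of the trace vanish, and this is the
    symmetrization of \<open>c\<close>.\<close>
  have anti: "c y x = - c x y" for x y
    using trace_polarization[OF coc, of x y] by (simp add: polarization_def tr eq_neg_iff_add_eq_0 add.commute)
  have c2: "c a (zscale m r) = 0" if "a \<in> A" for a m using c1[OF that, of m] anti[of a "zscale m r"] by simp
  \<comment> \<open>In the cocycle identity with last argument \<open>r\<close>, all terms ending in
    \<open>r\<close> vanish by \<open>h1\<close>. So \<open>h\<close> is periodic in its third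
    argument, which can then be moved into \<open>A\<close>.\<close>
  have shift: "h x y (z + r) = h x y z" if "x \<in> ?A" "y \<in> ?A" "z \<in> ?A" for x y z
    using D(1)[of x y z r] h1 that E(4) by simp
  have shiftm: "h x y (z + zscale m r) = h x y z" if "x \<in> ?A" "y \<in> ?A" "z \<in> ?A" for x y z m
  proof (induction m rule: int_induct[where k = 0])
    case base then show ?case by simp
  next
    case (step1 i)
    then show ?case using shift[OF that(1,2), of "z + zscale i r"] E(4)[OF that(3) rA] by (simp add: zscale_Suc add.assoc)
  next
    case (step2 i)
    have eq: "z + zscale (i - 1) r + r = z + zscale i r" by (simp add: zscale_pred)
    show ?case using shift[OF that(1,2) E(4)[OF that(3) rA], of "i - 1"] step2 unfolding eq by simp
  qed
  have hr: "h x y (zscale m r) = 0" if "x \<in> ?A" "y \<in> ?A" for x y m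
    using shiftm[OF that E(1), of m] norm by (simp add: normalized_def)
  \<comment> \<open>From here to \<open>s6\<close> the first two arguments grow from elements of
    \<open>A\<close> or multiples of \<open>r\<close> to all of \<open>adjoin A r\<close>. The
    cocycle identity splits sums; the second hexagon moves a multiple of \<open>r\<close> into the
    middle (\<open>s2\<close>) or an element of \<open>A\<close> to the end
    (\<open>s4\<close>).\<close>
  have s1: "h x a b = 0" if x: "x \<in> ?A" and a: "a \<in> A" and b: "b \<in> A" for x a b
  proof -
    obtain d m where "x = d + zscale m r" "d \<in> A" using x by (auto simp: adjoin_def)
    then show ?thesis using D(1)[of "zscale m r" d a b] a b by (simp add: h2 hA AD add.commute)
  qed
  have s2: "h a (zscale m r) b = 0" if "a \<in> A" "b \<in> A" for a b m
    using D(3)[of "zscale m r" a b] that by (simp add: h2 c2 AD AA hr)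
  have s3: "h a y b = 0" if a: "a \<in> A" and y: "y \<in> ?A" and b: "b \<in> A" for a y b
  proof -
    obtain d m where "y = d + zscale m r" "d \<in> A" using y by (auto simp: adjoin_def)
    then show ?thesis using D(1)[of a "zscale m r" d b] a b
      by (simp add: h2 s2 AD s1 E AA rA add.commute)
  qed
  have s4: "h (zscale n r) (zscale m r) a = 0" if "a \<in> A" for m n a
    using D(3)[of a "zscale n r" "zscale m r"] that c1[of a "n + m"]
    by (simp add: zscale_add c1 hr AA rA)
  have s5: "h (zscale n r) y b = 0" if y: "y \<in> ?A" and b: "b \<in> A" for y n b
  proof -
    obtain d m where "y = d + zscale m r" "d \<in> A" using y by (auto simp: adjoin_def)
    then show ?thesis using D(1)[of "zscale n r" "zscale m r" d b] b
      by (simp add: h2 s4 AD s1 E AA rA add.commute)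
  qed
  have s2': "h a (zscale n r) y = 0" if a: "a \<in> A" and y: "y \<in> ?A" for a n y
  proof -
    obtain d m where "y = d + zscale m r" "d \<in> A" using y by (auto simp: adjoin_def)
    then show ?thesis using shiftm[of a "zscale n r" d m] a by (simp add: s2 AA rA)
  qed
  have s6: "h x y b = 0" if x: "x \<in> ?A" and y: "y \<in> ?A" and b: "b \<in> A" for x y b
  proof -
    obtain a n where "x = a + zscale n r" "a \<in> A" using x by (auto simp: adjoin_def)
    then show ?thesis using D(1)[of a "zscale n r" y b] y b
      by (simp add: s2' s3 s5 E AA rA)
  qed
  show h0: "h x y z = 0" if x: "x \<in> ?A" and y: "y \<in> ?A" and z: "z \<in> ?A" for x y z
  proof -
    obtain d m where "z = d + zscale m r" "d \<in> A" using z by (auto simp: adjoin_def)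
    then show ?thesis using shiftm[OF x y, of d m] s6[OF x y] AA by simp
  qed
  \<comment> \<open>With \<open>h = 0\<close> the hexagons say that \<open>c\<close> is biadditive,
    so only its values on \<open>A\<close>, between \<open>A\<close> and \<open>r\<close>, and at
    \<open>(r, r)\<close> matter; the last is zero by the trace.\<close>
  have cadd: "additive_on ?A (c x)" "additive_on ?A (\<lambda>y. c y x)" if "x \<in> ?A" for x
  proof -
    show "additive_on ?A (c x)"
      unfolding additive_on_def
    proof (intro ballI)
      show "c x (y + z) = c x y + c x z" if "y \<in> ?A" "z \<in> ?A" for y z
        using D(2)[of y z x] that \<open>x \<in> ?A\<close> by (simp add: h0 add.commute)
    qed
    show "additive_on ?A (\<lambda>y. c y x)"
      unfolding additive_on_def
    proof (intro ballI)
      show "c (y + z) x = c y x + c z x" if "y \<in> ?A" "z \<in> ?A" for y z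
        using D(3)[of x y z] that \<open>x \<in> ?A\<close> by (simp add: h0)
    qed
  qed
  note cD = additive_onD[OF cadd(1) adjoin_subgroup[OF A]] additive_onD[OF cadd(2) adjoin_subgroup[OF A]]
  show "c x y = 0" if x: "x \<in> ?A" and y: "y \<in> ?A" for x y
  proof -
    obtain a m where a: "x = a + zscale m r" "a \<in> A" using x by (auto simp: adjoin_def)
    obtain b n where b: "y = b + zscale n r" "b \<in> A" using y by (auto simp: adjoin_def)
    have "c (zscale m r) (zscale n r) = 0"
      using cD(4)[of "zscale m r" r n] cD(8)[of r r m] by (simp add: rA rA1 tr)
    then show ?thesis unfolding a b using a b
      by (simp add: cD E AA rA cA c1 c2)
  qed
qed

text \<open>The witness \<open>k\<close> is forced by the conditions in \<open>cocycle_adjoin_rigid\<close>: \<open>k x r = 0\<close>, \<open>h x y r = cob3 k x y r\<close>,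
  \<open>h (m r) a b = cob3 k (m r) a b\<close> and \<open>c (m r) a = cob2 k (m r) a\<close>.\<close>

lemma cocycle_adjoin_trivial:
  assumes coc: "abelian_cocycle h c" and norm: "normalized h" and tr: "\<And>x. c x x = 0"
    and A: "additive_subgroup_set A" and r: "independent_over A r"
    and hA: "\<And>a b d. a \<in> A \<Longrightarrow> b \<in> A \<Longrightarrow> d \<in> A \<Longrightarrow> h a b d = 0"
    and cA: "\<And>a b. a \<in> A \<Longrightarrow> b \<in> A \<Longrightarrow> c a b = 0"
  obtains k where "\<And>x y. x \<in> A \<Longrightarrow> y \<in> A \<Longrightarrow> k x y = 0"
    "\<And>x y z. x \<in> adjoin A r \<Longrightarrow> y \<in> adjoin A r \<Longrightarrow> z \<in> adjoin A r \<Longrightarrow> h x y z = cob3 k x y z"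
    "\<And>x y. x \<in> adjoin A r \<Longrightarrow> y \<in> adjoin A r \<Longrightarrow> c x y = cob2 k x y"
proof -
  let ?A = "adjoin A r"
  note E = additive_subgroup_setD[OF adjoin_subgroup[OF A, of r]]
  note AD = additive_subgroup_setD[OF A]
  note N = norm[unfolded normalized_def, rule_format, THEN conjunct1]
    norm[unfolded normalized_def, rule_format, THEN conjunct2, THEN conjunct1]
    norm[unfolded normalized_def, rule_format, THEN conjunct2, THEN conjunct2]
  note Nc = normalized_braiding[OF coc norm]
  obtain \<alpha> \<mu> where \<alpha>: "\<And>a m. a \<in> A \<Longrightarrow> \<alpha> (a + zscale m r) = a" "\<And>a m. a \<in> A \<Longrightarrow> \<mu> (a + zscale m r) = m"
    using adjoin_coordinates[OF A r] by metis
  \<comment> \<open>With \<open>k x r = 0\<close>, the condition on \<open>h x y r\<close> reads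
    \<open>k x (y + r) = k x y + h x y r\<close>, so \<open>H x y m\<close> is the increment of
    \<open>k x\<close> from y to y + mr. Then \<open>g m a\<close> is the value of
    \<open>k (zscale m r) a\<close> forced by the condition on \<open>c\<close>, and the condition
    on h(mr, a, b) yields the remaining values of \<open>k\<close>.\<close>
  define H where "H x y = zsum (\<lambda>j. h x (y + zscale j r) r)" for x y
  define g where "g m a = H a 0 m - c (zscale m r) a" for m a
  define k where "k x y = (if x \<in> ?A \<and> y \<in> ?A then
    g (\<mu> x) (\<alpha> x + \<alpha> y) - g (\<mu> x) (\<alpha> x) - h (zscale (\<mu> x) r) (\<alpha> x) (\<alpha> y) + H x (\<alpha> y) (\<mu> y) else 0)" for x y
  have H0: "H x y 0 = 0" "H 0 y m = 0" for x y m
    using zscale_zero[of m] by (simp_all add: H_def N zscale_def)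
  have HS: "H x y (m + 1) = H x y m + h x (y + zscale m r) r" for x y m
    by (simp add: H_def zsum_Suc)
  have g0: "g 0 a = 0" "g m 0 = 0" for m a by (simp_all add: g_def H0 Nc)
  have K: "k (a + zscale m r) (b + zscale n r) =
      g m (a + b) - g m a - h (zscale m r) a b + H (a + zscale m r) b n" if "a \<in> A" "b \<in> A" for a m b n
    using that by (simp add: k_def \<alpha> adjoinI)
  have kA: "k a b = 0" if "a \<in> A" "b \<in> A" for a b
    using K[OF that, of 0 0] by (simp add: g0 H0 N)
  have k_r: "k x r = 0" if x: "x \<in> ?A" for x
  proof -
    obtain a m where "x = a + zscale m r" "a \<in> A" using x by (auto simp: adjoin_def)
    then show ?thesis using K[of a 0 m 1] HS[of x 0 0] by (simp add: AD N H0)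
  qed
  have k_0: "k x 0 = 0" "k 0 x = 0" for x
  proof -
    show "k x 0 = 0"
    proof (cases "x \<in> ?A")
      case True
      then obtain a m where "x = a + zscale m r" "a \<in> A" by (auto simp: adjoin_def)
      then show ?thesis using K[of a 0 m 0] by (simp add: AD N H0)
    qed (simp add: k_def)
    show "k 0 x = 0"
    proof (cases "x \<in> ?A")
      case True
      then obtain a m where "x = a + zscale m r" "a \<in> A" by (auto simp: adjoin_def)
      then show ?thesis using K[of 0 a 0 m] by (simp add: AD N H0 g0)
    qed (simp add: k_def)
  qed
  have k_shift: "k x (y + r) = k x y + h x y r" if x: "x \<in> ?A" and y: "y \<in> ?A" for x y
  proof -
    obtain a m where a: "x = a + zscale m r" "a \<in> A" using x by (auto simp: adjoin_def)
    obtain b n where b: "y = b + zscale n r" "b \<in> A" using y by (auto simp: adjoin_def)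
    have eq: "y + r = b + zscale (n + 1) r" by (simp add: b zscale_Suc add.assoc)
    show ?thesis unfolding eq unfolding a(1) b(1) K[OF a(2) b(2)] HS by (simp add: algebra_simps)
  qed
  have km: "k (a + zscale m r) b = g m (a + b) - g m a - h (zscale m r) a b" if "a \<in> A" "b \<in> A" for a b m
    using K[OF that, of m 0] by (simp add: H0)
  have km0: "k (zscale m r) b = g m b" if "b \<in> A" for b m
    using km[OF AD(1) that, of m] by (simp add: g0 N)
  have kA': "k a (zscale m r) = H a 0 m" if "a \<in> A" for a m
    using K[OF that AD(1), of 0 m] by (simp add: g0 N)
  let ?h = "\<lambda>x y z. h x y z - cob3 k x y z" and ?c = "\<lambda>x y. c x y - cob2 k x y"
  \<comment> \<open>Subtracting the coboundary of \<open>k\<close> leaves a cocycle to which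
    rigidity applies.\<close>
  have coc': "abelian_cocycle ?h ?c" by (rule abelian_cocycle_minus_coboundary[OF coc])
  have norm': "normalized ?h" by (simp add: normalized_def N cob3_def k_0)
  have tr': "?c x x = 0" for x by (simp add: tr cob2_def)
  have hA': "?h a b d = 0" if "a \<in> A" "b \<in> A" "d \<in> A" for a b d
    using that by (simp add: hA cob3_def kA AD)
  have cA': "?c a b = 0" if "a \<in> A" "b \<in> A" for a b
    using that by (simp add: cA cob2_def kA)
  have h1': "?h x y r = 0" if "x \<in> ?A" "y \<in> ?A" for x y
    using that by (simp add: cob3_def k_r k_shift E)
  have h2': "?h (zscale m r) a b = 0" if "a \<in> A" "b \<in> A" for m a b
    using that km[OF that, of m] by (simp add: cob3_def kA km0 AD add.commute)
  have c1': "?c (zscale m r) a = 0" if "a \<in> A" for m a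
    using that by (simp add: cob2_def km0 kA' g_def)
  note rigid = cocycle_adjoin_rigid[OF coc' norm' tr' A hA' cA' h1' h2' c1']
  show thesis
  proof (rule that[of k])
    show "k x y = 0" if "x \<in> A" "y \<in> A" for x y using kA that .
    show "h x y z = cob3 k x y z" if "x \<in> ?A" "y \<in> ?A" "z \<in> ?A" for x y z
      using rigid(1)[OF _ _ _ _ _ _ _ _ _ _ that] by simp
    show "c x y = cob2 k x y" if "x \<in> ?A" "y \<in> ?A" for x y
      using rigid(2)[OF _ _ _ _ _ _ _ _ _ _ that] by simp
  qed
qed

section \<open>Trivialization over a free abelian group\<close>

lemma cob_add:
  "cob3 (\<lambda>x y. k x y + l x y) x y z = cob3 k x y z + cob3 l x y z"
  "cob2 (\<lambda>x y. k x y + l x y) x y = cob2 k x y + cob2 l x y"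
  by (simp_all add: cob3_def cob2_def algebra_simps)

theorem free_cocycle_trivial:
  fixes h :: "('i \<Rightarrow>\<^sub>0 int) \<Rightarrow> ('i \<Rightarrow>\<^sub>0 int) \<Rightarrow> ('i \<Rightarrow>\<^sub>0 int) \<Rightarrow> 'm::ab_group_add"
  assumes coc: "abelian_cocycle h c" and norm: "normalized h" and tr: "\<And>x. c x x = 0"
  obtains k where "\<And>x y z. h x y z = cob3 k x y z" "\<And>x y. c x y = cob2 k x y" "\<And>x. k x 0 = 0" "\<And>x. k 0 x = 0"
proof -
  \<comment> \<open>Since \<open>h\<close> is normalized, \<open>f 0 0 = 0\<close> propagates to the
    axes through \<open>cob3 f 0 0 x = f 0 x - f 0 0\<close> and its mirror image. This keeps the
    cocycle normalized when a partial solution is subtracted.\<close>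
  define \<phi> where "\<phi> f a b d \<longleftrightarrow> h a b d = cob3 f a b d \<and> c a b = cob2 f a b \<and> f 0 0 = 0"
    for f :: "('i \<Rightarrow>\<^sub>0 int) \<Rightarrow> ('i \<Rightarrow>\<^sub>0 int) \<Rightarrow> 'm" and a b d
  have N: "h 0 0 x = 0" "h x 0 0 = 0" for x using norm by (simp_all add: normalized_def)
  have f0: "f 0 x = 0" "f x 0 = 0" if "\<phi> f 0 0 x" "\<phi> f x 0 0" for f x
    using that N[of x] by (simp_all add: \<phi>_def cob3_def)
  have "\<exists>f. \<forall>a\<in>UNIV. \<forall>b\<in>UNIV. \<forall>d\<in>UNIV. \<phi> f a b d"
  proof (rule free_extension_principle[where ?f0.0 = "\<lambda>_ _. 0"])
    show "\<phi> (\<lambda>_ _. 0) 0 0 0" using N[of 0] tr by (simp add: \<phi>_def cob3_def cob2_def)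
    show "\<phi> g a b d" if "additive_subgroup_set A" "\<And>x y. x \<in> A \<Longrightarrow> y \<in> A \<Longrightarrow> f x y = g x y"
      "a \<in> A" "b \<in> A" "d \<in> A" "\<phi> f a b d" for A f g a b d
      using that additive_subgroup_setD[OF that(1)] by (simp add: \<phi>_def cob3_def cob2_def)
  next
    fix A r f assume A: "additive_subgroup_set A" and r: "independent_over A r"
      and f: "\<And>a b d. a \<in> A \<Longrightarrow> b \<in> A \<Longrightarrow> d \<in> A \<Longrightarrow> \<phi> f a b d"
    note AD = additive_subgroup_setD[OF A]
    \<comment> \<open>Extension by zero turns the partial solution into a global cochain;
      subtracting its coboundary makes the cocycle vanish on \<open>A\<close>.\<close>
    define k0 where "k0 x y = (if x \<in> A \<and> y \<in> A then f x y else 0)" for x y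
    have k00: "k0 x 0 = 0" "k0 0 x = 0" for x
      using f0[OF f[OF AD(1) AD(1)] f[OF _ AD(1) AD(1)]] AD(1) by (simp_all add: k0_def)
    let ?h = "\<lambda>x y z. h x y z - cob3 k0 x y z" and ?c = "\<lambda>x y. c x y - cob2 k0 x y"
    have coc': "abelian_cocycle ?h ?c" by (rule abelian_cocycle_minus_coboundary[OF coc])
    have norm': "normalized ?h" using norm by (simp add: normalized_def cob3_def k00)
    have tr': "?c x x = 0" for x by (simp add: tr cob2_def)
    have hA': "?h a b d = 0" if "a \<in> A" "b \<in> A" "d \<in> A" for a b d
      using f[OF that] that by (simp add: \<phi>_def cob3_def k0_def AD)
    have cA': "?c a b = 0" if "a \<in> A" "b \<in> A" for a b
      using f[OF that AD(1)] that by (simp add: \<phi>_def cob2_def k0_def AD)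
    obtain k where k: "\<And>x y. x \<in> A \<Longrightarrow> y \<in> A \<Longrightarrow> k x y = 0"
      "\<And>x y z. x \<in> adjoin A r \<Longrightarrow> y \<in> adjoin A r \<Longrightarrow> z \<in> adjoin A r \<Longrightarrow> ?h x y z = cob3 k x y z"
      "\<And>x y. x \<in> adjoin A r \<Longrightarrow> y \<in> adjoin A r \<Longrightarrow> ?c x y = cob2 k x y"
      using cocycle_adjoin_trivial[OF coc' norm' tr' A r hA' cA'] by blast
    have "\<phi> (\<lambda>x y. k0 x y + k x y) a b d" if "a \<in> adjoin A r" "b \<in> adjoin A r" "d \<in> adjoin A r" for a b d
      using k(2)[OF that] k(3)[OF that(1,2)] k(1)[OF AD(1) AD(1)] k00
      unfolding \<phi>_def cob_add by (simp add: algebra_simps)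
    moreover have "k0 x y + k x y = f x y" if "x \<in> A" "y \<in> A" for x y
      using that by (simp add: k0_def k(1))
    ultimately show "\<exists>g. (\<forall>x\<in>A. \<forall>y\<in>A. g x y = f x y) \<and>
        (\<forall>a\<in>adjoin A r. \<forall>b\<in>adjoin A r. \<forall>d\<in>adjoin A r. \<phi> g a b d)"
      by (intro exI[of _ "\<lambda>x y. k0 x y + k x y"]) blast
  qed simp
  then obtain k where k: "\<And>a b d. \<phi> k a b d" by blast
  show thesis
  proof (rule that[of k])
    show "h x y z = cob3 k x y z" "c x y = cob2 k x y" for x y z
      using k[of x y z] by (simp_all add: \<phi>_def)
    show "k x 0 = 0" "k 0 x = 0" for x using f0[OF k k] by simp_all
  qed
qed

text \<open>A symmetric 2-cocycle describes an abelian extension of \<open>R\<close>, which splits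
  because a subgroup of a free abelian group is free. The splitting is built one generator at a
  time.\<close>

theorem symmetric_cocycle_splits:
  fixes k :: "('i \<Rightarrow>\<^sub>0 int) \<Rightarrow> ('i \<Rightarrow>\<^sub>0 int) \<Rightarrow> 'm::ab_group_add"
  assumes R: "additive_subgroup_set R"
    and coc: "\<And>x y z. x \<in> R \<Longrightarrow> y \<in> R \<Longrightarrow> z \<in> R \<Longrightarrow> cob3 k x y z = 0"
    and sym: "\<And>x y. x \<in> R \<Longrightarrow> y \<in> R \<Longrightarrow> k x y = k y x" and k00: "k 0 0 = 0"
  obtains u where "\<And>x y. x \<in> R \<Longrightarrow> y \<in> R \<Longrightarrow> k x y = u x + u y - u (x + y)"
proof -
  \<comment> \<open>The extension principle concerns binary functions, so the unary \<open>u\<close>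
    is encoded as \<open>f x 0\<close>.\<close>
  define \<phi> where "\<phi> f a b d \<longleftrightarrow> k a b = f a 0 + f b 0 - f (a + b) 0"
    for f :: "('i \<Rightarrow>\<^sub>0 int) \<Rightarrow> ('i \<Rightarrow>\<^sub>0 int) \<Rightarrow> 'm" and a b and d :: "'i \<Rightarrow>\<^sub>0 int"
  have "\<exists>f. \<forall>a\<in>R. \<forall>b\<in>R. \<forall>d\<in>R. \<phi> f a b d"
  proof (rule free_extension_principle[where ?f0.0 = "\<lambda>_ _. 0"])
    show "\<phi> (\<lambda>_ _. 0) 0 0 0" using k00 by (simp add: \<phi>_def)
    show "\<phi> g a b d" if "additive_subgroup_set A" "\<And>x y. x \<in> A \<Longrightarrow> y \<in> A \<Longrightarrow> f x y = g x y"
      "a \<in> A" "b \<in> A" "d \<in> A" "\<phi> f a b d" for A f g a b d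
      using that additive_subgroup_setD[OF that(1)] by (simp add: \<phi>_def)
  next
    fix A r f assume A: "additive_subgroup_set A" and r: "independent_over A r" and AR: "adjoin A r \<subseteq> R"
      and f: "\<And>a b d. a \<in> A \<Longrightarrow> b \<in> A \<Longrightarrow> d \<in> A \<Longrightarrow> \<phi> f a b d"
    let ?A = "adjoin A r"
    note E = additive_subgroup_setD[OF adjoin_subgroup[OF A, of r]]
    note AD = additive_subgroup_setD[OF A]
    have AA: "a \<in> ?A" if "a \<in> A" for a using adjoinI[OF that, of 0 r] by simp
    have rA: "zscale m r \<in> ?A" for m using adjoinI[OF AD(1), of m r] by simp
    have rA1: "r \<in> ?A" using rA[of 1] by simp
    have inR: "x \<in> R" if "x \<in> ?A" for x using AR that by blast
    obtain \<alpha> \<mu> where \<alpha>: "\<And>a m. a \<in> A \<Longrightarrow> \<alpha> (a + zscale m r) = a" "\<And>a m. a \<in> A \<Longrightarrow> \<mu> (a + zscale m r) = m"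
      using adjoin_coordinates[OF A r] by metis
    \<comment> \<open>Chosen so that \<open>v (y + r) = v y - k y r\<close>. By the cocycle identity
      the defect \<open>l\<close> is then periodic under \<open>r\<close> in its second argument, by
      symmetry also in its first, so it vanishes because it does on \<open>A\<close>.\<close>
    define v where "v x = f (\<alpha> x) 0 - zsum (\<lambda>j. k (\<alpha> x + zscale j r) r) (\<mu> x)" for x
    have vA: "v a = f a 0" if "a \<in> A" for a
      using \<alpha>[OF that, of 0] by (simp add: v_def)
    have v_shift: "v (y + r) = v y - k y r" if y: "y \<in> ?A" for y
    proof -
      obtain b n where b: "y = b + zscale n r" "b \<in> A" using y by (auto simp: adjoin_def)
      have eq: "y + r = b + zscale (n + 1) r" by (simp add: b zscale_Suc add.assoc)
      show ?thesis unfolding eq v_def by (simp add: b(1) \<alpha>[OF b(2)] zsum_Suc)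
    qed
    define l where "l x y = k x y - (v x + v y - v (x + y))" for x y
    have l_sym: "l x y = l y x" if "x \<in> ?A" "y \<in> ?A" for x y
      using sym that inR by (simp add: l_def add.commute)
    have lA: "l a b = 0" if "a \<in> A" "b \<in> A" for a b
      using f[OF that AD(1)] that by (simp add: l_def \<phi>_def vA AD)
    have l_shift: "l x (y + r) = l x y" if "x \<in> ?A" "y \<in> ?A" for x y
    proof -
      have v: "v (x + (y + r)) = v (x + y) - k (x + y) r"
        using v_shift[OF E(4)[OF that]] by (simp add: add.assoc)
      have c: "cob3 k x y r = 0" using coc that inR rA1 by blast
      show ?thesis
        unfolding l_def
        by (rule add_equation[OF v[symmetric]], rule add_equation[OF v_shift[OF that(2)]],
            rule add_equation[OF c[symmetric]]) (simp add: cob3_def algebra_simps)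
    qed
    have l_shiftm: "l x (y + zscale m r) = l x y" if "x \<in> ?A" "y \<in> ?A" for x y m
    proof (induction m rule: int_induct[where k = 0])
      case base then show ?case by simp
    next
      case (step1 i)
      then show ?case using l_shift[OF that(1) E(4)[OF that(2) rA], of i] by (simp add: zscale_Suc add.assoc)
    next
      case (step2 i)
      have eq: "y + zscale (i - 1) r + r = y + zscale i r" by (simp add: zscale_pred)
      show ?case using l_shift[OF that(1) E(4)[OF that(2) rA], of "i - 1"] step2 unfolding eq by simp
    qed
    have l0: "l x y = 0" if x: "x \<in> ?A" and y: "y \<in> ?A" for x y
    proof -
      obtain a m where a: "x = a + zscale m r" "a \<in> A" using x by (auto simp: adjoin_def)
      obtain b n where b: "y = b + zscale n r" "b \<in> A" using y by (auto simp: adjoin_def)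
      have "l x y = l x b" using l_shiftm[OF x AA[OF b(2)]] b(1) by simp
      also have "\<dots> = l b x" by (rule l_sym[OF x AA[OF b(2)]])
      also have "\<dots> = l b a" using l_shiftm[OF AA[OF b(2)] AA[OF a(2)]] a(1) by simp
      finally show ?thesis using lA a(2) b(2) by simp
    qed
    \<comment> \<open>On \<open>A\<close> this repeats \<open>f\<close>, as the extension principle
      demands; in the encoding \<open>g x 0\<close> it is \<open>v x\<close> everywhere.\<close>
    define g where "g x y = (if x \<in> A \<and> y \<in> A then f x y else v x)" for x y
    have g: "g x 0 = v x" for x using vA by (simp add: g_def AD)
    have "\<phi> g a b d" if "a \<in> ?A" "b \<in> ?A" for a b d
      using l0[OF that] by (simp add: \<phi>_def g l_def)
    then show "\<exists>g. (\<forall>x\<in>A. \<forall>y\<in>A. g x y = f x y) \<and> (\<forall>a\<in>?A. \<forall>b\<in>?A. \<forall>d\<in>?A. \<phi> g a b d)"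
      by (intro exI[of _ g]) (simp add: g_def)
  qed (rule R)
  then obtain f where "\<And>a b d. a \<in> R \<Longrightarrow> b \<in> R \<Longrightarrow> d \<in> R \<Longrightarrow> \<phi> f a b d" by blast
  then show thesis using that[of "\<lambda>x. f x 0"] additive_subgroup_setD(1)[OF R] by (simp add: \<phi>_def)
qed

theorem trace_zero_imp_coboundary:
  fixes h :: "'g::ab_group_add \<Rightarrow> 'g \<Rightarrow> 'g \<Rightarrow> 'm::ab_group_add"
  assumes coc: "abelian_cocycle h c" and tr: "\<And>x. c x x = 0"
  shows "\<exists>k. (\<forall>x y z. h x y z = cob3 k x y z) \<and> (\<forall>x y. c x y = cob2 k x y)"
proof -
  obtain k0 where norm: "normalized (\<lambda>x y z. h x y z - cob3 k0 x y z)"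
    using normalize_cocycle[OF coc] .
  define h' where "h' x y z = h x y z - cob3 k0 x y z" for x y z
  define c' where "c' x y = c x y - cob2 k0 x y" for x y
  have coc': "abelian_cocycle h' c'"
    unfolding h'_def c'_def by (rule abelian_cocycle_minus_coboundary[OF coc])
  have norm': "normalized h'" using norm by (simp add: h'_def[abs_def])
  have tr': "c' x x = 0" for x by (simp add: c'_def tr cob2_def)
  have N: "h' 0 x y = 0" "h' x 0 y = 0" "h' x y 0 = 0" for x y using norm' by (simp_all add: normalized_def)
  note Nc = normalized_braiding[OF coc' norm']
  obtain \<pi> :: "('g \<Rightarrow>\<^sub>0 int) \<Rightarrow> 'g" where \<pi>: "additive_on UNIV \<pi>" "surj \<pi>"
    using free_abelian_surjection .
  note p = additive_onD[OF \<pi>(1) additive_subgroup_set_UNIV, simplified]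
  define R where "R = {p. \<pi> p = 0}"
  have R: "additive_subgroup_set R" by (simp add: additive_subgroup_set_def p R_def)
  have "abelian_cocycle (\<lambda>x y z. h' (\<pi> x) (\<pi> y) (\<pi> z)) (\<lambda>x y. c' (\<pi> x) (\<pi> y))"
    using coc' unfolding abelian_cocycle_def p(1) by blast
  moreover have "normalized (\<lambda>x y z. h' (\<pi> x) (\<pi> y) (\<pi> z))"
    by (simp add: normalized_def p N)
  ultimately obtain k where kh: "\<And>x y z. h' (\<pi> x) (\<pi> y) (\<pi> z) = cob3 k x y z"
    and kc: "\<And>x y. c' (\<pi> x) (\<pi> y) = cob2 k x y" and k0: "\<And>x. k x 0 = 0" "\<And>x. k 0 x = 0"
    using free_cocycle_trivial[of "\<lambda>x y z. h' (\<pi> x) (\<pi> y) (\<pi> z)" "\<lambda>x y. c' (\<pi> x) (\<pi> y)"] tr' by blast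
  have kR: "cob3 k x y z = 0" if "x \<in> R" "y \<in> R" "z \<in> R" for x y z
    using kh[of x y z] that by (simp add: R_def N)
  have kR': "k x y = k y x" if "x \<in> R" "y \<in> R" for x y
    using kc[of x y] that by (simp add: R_def Nc cob2_def)
  obtain u where u: "\<And>x y. x \<in> R \<Longrightarrow> y \<in> R \<Longrightarrow> k x y = u x + u y - u (x + y)"
    using symmetric_cocycle_splits[OF R kR kR' k0(1)] by blast
  have u0: "u 0 = 0" using u[of 0 0] k0 by (simp add: R_def p)
  define s where "s x = (if x = 0 then 0 else inv_into UNIV \<pi> x)" for x
  have \<pi>s: "\<pi> (s x) = x" for x using \<pi>(2) by (simp add: s_def f_inv_into_f p)
  have s0: "s 0 = 0" by (simp add: s_def)
  \<comment> \<open>An extension of \<open>u\<close> from \<open>R\<close> to the whole free group,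
    forced by \<open>U (s x) = 0\<close> and by the wish that \<open>l\<close> vanish at
    \<open>(x, s y)\<close> for x in \<open>R\<close>.\<close>
  define U where "U p = u (p - s (\<pi> p)) - k (p - s (\<pi> p)) (s (\<pi> p))" for p
  define l where "l x y = k x y - (U x + U y - U (x + y))" for x y
  have lh: "cob3 l x y z = h' (\<pi> x) (\<pi> y) (\<pi> z)" for x y z
    unfolding kh by (simp add: l_def cob3_def algebra_simps)
  have lc: "cob2 l x y = c' (\<pi> x) (\<pi> y)" for x y
    unfolding kc by (simp add: l_def cob2_def algebra_simps)
  have UR: "U x = u x" if "x \<in> R" for x
    using that by (simp add: U_def R_def s0 k0)
  have Us: "U (s x) = 0" for x
    by (simp add: U_def \<pi>s u0 k0)
  have Urs: "U (x + s y) = u x - k x (s y)" if "x \<in> R" for x y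
    using that by (simp add: U_def p \<pi>s R_def)
  have l_RR: "l x y = 0" if "x \<in> R" "y \<in> R" for x y
    using that u additive_subgroup_setD(4)[OF R] by (simp add: l_def UR)
  have l_Rs: "l x (s y) = 0" if "x \<in> R" for x y
    using that by (simp add: l_def UR Us Urs)
  have l_R: "l x y = 0" if x: "x \<in> R" for x y
  proof -
    define y' where "y' = y - s (\<pi> y)"
    have y': "y' \<in> R" "y = y' + s (\<pi> y)" by (simp_all add: y'_def R_def p \<pi>s)
    have "cob3 l x y' (s (\<pi> y)) = 0" using x y' by (simp add: lh R_def N)
    then show ?thesis
      using x y' additive_subgroup_setD(4)[OF R] by (simp add: cob3_def l_Rs l_RR)
  qed
  have l_R': "l y x = 0" if x: "x \<in> R" for x y
    using lc[of x y] l_R[OF x] x by (simp add: cob2_def R_def Nc)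
  \<comment> \<open>For x in \<open>R\<close> the normalized \<open>h'\<close> makes
    \<open>cob3 l\<close> vanish, and so do the two terms of it with argument x alone. What is left
    says that \<open>l\<close> depends only on classes modulo \<open>R\<close>.\<close>
  have l_shift: "l (x + y) z = l y z" "l z (x + y) = l z y" if x: "x \<in> R" for x y z
    using lh[of x y z] lh[of z y x] l_R[OF x] l_R'[OF x] x by (simp_all add: cob3_def R_def N add.commute)
  have l_\<pi>: "l x y = l x' y'" if "\<pi> x = \<pi> x'" "\<pi> y = \<pi> y'" for x y x' y'
    using l_shift(1)[of "x - x'" x' y] l_shift(2)[of "y - y'" x' y'] that by (simp add: R_def p)
  define K where "K x y = l (s x) (s y)" for x y
  have K: "l x y = K (\<pi> x) (\<pi> y)" for x y unfolding K_def by (rule l_\<pi>) (simp_all add: \<pi>s)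
  have "h' x y z = cob3 K x y z" for x y z
    using lh[of "s x" "s y" "s z"] by (simp add: cob3_def K p \<pi>s)
  moreover have "c' x y = cob2 K x y" for x y
    using lc[of "s x" "s y"] by (simp add: cob2_def K \<pi>s)
  ultimately have "h x y z = cob3 (\<lambda>x y. k0 x y + K x y) x y z" "c x y = cob2 (\<lambda>x y. k0 x y + K x y) x y" for x y z
    unfolding cob_add h'_def c'_def by (simp_all add: algebra_simps)
  then show ?thesis by blast
qed

section \<open>From types to carriers\<close>

text \<open>The product of all abelian groups with elements of type \<open>'a\<close>, as a type. Every such group is a
  direct factor of it, which carries the results over from types to carriers.\<close>

typedef 'a all_groups_product = "(\<Pi>\<^sub>E M\<in>{M::'a monoid. comm_group M}. carrier M)"
proof
  show "(\<lambda>M\<in>{M. comm_group M}. \<one>\<^bsub>M\<^esub>) \<in> (\<Pi>\<^sub>E M\<in>{M::'a monoid. comm_group M}. carrier M)"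
    by (auto intro: comm_groupE(2))
qed

abbreviation component :: "'a monoid \<Rightarrow> 'a all_groups_product \<Rightarrow> 'a"
  where "component M x \<equiv> Rep_all_groups_product x M"

lemma component_closed [simp]: "comm_group M \<Longrightarrow> component M x \<in> carrier M"
  using Rep_all_groups_product[of x] by auto

lemma component_eqI:
  assumes "\<And>M. comm_group M \<Longrightarrow> component M x = component M y" shows "x = y"
proof -
  have "Rep_all_groups_product x = Rep_all_groups_product y"
    by (rule PiE_ext[OF Rep_all_groups_product Rep_all_groups_product]) (use assms in simp)
  then show ?thesis by (simp add: Rep_all_groups_product_inject)
qed

definition tuple :: "('a monoid \<Rightarrow> 'a) \<Rightarrow> 'a all_groups_product"
  where "tuple f = Abs_all_groups_product (\<lambda>M\<in>{M. comm_group M}. f M)"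

lemma component_tuple:
  assumes "\<And>M. comm_group M \<Longrightarrow> f M \<in> carrier M" "comm_group M"
  shows "component M (tuple f) = f M"
  unfolding tuple_def using assms by (subst Abs_all_groups_product_inverse) auto

instantiation all_groups_product :: (type) ab_group_add
begin

definition zero_all_groups_product where "0 = tuple (\<lambda>M. \<one>\<^bsub>M\<^esub>)"
definition plus_all_groups_product where "x + y = tuple (\<lambda>M. component M x \<otimes>\<^bsub>M\<^esub> component M y)"
definition uminus_all_groups_product where "- x = tuple (\<lambda>M. inv\<^bsub>M\<^esub> component M x)"
definition minus_all_groups_product
  where "x - y = tuple (\<lambda>M. component M x \<otimes>\<^bsub>M\<^esub> inv\<^bsub>M\<^esub> component M y)"

lemma component_simps [simp]:
  assumes "comm_group M"
  shows "component M 0 = \<one>\<^bsub>M\<^esub>" "component M (x + y) = component M x \<otimes>\<^bsub>M\<^esub> component M y"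
    "component M (- x) = inv\<^bsub>M\<^esub> component M x"
    "component M (x - y) = component M x \<otimes>\<^bsub>M\<^esub> inv\<^bsub>M\<^esub> component M y"
proof -
  have closed: "\<one>\<^bsub>N\<^esub> \<in> carrier N" "component N x \<otimes>\<^bsub>N\<^esub> component N y \<in> carrier N"
    "inv\<^bsub>N\<^esub> component N x \<in> carrier N" "component N x \<otimes>\<^bsub>N\<^esub> inv\<^bsub>N\<^esub> component N y \<in> carrier N"
    if "comm_group N" for N
  proof -
    interpret comm_group N by fact
    show "\<one>\<^bsub>N\<^esub> \<in> carrier N" "component N x \<otimes>\<^bsub>N\<^esub> component N y \<in> carrier N"
      "inv\<^bsub>N\<^esub> component N x \<in> carrier N" "component N x \<otimes>\<^bsub>N\<^esub> inv\<^bsub>N\<^esub> component N y \<in> carrier N"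
      using that by simp_all
  qed
  show "component M 0 = \<one>\<^bsub>M\<^esub>" "component M (x + y) = component M x \<otimes>\<^bsub>M\<^esub> component M y"
    "component M (- x) = inv\<^bsub>M\<^esub> component M x"
    "component M (x - y) = component M x \<otimes>\<^bsub>M\<^esub> inv\<^bsub>M\<^esub> component M y"
    by (simp_all add: zero_all_groups_product_def plus_all_groups_product_def
      uminus_all_groups_product_def minus_all_groups_product_def component_tuple closed assms)
qed

instance
proof
  fix a b c :: "'a all_groups_product"
  show "a + b + c = a + (b + c)"
    by (rule component_eqI) (simp add: comm_groupE(3))
  show "a + b = b + a"
    by (rule component_eqI) (simp add: comm_groupE(4))
  show "0 + a = a"
    by (rule component_eqI) (simp add: comm_groupE(5))
  show "- a + a = 0"
    by (rule component_eqI) (simp add: comm_group.axioms(2) group.l_inv)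
  show "a - b = a + - b"
    by (rule component_eqI) (simp)
qed

end

text \<open>Inclusion of the factor \<open>M\<close>, with \<open>component M\<close> as left
  inverse.\<close>

definition embed :: "'a monoid \<Rightarrow> 'a \<Rightarrow> 'a all_groups_product"
  where "embed M a = tuple (\<lambda>N. if N = M then a else \<one>\<^bsub>N\<^esub>)"

lemma component_embed:
  assumes "a \<in> carrier M" "comm_group N"
  shows "component N (embed M a) = (if N = M then a else \<one>\<^bsub>N\<^esub>)"
  unfolding embed_def by (rule component_tuple) (use assms comm_groupE(2) in auto)

lemma component_embed_same [simp]: "comm_group M \<Longrightarrow> a \<in> carrier M \<Longrightarrow> component M (embed M a) = a"
  by (simp add: component_embed)

lemma embed_mult:
  assumes "comm_group M" "a \<in> carrier M" "b \<in> carrier M"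
  shows "embed M (a \<otimes>\<^bsub>M\<^esub> b) = embed M a + embed M b"
  by (rule component_eqI)
     (use assms in \<open>simp add: component_embed comm_groupE(1,2) comm_groupE(5)[OF _ comm_groupE(2)]\<close>)

lemma embed_one: "comm_group M \<Longrightarrow> embed M \<one>\<^bsub>M\<^esub> = 0"
  using embed_mult[of M "\<one>\<^bsub>M\<^esub>" "\<one>\<^bsub>M\<^esub>"] comm_groupE(2,5) by fastforce

lemma embed_inv:
  assumes "comm_group M" "a \<in> carrier M"
  shows "embed M (inv\<^bsub>M\<^esub> a) = - embed M a"
proof -
  interpret comm_group M by fact
  show ?thesis
    using embed_mult[OF assms(1) assms(2) inv_closed[OF assms(2)]] assms
    by (simp add: embed_one eq_neg_iff_add_eq_0 add.commute)
qed

lemma embed_eq_iff: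
  "comm_group M \<Longrightarrow> a \<in> carrier M \<Longrightarrow> b \<in> carrier M \<Longrightarrow> embed M a = embed M b \<longleftrightarrow> a = b"
  by (metis component_embed_same)

section \<open>The trace of a cohomology class\<close>

definition quadratic_map :: "'a monoid \<Rightarrow> 'm monoid \<Rightarrow> ('a \<Rightarrow> 'm) \<Rightarrow> bool"
  where "quadratic_map G M q \<longleftrightarrow> q \<in> carrier G \<rightarrow> carrier M \<and>
    (\<forall>x\<in>carrier G. \<forall>y\<in>carrier G. \<forall>z\<in>carrier G.
      q (x \<otimes>\<^bsub>G\<^esub> y \<otimes>\<^bsub>G\<^esub> z) \<otimes>\<^bsub>M\<^esub> inv\<^bsub>M\<^esub> q (x \<otimes>\<^bsub>G\<^esub> y) \<otimes>\<^bsub>M\<^esub> inv\<^bsub>M\<^esub> q z =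
      (q (x \<otimes>\<^bsub>G\<^esub> z) \<otimes>\<^bsub>M\<^esub> inv\<^bsub>M\<^esub> q x \<otimes>\<^bsub>M\<^esub> inv\<^bsub>M\<^esub> q z) \<otimes>\<^bsub>M\<^esub>
      (q (y \<otimes>\<^bsub>G\<^esub> z) \<otimes>\<^bsub>M\<^esub> inv\<^bsub>M\<^esub> q y \<otimes>\<^bsub>M\<^esub> inv\<^bsub>M\<^esub> q z)) \<and>
    (\<forall>x\<in>carrier G. q (x \<otimes>\<^bsub>G\<^esub> x) \<otimes>\<^bsub>M\<^esub> inv\<^bsub>M\<^esub> q x \<otimes>\<^bsub>M\<^esub> inv\<^bsub>M\<^esub> q x = q x \<otimes>\<^bsub>M\<^esub> q x)"

text \<open>The projection \<open>component G\<close> maps onto \<open>carrier G\<close>, and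
  \<open>embed M\<close> is additive and injective on \<open>carrier M\<close>, so the two sets of
  equations are equivalent.\<close>

lemma quadratic_map_iff:
  assumes G: "comm_group G" and M: "comm_group M" and q: "q \<in> carrier G \<rightarrow> carrier M"
  shows "quadratic_map G M q \<longleftrightarrow> quadratic (\<lambda>x. embed M (q (component G x)))"
    (is "_ \<longleftrightarrow> quadratic ?Q")
proof -
  interpret G: comm_group G by fact
  interpret M: comm_group M by fact
  have qc [simp]: "q x \<in> carrier M" if "x \<in> carrier G" for x using q that by auto
  have pol: "polarization ?Q x y = embed M (q (component G x \<otimes>\<^bsub>G\<^esub> component G y)
      \<otimes>\<^bsub>M\<^esub> inv\<^bsub>M\<^esub> q (component G x) \<otimes>\<^bsub>M\<^esub> inv\<^bsub>M\<^esub> q (component G y))" for x y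
    by (simp add: polarization_def embed_mult embed_inv G M)
  have range: "carrier G = range (component G)"
    using component_embed_same[OF G] component_closed[OF G] by (metis image_eqI rangeI image_subsetI subsetI subset_antisym UNIV_I)
  have "quadratic ?Q \<longleftrightarrow>
    (\<forall>x y z. q (component G x \<otimes>\<^bsub>G\<^esub> component G y \<otimes>\<^bsub>G\<^esub> component G z) \<otimes>\<^bsub>M\<^esub> inv\<^bsub>M\<^esub> q (component G x \<otimes>\<^bsub>G\<^esub> component G y) \<otimes>\<^bsub>M\<^esub> inv\<^bsub>M\<^esub> q (component G z) =
      (q (component G x \<otimes>\<^bsub>G\<^esub> component G z) \<otimes>\<^bsub>M\<^esub> inv\<^bsub>M\<^esub> q (component G x) \<otimes>\<^bsub>M\<^esub> inv\<^bsub>M\<^esub> q (component G z)) \<otimes>\<^bsub>M\<^esub>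
      (q (component G y \<otimes>\<^bsub>G\<^esub> component G z) \<otimes>\<^bsub>M\<^esub> inv\<^bsub>M\<^esub> q (component G y) \<otimes>\<^bsub>M\<^esub> inv\<^bsub>M\<^esub> q (component G z))) \<and>
    (\<forall>x. q (component G x \<otimes>\<^bsub>G\<^esub> component G x) \<otimes>\<^bsub>M\<^esub> inv\<^bsub>M\<^esub> q (component G x) \<otimes>\<^bsub>M\<^esub> inv\<^bsub>M\<^esub> q (component G x)
      = q (component G x) \<otimes>\<^bsub>M\<^esub> q (component G x))"
    unfolding quadratic_def pol by (simp add: G M embed_mult[symmetric] embed_eq_iff)
  also have "\<dots> \<longleftrightarrow> quadratic_map G M q"
    using q unfolding quadratic_map_def range by simp
  finally show ?thesis by simp
qed

lemma Z3_iff: "(h, c) \<in> carrier (Z3_2ab G M) \<longleftrightarrow>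
  h \<in> carrier3 G \<rightarrow>\<^sub>E carrier M \<and> c \<in> carrier2 G \<rightarrow>\<^sub>E carrier M \<and> cocycle3 G M h \<and> hexagons G M h c"
  by (simp add: Z3_2ab_def C3_2ab_def)

lemma embed_cocycle:
  fixes G :: "'a monoid" and M :: "'m monoid"
  assumes G: "comm_group G" and M: "comm_group M" and z: "(h, c) \<in> carrier (Z3_2ab G M)"
  shows "abelian_cocycle (\<lambda>x y w. embed M (h (component G x, component G y, component G w)))
    (\<lambda>x y. embed M (c (component G x, component G y)))"
proof -
  interpret G: comm_group G by fact
  interpret M: comm_group M by fact
  have [simp]: "h p \<in> carrier M" if "p \<in> carrier3 G" for p
    using z that unfolding Z3_iff by (meson PiE_mem)
  have [simp]: "c p \<in> carrier M" if "p \<in> carrier2 G" for p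
    using z that unfolding Z3_iff by (meson PiE_mem)
  have coc: "cocycle3 G M h" and hex: "hexagons G M h c" using z by (simp_all add: Z3_iff)
  note e = embed_mult[OF M, symmetric] embed_inv[OF M, symmetric]
  have minus: "embed M a - embed M b = embed M (a \<otimes>\<^bsub>M\<^esub> inv\<^bsub>M\<^esub> b)" if "a \<in> carrier M" "b \<in> carrier M" for a b
    using that by (simp add: embed_mult[OF M] embed_inv[OF M])
  show ?thesis
    unfolding abelian_cocycle_def
    using coc hex by (simp add: e minus G M cocycle3_def hexagons_def)
qed

theorem quadratic_map_trace:
  fixes G :: "'a monoid" and M :: "'m monoid"
  assumes G: "comm_group G" and M: "comm_group M" and z: "z \<in> carrier (Z3_2ab G M)"
  shows "quadratic_map G M (\<lambda>x. snd z (x, x))"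
proof -
  obtain h c where hc: "z = (h, c)" by force
  have "(\<lambda>x. snd z (x, x)) \<in> carrier G \<rightarrow> carrier M"
    using z by (auto simp: hc Z3_iff)
  then show ?thesis
    using quadratic_trace[OF embed_cocycle[OF G M z[unfolded hc]]] by (simp add: quadratic_map_iff[OF G M] hc)
qed

theorem trace_one_imp_B3:
  fixes G :: "'a monoid" and M :: "'m monoid"
  assumes G: "comm_group G" and M: "comm_group M" and z: "z \<in> carrier (Z3_2ab G M)"
    and tr: "\<And>x. x \<in> carrier G \<Longrightarrow> snd z (x, x) = \<one>\<^bsub>M\<^esub>"
  shows "z \<in> B3_2ab G M"
proof -
  interpret G: comm_group G by fact
  interpret M: comm_group M by fact
  obtain h c where hc: "z = (h, c)" by force
  have h: "h \<in> carrier3 G \<rightarrow>\<^sub>E carrier M" and c: "c \<in> carrier2 G \<rightarrow>\<^sub>E carrier M"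
    using z by (simp_all add: hc Z3_iff)
  obtain k where kh: "\<And>x y w. embed M (h (component G x, component G y, component G w)) = cob3 k x y w"
    and kc: "\<And>x y. embed M (c (component G x, component G y)) = cob2 k x y"
    using trace_zero_imp_coboundary[OF embed_cocycle[OF G M z[unfolded hc]]] tr
    by (auto simp: hc G embed_one[OF M])
  \<comment> \<open>Restriction of \<open>k\<close> to the factor \<open>G\<close>, followed by
    projection to \<open>M\<close>. Both maps are homomorphisms, so coboundaries are
    respected.\<close>
  define K where "K = (\<lambda>(x, y)\<in>carrier2 G. component M (k (embed G x) (embed G y)))"
  have [simp]: "h p \<in> carrier M" if "p \<in> carrier3 G" for p using h that by (rule PiE_mem)
  have [simp]: "c p \<in> carrier M" if "p \<in> carrier2 G" for p using c that by (rule PiE_mem)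
  have h_cob: "h (x, y, w) = component M (cob3 k (embed G x) (embed G y) (embed G w))"
    if "x \<in> carrier G" "y \<in> carrier G" "w \<in> carrier G" for x y w
    using that by (simp add: G M kh[symmetric])
  have c_cob: "c (x, y) = component M (cob2 k (embed G x) (embed G y))"
    if "x \<in> carrier G" "y \<in> carrier G" for x y
    using that by (simp add: G M kc[symmetric])
  have "h = fst (coboundary_2ab G M K)"
  proof (rule extensionalityI[of _ "carrier3 G"])
    show "h \<in> extensional (carrier3 G)" using h by (simp add: PiE_iff)
    show "fst (coboundary_2ab G M K) \<in> extensional (carrier3 G)" by (simp add: coboundary_2ab_def)
    fix p assume "p \<in> carrier3 G"
    then show "h p = fst (coboundary_2ab G M K) p"
      by (auto simp: h_cob coboundary_2ab_def K_def cob3_def G M embed_mult[OF G])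
  qed
  moreover have "c = snd (coboundary_2ab G M K)"
  proof (rule extensionalityI[of _ "carrier2 G"])
    show "c \<in> extensional (carrier2 G)" using c by (simp add: PiE_iff)
    show "snd (coboundary_2ab G M K) \<in> extensional (carrier2 G)" by (simp add: coboundary_2ab_def)
    fix p assume "p \<in> carrier2 G"
    then show "c p = snd (coboundary_2ab G M K) p"
      by (auto simp: c_cob coboundary_2ab_def K_def cob2_def G M)
  qed
  ultimately have "z = coboundary_2ab G M K" by (simp add: hc)
  moreover have "K \<in> carrier2 G \<rightarrow>\<^sub>E carrier M" by (auto simp: K_def M)
  ultimately show ?thesis by (auto simp: B3_2ab_def)
qed

theorem quadratic_map_is_trace:
  fixes G :: "'a monoid" and M :: "'m monoid"
  assumes G: "comm_group G" and M: "comm_group M" and q: "quadratic_map G M q"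
  obtains z where "z \<in> carrier (Z3_2ab G M)" "\<And>x. x \<in> carrier G \<Longrightarrow> snd z (x, x) = q x"
proof -
  interpret G: comm_group G by fact
  interpret M: comm_group M by fact
  have qc: "q \<in> carrier G \<rightarrow> carrier M" using q by (simp add: quadratic_map_def)
  have "quadratic (\<lambda>x. embed M (q (component G x)))"
    using q quadratic_map_iff[OF G M qc] by simp
  from quadratic_is_trace[OF this] obtain h c
    where coc: "abelian_cocycle h c" and tr: "\<And>x. c x x = embed M (q (component G x))" by blast
  let ?e = "embed G" and ?p = "component M"
  define z where "z = (\<lambda>(x, y, w)\<in>carrier3 G. ?p (h (?e x) (?e y) (?e w)), \<lambda>(x, y)\<in>carrier2 G. ?p (c (?e x) (?e y)))"
  note D = abelian_cocycleD[OF coc, THEN arg_cong[of _ _ ?p]]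
  have "cocycle3 G M (fst z)"
    using D(1) by (simp add: z_def cocycle3_def embed_mult[OF G] M)
  moreover have "hexagons G M (fst z) (snd z)"
    using D(2,3) by (simp add: z_def hexagons_def embed_mult[OF G] M del: uminus_add_conv_diff)
  ultimately have "z \<in> carrier (Z3_2ab G M)"
    by (subst prod.collapse[symmetric], subst Z3_iff) (auto simp: z_def M)
  moreover have "snd z (x, x) = q x" if "x \<in> carrier G" for x
    using that funcset_mem[OF qc that] by (simp add: z_def tr G M)
  ultimately show thesis using that[of z] by blast
qed

text \<open>The trace is a complete invariant of a class: it is trivial on coboundaries because k(x,
  x) cancels against itself, and conversely \<open>trace_one_imp_B3\<close> applies to the quotient
  of \<open>z\<close> by \<open>w\<close>.\<close>

theorem H3_coset_eq_iff:
  fixes G :: "'a monoid" and M :: "'m monoid"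
  assumes G: "comm_group G" and M: "comm_group M"
    and z: "z \<in> carrier (Z3_2ab G M)" and w: "w \<in> carrier (Z3_2ab G M)"
  shows "B3_2ab G M #>\<^bsub>Z3_2ab G M\<^esub> z = B3_2ab G M #>\<^bsub>Z3_2ab G M\<^esub> w \<longleftrightarrow>
    (\<forall>x\<in>carrier G. snd z (x, x) = snd w (x, x))"
proof -
  interpret G: comm_group G by fact
  interpret M: comm_group M by fact
  interpret Z: comm_group "Z3_2ab G M" by (rule comm_group_Z3) fact+
  interpret B: subgroup "B3_2ab G M" "Z3_2ab G M" by (rule subgroup_B3) fact+
  have tr_closed: "snd a (x, x) \<in> carrier M" if "a \<in> carrier (Z3_2ab G M)" "x \<in> carrier G" for a x
    using quadratic_map_trace[OF G M that(1)] that(2) by (auto simp: quadratic_map_def)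
  have tr_mult: "snd (a \<otimes>\<^bsub>Z3_2ab G M\<^esub> b) (x, x) = snd a (x, x) \<otimes>\<^bsub>M\<^esub> snd b (x, x)"
    if "x \<in> carrier G" for a b x
    using that by (cases a; cases b) (simp add: mult_Z3)
  have tr_B: "snd b (x, x) = \<one>\<^bsub>M\<^esub>" if "b \<in> B3_2ab G M" "x \<in> carrier G" for b x
    using that by (auto simp: B3_2ab_def coboundary_2ab_def PiE_iff)
  show ?thesis
  proof
    assume "B3_2ab G M #>\<^bsub>Z3_2ab G M\<^esub> z = B3_2ab G M #>\<^bsub>Z3_2ab G M\<^esub> w"
    then have "z \<in> B3_2ab G M #>\<^bsub>Z3_2ab G M\<^esub> w"
      using Z.rcos_self[OF z B.subgroup_axioms] by simp
    then obtain b where b: "b \<in> B3_2ab G M" "z = b \<otimes>\<^bsub>Z3_2ab G M\<^esub> w" by (auto simp: r_coset_def)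
    then show "\<forall>x\<in>carrier G. snd z (x, x) = snd w (x, x)"
      using tr_closed[OF w] by (simp add: tr_mult tr_B)
  next
    assume eq: "\<forall>x\<in>carrier G. snd z (x, x) = snd w (x, x)"
    define d where "d = z \<otimes>\<^bsub>Z3_2ab G M\<^esub> inv\<^bsub>Z3_2ab G M\<^esub> w"
    have d: "d \<in> carrier (Z3_2ab G M)" "z = d \<otimes>\<^bsub>Z3_2ab G M\<^esub> w"
      using z w by (simp_all add: d_def Z.m_assoc)
    have "snd d (x, x) = \<one>\<^bsub>M\<^esub>" if x: "x \<in> carrier G" for x
    proof -
      have "snd d (x, x) \<otimes>\<^bsub>M\<^esub> snd w (x, x) = snd w (x, x)"
        using eq x tr_mult[OF x, of d w] d(2) by simp
      then show ?thesis using tr_closed[OF d(1) x] tr_closed[OF w x] by simp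
    qed
    then have "d \<in> B3_2ab G M" by (rule trace_one_imp_B3[OF G M d(1)])
    then show "B3_2ab G M #>\<^bsub>Z3_2ab G M\<^esub> z = B3_2ab G M #>\<^bsub>Z3_2ab G M\<^esub> w"
      unfolding d(2) using w by (simp add: Z.coset_mult_assoc[symmetric] B.subset B.rcos_const[OF Z.is_group])
  qed
qed

section \<open>Gluing traces over the colimit\<close>

lemma H3_cases:
  assumes "u \<in> carrier (H3_2ab G M)"
  obtains z where "z \<in> carrier (Z3_2ab G M)" "u = B3_2ab G M #>\<^bsub>Z3_2ab G M\<^esub> z"
  using assms by (auto simp: H3_2ab_def carrier_FactGroup)

lemma trace_pullback: "x \<in> carrier G \<Longrightarrow> snd (pullback_2ab G \<phi> z) (x, x) = snd z (\<phi> x, \<phi> x)"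
  by (simp add: pullback_2ab_def case_prod_beta)

theorem lemma4p3:
  fixes C :: "('o, 'f) category"
    and G :: "'o \<Rightarrow> 'a monoid" and F :: "'f \<Rightarrow> 'a \<Rightarrow> 'a"
    and M :: "'m monoid"
  assumes "filtered_category C"
    and "ab_group_functor C G F"
    and "comm_group M"
  shows "H3_colim_to_lim C G F M \<in> iso (H3_2ab (colim_group C G F) M) (lim_H3 C G F M)"
proof -
  interpret filtered_category C by fact
  interpret ab_group_functor C G F by fact
  interpret filtered_ab_system C G F by unfold_locales
  note M = assms(3)
  note L = comm_group_colim
  let ?\<Phi> = "H3_colim_to_lim C G F M"
  have \<Phi>: "?\<Phi> (B3_2ab L M #>\<^bsub>Z3_2ab L M\<^esub> z) i = B3_2ab (G i) M #>\<^bsub>Z3_2ab (G i) M\<^esub> pullback_2ab (G i) (\<iota> i) z"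
    and pb: "pullback_2ab (G i) (\<iota> i) z \<in> carrier (Z3_2ab (G i) M)"
    if "z \<in> carrier (Z3_2ab L M)" "i \<in> Obj C" for z i
    using H3_map_coset[OF comm_group L M colim_in_hom that(1)] pullback_in_Z3[OF comm_group L M colim_in_hom that(1)] that(2)
    by (simp_all add: H3_colim_to_lim_def)
  have "inj_on ?\<Phi> (carrier (H3_2ab L M))"
  proof (rule inj_onI)
    fix u v assume u: "u \<in> carrier (H3_2ab L M)" and v: "v \<in> carrier (H3_2ab L M)" and eq: "?\<Phi> u = ?\<Phi> v"
    obtain z where z: "z \<in> carrier (Z3_2ab L M)" "u = B3_2ab L M #>\<^bsub>Z3_2ab L M\<^esub> z" using H3_cases[OF u] .
    obtain w where w: "w \<in> carrier (Z3_2ab L M)" "v = B3_2ab L M #>\<^bsub>Z3_2ab L M\<^esub> w" using H3_cases[OF v] .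
    \<comment> \<open>Every element of the colimit comes from a stage, so equality of traces can be
      tested there.\<close>
    have "snd z (\<iota> i x, \<iota> i x) = snd w (\<iota> i x, \<iota> i x)" if i: "i \<in> Obj C" and x: "x \<in> carrier (G i)" for i x
    proof -
      have "B3_2ab (G i) M #>\<^bsub>Z3_2ab (G i) M\<^esub> pullback_2ab (G i) (\<iota> i) z
          = B3_2ab (G i) M #>\<^bsub>Z3_2ab (G i) M\<^esub> pullback_2ab (G i) (\<iota> i) w"
        using eq \<Phi>[OF z(1) i] \<Phi>[OF w(1) i] z(2) w(2) by simp
      then show ?thesis
        using H3_coset_eq_iff[OF comm_group[OF i] M pb[OF z(1) i] pb[OF w(1) i]] x by (simp add: trace_pullback)
    qed
    then show "u = v"
      unfolding z(2) w(2) H3_coset_eq_iff[OF L M z(1) w(1)] carrier_colim by blast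
  qed
  moreover have "s \<in> ?\<Phi> ` carrier (H3_2ab L M)" if s: "s \<in> carrier (lim_H3 C G F M)" for s
  proof -
    have sP: "s \<in> (\<Pi>\<^sub>E i\<in>Obj C. carrier (H3_2ab (G i) M))"
      and sf: "\<And>f. f \<in> Arr C \<Longrightarrow> H3_map (G (Dom C f)) M (F f) (s (Cod C f)) = s (Dom C f)"
      using s by (auto simp: lim_H3_def lim_group_def)
    have "\<forall>i\<in>Obj C. \<exists>z. z \<in> carrier (Z3_2ab (G i) M) \<and> s i = B3_2ab (G i) M #>\<^bsub>Z3_2ab (G i) M\<^esub> z"
      using sP H3_cases by (metis PiE_mem)
    then obtain z where z: "\<And>i. i \<in> Obj C \<Longrightarrow> z i \<in> carrier (Z3_2ab (G i) M)"
      and sz: "\<And>i. i \<in> Obj C \<Longrightarrow> s i = B3_2ab (G i) M #>\<^bsub>Z3_2ab (G i) M\<^esub> z i" by metis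
    \<comment> \<open>The chosen cocycles are compatible only up to coboundaries, but their traces
      are strictly compatible, which allows gluing.\<close>
    define q where "q i x = snd (z i) (x, x)" for i x
    have qq: "quadratic_map (G i) M (q i)" if "i \<in> Obj C" for i
      unfolding q_def by (rule quadratic_map_trace[OF comm_group[OF that] M z[OF that]])
    have q_compat: "q j (F f x) = q i x" if f: "f \<in> Hom C i j" and x: "x \<in> carrier (G i)" for f i j x
    proof -
      have ij: "i \<in> Obj C" "j \<in> Obj C" using Hom_obj[OF f] by auto
      have "B3_2ab (G i) M #>\<^bsub>Z3_2ab (G i) M\<^esub> pullback_2ab (G i) (F f) (z j) = B3_2ab (G i) M #>\<^bsub>Z3_2ab (G i) M\<^esub> z i"
        using sf[of f] f H3_map_coset[OF comm_group[OF ij(1)] comm_group[OF ij(2)] M hom[OF f] z[OF ij(2)]] sz ij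
        by (auto simp: Hom_def)
      then show ?thesis
        using H3_coset_eq_iff[OF comm_group[OF ij(1)] M pullback_in_Z3[OF comm_group[OF ij(1)] comm_group[OF ij(2)] M hom[OF f] z[OF ij(2)]] z[OF ij(1)]] x
        by (simp add: trace_pullback q_def)
    qed
    \<comment> \<open>Well defined, since two representatives of a germ become equal at a later
      stage and the \<open>q i\<close> are compatible.\<close>
    define Q where "Q A = (SOME m. \<exists>i\<in>Obj C. \<exists>x\<in>carrier (G i). A = \<iota> i x \<and> m = q i x)" for A
    have Q: "Q (\<iota> i x) = q i x" if i: "i \<in> Obj C" and x: "x \<in> carrier (G i)" for i x
      unfolding Q_def
    proof (rule some_equality)
      fix m assume "\<exists>j\<in>Obj C. \<exists>y\<in>carrier (G j). \<iota> i x = \<iota> j y \<and> m = q j y"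
      then obtain j y where j: "j \<in> Obj C" "y \<in> carrier (G j)" "\<iota> i x = \<iota> j y" "m = q j y" by blast
      then obtain k f g where "f \<in> Hom C i k" "g \<in> Hom C j k" "F f x = F g y"
        using colim_in_eq_iff[OF i x j(1,2)] by blast
      then show "m = q i x" using q_compat j x by metis
    qed (use i x in blast)
    have Qq: "quadratic_map L M Q"
      unfolding quadratic_map_def
    proof (intro conjI ballI)
      have "q i x \<in> carrier M" if "i \<in> Obj C" "x \<in> carrier (G i)" for i x
        using qq[OF that(1)] that(2) by (auto simp: quadratic_map_def)
      then show "Q \<in> carrier L \<rightarrow> carrier M"
        by (auto simp: carrier_colim Q)
    next
      fix X Y Z assume "X \<in> carrier L" "Y \<in> carrier L" "Z \<in> carrier L"
      \<comment> \<open>Filteredness brings the three germs to one stage, where the identity is that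
        of \<open>q k\<close>.\<close>
      then obtain k x y w where k: "k \<in> Obj C" and xyw: "x \<in> carrier (G k)" "y \<in> carrier (G k)" "w \<in> carrier (G k)"
        and XYZ: "X = \<iota> k x" "Y = \<iota> k y" "Z = \<iota> k w"
        using colim_stage3 by metis
      show "Q (X \<otimes>\<^bsub>L\<^esub> Y \<otimes>\<^bsub>L\<^esub> Z) \<otimes>\<^bsub>M\<^esub> inv\<^bsub>M\<^esub> Q (X \<otimes>\<^bsub>L\<^esub> Y) \<otimes>\<^bsub>M\<^esub> inv\<^bsub>M\<^esub> Q Z =
          Q (X \<otimes>\<^bsub>L\<^esub> Z) \<otimes>\<^bsub>M\<^esub> inv\<^bsub>M\<^esub> Q X \<otimes>\<^bsub>M\<^esub> inv\<^bsub>M\<^esub> Q Z \<otimes>\<^bsub>M\<^esub>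
          (Q (Y \<otimes>\<^bsub>L\<^esub> Z) \<otimes>\<^bsub>M\<^esub> inv\<^bsub>M\<^esub> Q Y \<otimes>\<^bsub>M\<^esub> inv\<^bsub>M\<^esub> Q Z)"
        using qq[OF k] k xyw by (simp add: XYZ colim_mult_same Q G_closed quadratic_map_def)
    next
      fix X assume "X \<in> carrier L"
      then obtain k x where k: "k \<in> Obj C" and x: "x \<in> carrier (G k)" and X: "X = \<iota> k x"
        by (auto simp: carrier_colim)
      show "Q (X \<otimes>\<^bsub>L\<^esub> X) \<otimes>\<^bsub>M\<^esub> inv\<^bsub>M\<^esub> Q X \<otimes>\<^bsub>M\<^esub> inv\<^bsub>M\<^esub> Q X = Q X \<otimes>\<^bsub>M\<^esub> Q X"
        using qq[OF k] k x by (simp add: X colim_mult_same Q G_closed quadratic_map_def)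
    qed
    obtain w where w: "w \<in> carrier (Z3_2ab L M)" and wQ: "\<And>X. X \<in> carrier L \<Longrightarrow> snd w (X, X) = Q X"
      using quadratic_map_is_trace[OF L M Qq] by blast
    \<comment> \<open>At each stage both classes have trace \<open>q i\<close>, hence they
      coincide.\<close>
    have "?\<Phi> (B3_2ab L M #>\<^bsub>Z3_2ab L M\<^esub> w) i = s i" if i: "i \<in> Obj C" for i
      unfolding \<Phi>[OF w i] sz[OF i] H3_coset_eq_iff[OF comm_group[OF i] M pb[OF w i] z[OF i]]
      using i by (simp add: trace_pullback wQ colim_in_closed Q q_def)
    then have "?\<Phi> (B3_2ab L M #>\<^bsub>Z3_2ab L M\<^esub> w) = s"
      using sP by (intro extensionalityI[of _ "Obj C"]) (auto simp: H3_colim_to_lim_def PiE_iff)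
    moreover have "B3_2ab L M #>\<^bsub>Z3_2ab L M\<^esub> w \<in> carrier (H3_2ab L M)"
      using w by (auto simp: H3_2ab_def carrier_FactGroup)
    ultimately show ?thesis by blast
  qed
  moreover note H3_colim_to_lim_hom[OF M]
  ultimately show ?thesis
    by (auto simp: iso_def bij_betw_def hom_in_carrier)
qed

end
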